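(* There exist a homogeneous $A$-hypergeometric system $H_A(\beta)$, a generic direction $w$, a fake exponent $v$ of $H_A(\beta)$ in the direction $w$, and an ordered negative support family $\mathcal N^\circ\subseteq\mathcal N_v$ for which $$\Phi\bigl(Q_{\mathcal N^\circ}(t):e\bigr)\subsetneq\Pi_{\mathcal N^\circ}:m_{v,\mathcal N^\circ},$$ such that the affine semigroup $\mathcal C(w)$ is normal and $\dim_{\mathbb C}\mathfrak D_{\mathcal N^\circ}(e)=1$. Moreover, the distinguished collection $\mathcal N_v$ is not ordered, but it gives the same two monomial ideals ($M_{\mathcal N_v}=M_{\mathcal N^\circ}$ and $P_{\mathcal N_v}(t)=P_{\mathcal N^\circ}(t)$), the same monomial $e$, and hence the same obstruction module as the ordered family $\mathcal N^\circ$. For the ordered family $\mathcal N^\circ$, ambient perturbation supplies a logarithmic coefficient that cannot be obtained by intrinsic perturbation; that is, the ambient coefficient space at $v$ for $\mathcal N^\circ$ contains an element, involving logarithms, that does not lie in the intrinsic coefficient space at $v$ for $\mathcal N^\circ$.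
   Context: System. $\mathbb N=\{0,1,2,\dots\}$. $A=(a_{ij})\in\mathbb Z^{d\times n}$ has rank $d$ and its columns lie in an affine hyperplane not containing the origin ("homogeneous"). $L=\ker_{\mathbb Z}(A)$, $r=\operatorname{rank}L=n-d$. For $u\in L$ write $u=u_+-u_-$ with $u_\pm\in\mathbb N^n$ of disjoint support. $I_A=\langle\partial^{u_+}-\partial^{u_-}\mid u\in L\rangle\subseteq\mathbb C[\partial_1,\dots,\partial_n]$. For $\beta\in\mathbb C^d$, $H_A(\beta)$ is the left ideal of the Weyl algebra in $x_1,\dots,x_n$ generated by $I_A$ and $\sum_j a_{ij}x_j\partial_j-\beta_i$ $(1\le i\le d)$. $\operatorname{in}_w$ takes terms of largest $w$-weight; $\operatorname{in}_{(-w,w)}$ is the initial ideal in the Weyl algebra for weights $-w$ on $x$, $w$ on $\partial$. A direction $w\in\mathbb R^n$ is generic if $\operatorname{in}_w(I_A)$ is a monomial ideal and $w$ lies in the interior of a full-dimensional cone of the small Gröbner fan of $H_A(\beta)$ (so $\operatorname{in}_{(-w',w')}(H_A(\beta))$ is constant for $w'$ in that interior). For $z\in\mathbb C^n$, $p\in\mathbb N^n$: $[z]_p=\prod_j z_j(z_j-1)\cdots(z_j-p_j+1)$. A fake exponent of $H_A(\beta)$ in the direction $w$ is $v\in\mathbb C^n$ with $Av=\beta$ and $[v]_p=0$ for every monomial $\partial^p\in\operatorname{in}_w(I_A)$. Semigroup. Let $\{\partial^{g^{(i)}_+}-\partial^{g^{(i)}_-}\}_i$ be the reduced Gröbner basis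 of $I_A$ in the direction $w$, the first monomial being initial (so $w\cdot g^{(i)}>0$, $g^{(i)}=g^{(i)}_+-g^{(i)}_-$). $\mathcal C(w)=\sum_i\mathbb Ng^{(i)}\subseteq L$. It is normal if it contains every element of the group it generates that lies in the real cone it spans. Negative supports. $\operatorname{nsupp}(z)=\{j\mid z_j\in\mathbb Z_{<0}\}$. For $u\in L$, $I_u=\operatorname{nsupp}(v+u)$; $I_0=\operatorname{nsupp}(v)$; $\mathcal S(v)=\{I_u\mid u\in L\}$. The distinguished collection is $\mathcal N_v=\{I\in\mathcal S(v)\mid w\cdot u\ge0\text{ for every }u\in L\text{ with }I_u=I\}$. A negative support family for $v$ is a set $\mathcal N$ with $I_0\in\mathcal N\subseteq\mathcal N_v$; it is ordered if $I\in\mathcal N$, $J\in\mathcal S(v)$, $J\subseteq I$ imply $J\in\mathcal N$. $K_{\mathcal N}=\bigcap_{I\in\mathcal N}I$. Ideals. $\widehat R=\mathbb C[[t_1,\dots,t_n]]$, $t^J=\prod_{j\in J}t_j$, $e=t^{I_0\setminus K_{\mathcal N}}$. $U=\langle At\rangle$ is generated by the entries of $At$; $M_{\mathcal N}=\langle t^{I\setminus K_{\mathcal N}}\mid I\in\mathcal N\rangle$; $P_{\mathcal N}(t)=\langle t^{(I\cup J)\setminus K_{\mathcal N}}\mid I\in\mathcal N,\ J\in\mathcal S(v)\setminus\mathcal N\rangle$; $Q_{\mathcal N}(t)=UM_{\mathcal N}+P_{\mathcal N}(t)$. A Gale dual $B$ is an $n\times r$ integer matrix whose columns form a $\mathbb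 Z$-basis of $L$; $\Phi:\widehat R\to\mathbb C[[s_1,\dots,s_r]]$, $t_j\mapsto(Bs)_j$; $\Pi_{\mathcal N}=\Phi(P_{\mathcal N}(t))$, $m_{v,\mathcal N}=\Phi(e)$. $\mathfrak D_{\mathcal N}(e)=\dfrac{(U+P_{\mathcal N}(t)):e}{(UM_{\mathcal N}+P_{\mathcal N}(t)):e}$. Coefficient spaces (for $\mathcal N$ ordered). The ambient coefficient space at $v$ for $\mathcal N$ (the coefficients of $x^v$ obtained by the Okuyama–Saito ambient perturbation) is the full coefficient space: all polynomials $p_0(\log x)$ for which there is a formal series $\sum_{u\in L}x^{v+u}p_u(\log x)$, $p_u\in\mathbb C[y_1,\dots,y_n]$, annihilated by $H_A(\beta)$, with $I_u\in\mathcal N$ whenever $p_u\ne0$. For the intrinsic one, put $a_u(s)=[v+Bs]_{u_-}/[v+Bs+u]_{u_+}$ and $\Psi_{\mathcal N}(x,s)=m_{v,\mathcal N}(s)\sum_{u\in L,\,I_u\in\mathcal N}a_u(s)x^{v+Bs+u}$, and let $\mathcal P_{v,\mathcal N}\subseteq\mathbb C[s_1,\dots,s_r]$ be generated by the products $\prod_{j\in(I\cup J)\setminus K_{\mathcal N}}(Bs)_j$, $I\in\mathcal N$, $J\in\mathcal S(v)\setminus\mathcal N$. For a homogeneous ideal $I\subseteq\mathbb C[s]$, $I^\perp=\{q(\partial_s)\mid(q(\partial_s)f)|_{s=0}=0\ \forall f\in I\}$. The intrinsic coefficient space at $v$ for $\mathcal N$ is the space of coefficients of $x^v$ in the series $q(\partial_s)\Psi_{\mathcal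 N}(x,s)|_{s=0}$, $q\in\mathcal P_{v,\mathcal N}^\perp$. *)

theory Defs
  imports
    "HOL-Library.Poly_Mapping"
    "HOL-Analysis.Abstract_Euclidean_Space"
    "Jordan_Normal_Form.DL_Rank"
begin

text \<open>
  Sizes \<open>n, d, r\<close> are ordinary natural numbers, all indices start at \<open>0\<close>, and a vector of length
  \<open>n\<close> is a function on \<^typ>\<open>nat\<close> that vanishes from \<open>n\<close> on; this is the convention of
  \<^const>\<open>Euclidean_space\<close>.  Exponents of monomials are finitely supported maps, so polynomial and
  power series rings in \<open>n\<close> variables appear as subrings of rings in countably many variables.
\<close>

section \<open>Monomials, polynomials, power series\<close>

abbreviation keys :: "('a \<Rightarrow>\<^sub>0 'b::zero) \<Rightarrow> 'a set" where "keys \<equiv> Poly_Mapping.keys"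
abbreviation lookup :: "('a \<Rightarrow>\<^sub>0 'b::zero) \<Rightarrow> 'a \<Rightarrow> 'b" where "lookup \<equiv> Poly_Mapping.lookup"

type_synonym exps = "nat \<Rightarrow>\<^sub>0 nat"
type_synonym 'a mpoly = "exps \<Rightarrow>\<^sub>0 'a"

definition vectors :: "nat \<Rightarrow> (nat \<Rightarrow> 'a::zero) set" where
  "vectors n = {z. \<forall>j\<ge>n. z j = 0}"

definition exps_of :: "nat \<Rightarrow> exps set" where
  "exps_of n = {m. keys m \<subseteq> {..<n}}"

definition exp_dvd :: "exps \<Rightarrow> exps \<Rightarrow> bool" where
  "exp_dvd a b \<longleftrightarrow> (\<forall>j. lookup a j \<le> lookup b j)"

definition exp_degree :: "exps \<Rightarrow> nat" where
  "exp_degree m = (\<Sum>j\<in>keys m. lookup m j)"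

definition exp_fact :: "exps \<Rightarrow> nat" where
  "exp_fact m = (\<Prod>j\<in>keys m. fact (lookup m j))"

definition polys :: "nat \<Rightarrow> 'a::zero mpoly set" where
  "polys n = {p. keys p \<subseteq> exps_of n}"

definition mp_const :: "'a::zero \<Rightarrow> 'a mpoly" where
  "mp_const c = Poly_Mapping.single 0 c"

definition mp_var :: "nat \<Rightarrow> 'a::zero_neq_one mpoly" where
  "mp_var j = Poly_Mapping.single (Poly_Mapping.single j 1) 1"

definition mp_deriv :: "nat \<Rightarrow> 'a::semiring_1 mpoly \<Rightarrow> 'a mpoly" where
  "mp_deriv j p = (\<Sum>m\<in>keys p.
     Poly_Mapping.single (m - Poly_Mapping.single j 1) (of_nat (lookup m j) * lookup p m))"

lemma finite_exp_dvd: "finite {a. exp_dvd a m}"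
proof -
  let ?F = "{f :: nat \<Rightarrow> nat. (\<forall>x. (x \<in> keys m \<longrightarrow> f x \<in> {..Max (insert 0 (lookup m ` keys m))})
                           \<and> (x \<notin> keys m \<longrightarrow> f x = 0))}"
  have "finite ?F"
    by (rule finite_set_of_finite_funs) auto
  moreover have "lookup ` {a. exp_dvd a m} \<subseteq> ?F"
  proof safe
    fix a x assume a: "exp_dvd a m"
    have le: "lookup a x \<le> lookup m x"
      using a by (simp add: exp_dvd_def)
    { assume "x \<in> keys m"
      hence "lookup m x \<le> Max (insert 0 (lookup m ` keys m))"
        by (intro Max_ge) auto
      with le show "lookup a x \<le> Max (insert 0 (lookup m ` keys m))"
        by linarith }
    { assume "x \<notin> keys m"
      with le show "lookup a x = 0"
        by (simp add: in_keys_iff) }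
  qed
  ultimately have "finite (lookup ` {a. exp_dvd a m})"
    by (rule finite_subset[rotated])
  thus ?thesis
    by (rule finite_imageD) (auto intro: inj_onI)
qed

lemma finite_exp_splits: "finite {(a, b). a + b = (m :: exps)}"
proof -
  have "{(a, b). a + b = m} \<subseteq> {a. exp_dvd a m} \<times> {b. exp_dvd b m}"
    by (auto simp: exp_dvd_def lookup_add)
  thus ?thesis
    using finite_exp_dvd finite_cartesian_product finite_subset by blast
qed

typedef 'a mfps = "UNIV :: (exps \<Rightarrow> 'a) set"
  morphisms mfps_nth Abs_mfps by simp

setup_lifting type_definition_mfps

lemma mfps_eqI: "(\<And>m. mfps_nth f m = mfps_nth g m) \<Longrightarrow> f = g"
  by (metis ext mfps_nth_inject)

instantiation mfps :: (comm_ring_1) comm_ring_1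
begin

lift_definition zero_mfps :: "'a mfps" is "\<lambda>_. 0" .
lift_definition one_mfps :: "'a mfps" is "\<lambda>m. if m = 0 then 1 else 0" .
lift_definition plus_mfps :: "'a mfps \<Rightarrow> 'a mfps \<Rightarrow> 'a mfps" is "\<lambda>f g m. f m + g m" .
lift_definition minus_mfps :: "'a mfps \<Rightarrow> 'a mfps \<Rightarrow> 'a mfps" is "\<lambda>f g m. f m - g m" .
lift_definition uminus_mfps :: "'a mfps \<Rightarrow> 'a mfps" is "\<lambda>f m. - f m" .
lift_definition times_mfps :: "'a mfps \<Rightarrow> 'a mfps \<Rightarrow> 'a mfps"
  is "\<lambda>f g m. \<Sum>(a, b) | a + b = m. f a * g b" .

instance
proof
  fix f g h :: "'a mfps"
  show "f * g * h = f * (g * h)"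
  proof (rule mfps_eqI)
    fix m
    let ?S = "\<lambda>m. {(a, b). a + b = (m :: exps)}"
    have fin: "finite (?S k)" for k
      by (rule finite_exp_splits)
    have "mfps_nth (f * g * h) m
        = (\<Sum>p\<in>?S m. \<Sum>q\<in>?S (fst p). mfps_nth f (fst q) * mfps_nth g (snd q) * mfps_nth h (snd p))"
      by (simp add: times_mfps.rep_eq sum_distrib_right case_prod_beta)
    also have "\<dots> = (\<Sum>(p, q)\<in>Sigma (?S m) (\<lambda>p. ?S (fst p)).
                   mfps_nth f (fst q) * mfps_nth g (snd q) * mfps_nth h (snd p))"
      by (rule sum.Sigma) (use fin in auto)
    also have "\<dots> = (\<Sum>(p, q)\<in>Sigma (?S m) (\<lambda>p. ?S (snd p)).
                   mfps_nth f (fst p) * (mfps_nth g (fst q) * mfps_nth h (snd q)))"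
      by (rule sum.reindex_bij_witness[where
             i = "\<lambda>(p, q). ((fst p + fst q, snd q), (fst p, fst q))" and
             j = "\<lambda>(p, q). ((fst q, snd q + snd p), (snd q, snd p))"])
         (auto simp: ac_simps)
    also have "\<dots> = (\<Sum>p\<in>?S m. \<Sum>q\<in>?S (snd p).
                   mfps_nth f (fst p) * (mfps_nth g (fst q) * mfps_nth h (snd q)))"
      by (rule sum.Sigma[symmetric]) (use fin in auto)
    also have "\<dots> = mfps_nth (f * (g * h)) m"
      by (simp add: times_mfps.rep_eq sum_distrib_left case_prod_beta)
    finally show "mfps_nth (f * g * h) m = mfps_nth (f * (g * h)) m" .
  qed
  show "f * g = g * f"
  proof (rule mfps_eqI)
    fix m
    show "mfps_nth (f * g) m = mfps_nth (g * f) m"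
      unfolding times_mfps.rep_eq
      by (rule sum.reindex_bij_witness[where i = prod.swap and j = prod.swap])
         (auto simp: ac_simps)
  qed
  show "1 * f = f"
  proof (rule mfps_eqI)
    fix m
    have "mfps_nth (1 * f) m = (\<Sum>p\<in>{(a, b). a + b = m}. if p = (0, m) then mfps_nth f m else 0)"
      unfolding times_mfps.rep_eq one_mfps.rep_eq
      by (rule sum.cong) (auto split: if_splits)
    also have "\<dots> = mfps_nth f m"
      using finite_exp_splits[of m] by (simp add: sum.delta)
    finally show "mfps_nth (1 * f) m = mfps_nth f m" .
  qed
  show "(f + g) * h = f * h + g * h"
    by (rule mfps_eqI)
       (simp add: times_mfps.rep_eq plus_mfps.rep_eq case_prod_beta sum.distrib ring_distribs)
  show "(0 :: 'a mfps) \<noteq> 1"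
    by (metis one_mfps.rep_eq zero_mfps.rep_eq zero_neq_one)
qed (rule mfps_eqI,
     simp add: plus_mfps.rep_eq minus_mfps.rep_eq uminus_mfps.rep_eq zero_mfps.rep_eq algebra_simps)+

end

definition series :: "nat \<Rightarrow> 'a::zero mfps set" where
  "series n = {f. \<forall>m. mfps_nth f m \<noteq> 0 \<longrightarrow> m \<in> exps_of n}"

definition mfps_const :: "'a::zero \<Rightarrow> 'a mfps" where
  "mfps_const c = Abs_mfps (\<lambda>m. if m = 0 then c else 0)"

definition mfps_var :: "nat \<Rightarrow> 'a::zero_neq_one mfps" where
  "mfps_var j = Abs_mfps (\<lambda>m. if m = Poly_Mapping.single j 1 then 1 else 0)"

text \<open>The falling factorial \<open>[z]\<^sub>p = \<Prod>\<^sub>j z\<^sub>j (z\<^sub>j - 1) \<dots> (z\<^sub>j - p\<^sub>j + 1)\<close>.\<close>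

definition falling :: "(nat \<Rightarrow> 'a::comm_ring_1) \<Rightarrow> exps \<Rightarrow> 'a" where
  "falling z p = (\<Prod>j\<in>keys p. \<Prod>k<lookup p j. z j - of_nat k)"

section \<open>Ideals\<close>

text \<open>
  The left ideal generated by \<open>S\<close> in a ring with carrier \<open>R\<close> and multiplication \<open>mul\<close>; the same
  definition serves the commutative rings, where \<open>R\<close> singles out the elements in the first \<open>n\<close>
  variables.
\<close>

definition left_ideal_gen :: "('a::comm_monoid_add \<Rightarrow> 'a \<Rightarrow> 'a) \<Rightarrow> 'a set \<Rightarrow> 'a set \<Rightarrow> 'a set" where
  "left_ideal_gen mul R S =
     {\<Sum>i<k. mul (a i) (s i) | (k::nat) a s. \<forall>i<k. a i \<in> R \<and> s i \<in> S}"

abbreviation ideal_gen :: "'a::comm_ring_1 set \<Rightarrow> 'a set \<Rightarrow> 'a set" where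
  "ideal_gen \<equiv> left_ideal_gen (*)"

definition ideal_sum :: "'a::comm_ring_1 set \<Rightarrow> 'a set \<Rightarrow> 'a set" where
  "ideal_sum I J = {f + g | f g. f \<in> I \<and> g \<in> J}"

definition ideal_mult :: "'a::comm_ring_1 set \<Rightarrow> 'a set \<Rightarrow> 'a set \<Rightarrow> 'a set" where
  "ideal_mult R I J = ideal_gen R {f * g | f g. f \<in> I \<and> g \<in> J}"

definition colon :: "'a::comm_ring_1 set \<Rightarrow> 'a set \<Rightarrow> 'a \<Rightarrow> 'a set" where
  "colon R I e = {f \<in> R. f * e \<in> I}"

text \<open>The sum of the terms of largest weight (\<open>0\<close> if \<open>f = 0\<close>).\<close>

definition initial_form :: "('k \<Rightarrow> real) \<Rightarrow> ('k \<Rightarrow>\<^sub>0 'a::comm_monoid_add) \<Rightarrow> ('k \<Rightarrow>\<^sub>0 'a)" where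
  "initial_form wt f =
     (\<Sum>m \<in> {m \<in> keys f. \<forall>m'\<in>keys f. wt m' \<le> wt m}. Poly_Mapping.single m (lookup f m))"

definition weight :: "(nat \<Rightarrow> real) \<Rightarrow> exps \<Rightarrow> real" where
  "weight w m = (\<Sum>j\<in>keys m. w j * real (lookup m j))"

definition initial_ideal :: "nat \<Rightarrow> (nat \<Rightarrow> real) \<Rightarrow> complex mpoly set \<Rightarrow> complex mpoly set" where
  "initial_ideal n w I = ideal_gen (polys n) (initial_form (weight w) ` I)"

definition monomial_ideal :: "nat \<Rightarrow> complex mpoly set \<Rightarrow> bool" where
  "monomial_ideal n I \<longleftrightarrow>
     (\<exists>S \<subseteq> exps_of n. I = ideal_gen (polys n) ((\<lambda>m. Poly_Mapping.single m 1) ` S))"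

definition reduced_groebner_basis ::
  "nat \<Rightarrow> (nat \<Rightarrow> real) \<Rightarrow> complex mpoly set \<Rightarrow> complex mpoly set \<Rightarrow> bool" where
  "reduced_groebner_basis n w I \<G> \<longleftrightarrow>
     finite \<G> \<and> \<G> \<subseteq> I \<and>
     (\<forall>f\<in>\<G>. \<exists>m. initial_form (weight w) f = Poly_Mapping.single m 1) \<and>
     ideal_gen (polys n) (initial_form (weight w) ` \<G>) = initial_ideal n w I \<and>
     (\<forall>f\<in>\<G>. \<forall>g\<in>\<G>. \<forall>m\<in>keys f. \<forall>l\<in>keys (initial_form (weight w) g).
        exp_dvd l m \<longrightarrow> g = f \<and> l = m)"

section \<open>The matrix, its lattice, and the toric ideal\<close>

definition homogeneous_matrix :: "nat \<Rightarrow> nat \<Rightarrow> (nat \<Rightarrow> nat \<Rightarrow> int) \<Rightarrow> bool" where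
  "homogeneous_matrix d n A \<longleftrightarrow>
     vec_space.rank d (mat d n (\<lambda>(i, j). rat_of_int (A i j))) = d \<and>
     (\<exists>(c :: nat \<Rightarrow> real) b. b \<noteq> 0 \<and> (\<forall>j<n. (\<Sum>i<d. c i * of_int (A i j)) = b))"

definition relation_lattice :: "nat \<Rightarrow> nat \<Rightarrow> (nat \<Rightarrow> nat \<Rightarrow> int) \<Rightarrow> (nat \<Rightarrow> int) set" where
  "relation_lattice d n A = {u \<in> vectors n. \<forall>i<d. (\<Sum>j<n. A i j * u j) = 0}"

definition gale_dual ::
  "nat \<Rightarrow> nat \<Rightarrow> nat \<Rightarrow> (nat \<Rightarrow> nat \<Rightarrow> int) \<Rightarrow> (nat \<Rightarrow> nat \<Rightarrow> int) \<Rightarrow> bool" where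
  "gale_dual d n r A B \<longleftrightarrow>
     (\<forall>i<r. (\<lambda>j. B j i) \<in> relation_lattice d n A) \<and>
     (\<forall>u \<in> relation_lattice d n A. \<exists>!c. c \<in> vectors r \<and> (\<forall>j<n. u j = (\<Sum>i<r. B j i * c i)))"

definition pos_part :: "(nat \<Rightarrow> int) \<Rightarrow> exps" where
  "pos_part u = Abs_poly_mapping (\<lambda>j. nat (u j))"

definition neg_part :: "(nat \<Rightarrow> int) \<Rightarrow> exps" where
  "neg_part u = Abs_poly_mapping (\<lambda>j. nat (- u j))"

definition toric_binomial :: "(nat \<Rightarrow> int) \<Rightarrow> complex mpoly" where
  "toric_binomial u = Poly_Mapping.single (pos_part u) 1 - Poly_Mapping.single (neg_part u) 1"

definition toric_ideal :: "nat \<Rightarrow> nat \<Rightarrow> (nat \<Rightarrow> nat \<Rightarrow> int) \<Rightarrow> complex mpoly set" where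
  "toric_ideal d n A = ideal_gen (polys n) (toric_binomial ` relation_lattice d n A)"

text \<open>
  \<open>G\<close> lists the vectors \<open>g\<^sup>(\<^sup>i\<^sup>)\<close> of the reduced Groebner basis, oriented so that the first monomial
  is the initial one.
\<close>

definition groebner_vectors ::
  "nat \<Rightarrow> nat \<Rightarrow> (nat \<Rightarrow> nat \<Rightarrow> int) \<Rightarrow> (nat \<Rightarrow> real) \<Rightarrow> (nat \<Rightarrow> int) set \<Rightarrow> bool" where
  "groebner_vectors d n A w G \<longleftrightarrow>
     finite G \<and> G \<subseteq> relation_lattice d n A \<and>
     (\<forall>g\<in>G. initial_form (weight w) (toric_binomial g) = Poly_Mapping.single (pos_part g) 1) \<and>
     reduced_groebner_basis n w (toric_ideal d n A) (toric_binomial ` G)"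

definition semigroup_gen :: "(nat \<Rightarrow> int) set \<Rightarrow> (nat \<Rightarrow> int) set" where
  "semigroup_gen G = {u. \<exists>c :: (nat \<Rightarrow> int) \<Rightarrow> nat. u = (\<lambda>j. \<Sum>g\<in>G. int (c g) * g j)}"

definition group_gen :: "(nat \<Rightarrow> int) set \<Rightarrow> (nat \<Rightarrow> int) set" where
  "group_gen G = {u. \<exists>c :: (nat \<Rightarrow> int) \<Rightarrow> int. u = (\<lambda>j. \<Sum>g\<in>G. c g * g j)}"

definition real_cone :: "(nat \<Rightarrow> int) set \<Rightarrow> (nat \<Rightarrow> real) set" where
  "real_cone G = {x. \<exists>c :: (nat \<Rightarrow> int) \<Rightarrow> real.
     (\<forall>g\<in>G. c g \<ge> 0) \<and> x = (\<lambda>j. \<Sum>g\<in>G. c g * of_int (g j))}"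

definition normal_semigroup :: "(nat \<Rightarrow> int) set \<Rightarrow> bool" where
  "normal_semigroup G \<longleftrightarrow>
     (\<forall>u \<in> group_gen G. (\<lambda>j. real_of_int (u j)) \<in> real_cone G \<longrightarrow> u \<in> semigroup_gen G)"

section \<open>The Weyl algebra and the hypergeometric ideal\<close>

text \<open>
  Elements are stored in normally ordered form: \<open>(a, b)\<close> stands for \<open>x\<^sup>a \<partial>\<^sup>b\<close>.  The product is the
  Leibniz rule \<open>\<partial>\<^sup>b x\<^sup>c = \<Sum>\<^sub>k k! (b choose k) (c choose k) x\<^bsup>c-k\<^esup> \<partial>\<^bsup>b-k\<^esup>\<close>, in multi-index notation.
\<close>

type_synonym weyl = "exps \<times> exps \<Rightarrow>\<^sub>0 complex"

definition weyl_algebra :: "nat \<Rightarrow> weyl set" where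
  "weyl_algebra n = {P. keys P \<subseteq> exps_of n \<times> exps_of n}"

definition contractions :: "exps \<Rightarrow> exps \<Rightarrow> exps set" where
  "contractions b c = {k. exp_dvd k b \<and> exp_dvd k c}"

definition leibniz_coeff :: "exps \<Rightarrow> exps \<Rightarrow> exps \<Rightarrow> nat" where
  "leibniz_coeff b c k = (\<Prod>j\<in>keys k.
     fact (lookup k j) * (lookup b j choose lookup k j) * (lookup c j choose lookup k j))"

definition weyl_mult :: "weyl \<Rightarrow> weyl \<Rightarrow> weyl" where
  "weyl_mult P Q =
     (\<Sum>(a, b)\<in>keys P. \<Sum>(c, e)\<in>keys Q. \<Sum>k\<in>contractions b c.
        Poly_Mapping.single (a + (c - k), (b - k) + e)
          (of_nat (leibniz_coeff b c k) * lookup P (a, b) * lookup Q (c, e)))"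

definition diff_op :: "complex mpoly \<Rightarrow> weyl" where
  "diff_op f = (\<Sum>m\<in>keys f. Poly_Mapping.single (0, m) (lookup f m))"

definition euler_op ::
  "nat \<Rightarrow> (nat \<Rightarrow> nat \<Rightarrow> int) \<Rightarrow> (nat \<Rightarrow> complex) \<Rightarrow> nat \<Rightarrow> weyl" where
  "euler_op n A \<beta> i =
     (\<Sum>j<n. Poly_Mapping.single (Poly_Mapping.single j 1, Poly_Mapping.single j 1) (of_int (A i j)))
     - Poly_Mapping.single (0, 0) (\<beta> i)"

definition hypergeometric_ideal ::
  "nat \<Rightarrow> nat \<Rightarrow> (nat \<Rightarrow> nat \<Rightarrow> int) \<Rightarrow> (nat \<Rightarrow> complex) \<Rightarrow> weyl set" where
  "hypergeometric_ideal d n A \<beta> =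
     left_ideal_gen weyl_mult (weyl_algebra n)
       (diff_op ` toric_ideal d n A \<union> euler_op n A \<beta> ` {..<d})"

section \<open>The small Groebner fan and generic directions\<close>

text \<open>
  The Groebner fan of an ideal \<open>H\<close> of the Weyl algebra is, as usual, that of its homogenization in the
  homogenized Weyl algebra, where \<open>\<partial>\<^sub>j x\<^sub>j = x\<^sub>j \<partial>\<^sub>j + h\<^sup>2\<close> and \<open>h\<close> is central of weight \<open>0\<close>.  Its classes
  are convex cones, which need not hold for the classes of equal initial ideals of \<open>H\<close> itself.
  Setting \<open>h = 1\<close> turns the initial ideal of the homogenization into that of \<open>H\<close>, so the initial
  ideal of \<open>H\<close> is constant on every class.  In a key, \<open>(a, b, c)\<close> stands for \<open>x\<^sup>a \<partial>\<^sup>b h\<^sup>c\<close>.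
\<close>

type_synonym hweyl = "exps \<times> exps \<times> nat \<Rightarrow>\<^sub>0 complex"

definition hweyl_algebra :: "nat \<Rightarrow> hweyl set" where
  "hweyl_algebra n = {P. keys P \<subseteq> exps_of n \<times> exps_of n \<times> UNIV}"

definition hweyl_mult :: "hweyl \<Rightarrow> hweyl \<Rightarrow> hweyl" where
  "hweyl_mult P Q =
     (\<Sum>(a, b, p)\<in>keys P. \<Sum>(c, e, q)\<in>keys Q. \<Sum>k\<in>contractions b c.
        Poly_Mapping.single (a + (c - k), (b - k) + e, p + q + 2 * exp_degree k)
          (of_nat (leibniz_coeff b c k) * lookup P (a, b, p) * lookup Q (c, e, q)))"

definition weyl_degree :: "weyl \<Rightarrow> nat" where
  "weyl_degree P = Max (insert 0 ((\<lambda>(a, b). exp_degree a + exp_degree b) ` keys P))"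

definition homogenize :: "weyl \<Rightarrow> hweyl" where
  "homogenize P = (\<Sum>(a, b)\<in>keys P.
     Poly_Mapping.single (a, b, weyl_degree P - (exp_degree a + exp_degree b)) (lookup P (a, b)))"

definition homogenized_ideal :: "nat \<Rightarrow> weyl set \<Rightarrow> hweyl set" where
  "homogenized_ideal n H = left_ideal_gen hweyl_mult (hweyl_algebra n) (homogenize ` H)"

definition hweyl_weight :: "(nat \<Rightarrow> real) \<Rightarrow> exps \<times> exps \<times> nat \<Rightarrow> real" where
  "hweyl_weight w = (\<lambda>(a, b, c). weight w b - weight w a)"

definition hweyl_initial_ideal :: "nat \<Rightarrow> (nat \<Rightarrow> real) \<Rightarrow> hweyl set \<Rightarrow> hweyl set" where
  "hweyl_initial_ideal n w I =
     left_ideal_gen hweyl_mult (hweyl_algebra n) (initial_form (hweyl_weight w) ` I)"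

definition small_groebner_cone :: "nat \<Rightarrow> weyl set \<Rightarrow> (nat \<Rightarrow> real) \<Rightarrow> (nat \<Rightarrow> real) set" where
  "small_groebner_cone n H w =
     Euclidean_space n closure_of
       {w' \<in> topspace (Euclidean_space n).
          hweyl_initial_ideal n w' (homogenized_ideal n H) =
          hweyl_initial_ideal n w (homogenized_ideal n H)}"

definition small_groebner_fan :: "nat \<Rightarrow> weyl set \<Rightarrow> (nat \<Rightarrow> real) set set" where
  "small_groebner_fan n H = small_groebner_cone n H ` topspace (Euclidean_space n)"

text \<open>A cone with an interior point is full-dimensional.\<close>

definition generic_direction ::
  "nat \<Rightarrow> nat \<Rightarrow> (nat \<Rightarrow> nat \<Rightarrow> int) \<Rightarrow> (nat \<Rightarrow> complex) \<Rightarrow> (nat \<Rightarrow> real) \<Rightarrow> bool" where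
  "generic_direction d n A \<beta> w \<longleftrightarrow>
     w \<in> topspace (Euclidean_space n) \<and>
     monomial_ideal n (initial_ideal n w (toric_ideal d n A)) \<and>
     (\<exists>C \<in> small_groebner_fan n (hypergeometric_ideal d n A \<beta>). w \<in> Euclidean_space n interior_of C)"

definition fake_exponent ::
  "nat \<Rightarrow> nat \<Rightarrow> (nat \<Rightarrow> nat \<Rightarrow> int) \<Rightarrow> (nat \<Rightarrow> complex) \<Rightarrow> (nat \<Rightarrow> real) \<Rightarrow> (nat \<Rightarrow> complex) \<Rightarrow> bool" where
  "fake_exponent d n A \<beta> w v \<longleftrightarrow>
     v \<in> vectors n \<and> (\<forall>i<d. (\<Sum>j<n. of_int (A i j) * v j) = \<beta> i) \<and>
     (\<forall>p. Poly_Mapping.single p 1 \<in> initial_ideal n w (toric_ideal d n A) \<longrightarrow> falling v p = 0)"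

section \<open>Negative supports\<close>

definition nsupp :: "nat \<Rightarrow> (nat \<Rightarrow> complex) \<Rightarrow> nat set" where
  "nsupp n z = {j. j < n \<and> (\<exists>k::int. k < 0 \<and> z j = of_int k)}"

definition nsupp_at :: "nat \<Rightarrow> (nat \<Rightarrow> complex) \<Rightarrow> (nat \<Rightarrow> int) \<Rightarrow> nat set" where
  "nsupp_at n v u = nsupp n (\<lambda>j. v j + of_int (u j))"

definition nsupps :: "nat \<Rightarrow> nat \<Rightarrow> (nat \<Rightarrow> nat \<Rightarrow> int) \<Rightarrow> (nat \<Rightarrow> complex) \<Rightarrow> nat set set" where
  "nsupps d n A v = nsupp_at n v ` relation_lattice d n A"

definition distinguished_collection ::
  "nat \<Rightarrow> nat \<Rightarrow> (nat \<Rightarrow> nat \<Rightarrow> int) \<Rightarrow> (nat \<Rightarrow> real) \<Rightarrow> (nat \<Rightarrow> complex) \<Rightarrow> nat set set" where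
  "distinguished_collection d n A w v =
     {I \<in> nsupps d n A v.
        \<forall>u \<in> relation_lattice d n A. nsupp_at n v u = I \<longrightarrow> (\<Sum>j<n. w j * of_int (u j)) \<ge> 0}"

definition negative_support_family ::
  "nat \<Rightarrow> nat \<Rightarrow> (nat \<Rightarrow> nat \<Rightarrow> int) \<Rightarrow> (nat \<Rightarrow> real) \<Rightarrow> (nat \<Rightarrow> complex) \<Rightarrow> nat set set \<Rightarrow> bool" where
  "negative_support_family d n A w v \<N> \<longleftrightarrow>
     nsupp n v \<in> \<N> \<and> \<N> \<subseteq> distinguished_collection d n A w v"

definition ordered_family ::
  "nat \<Rightarrow> nat \<Rightarrow> (nat \<Rightarrow> nat \<Rightarrow> int) \<Rightarrow> (nat \<Rightarrow> complex) \<Rightarrow> nat set set \<Rightarrow> bool" where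
  "ordered_family d n A v \<N> \<longleftrightarrow> (\<forall>I\<in>\<N>. \<forall>J \<in> nsupps d n A v. J \<subseteq> I \<longrightarrow> J \<in> \<N>)"

section \<open>Ideals attached to a negative support family\<close>

definition t_prod :: "nat set \<Rightarrow> complex mfps" where
  "t_prod J = (\<Prod>j\<in>J. mfps_var j)"

definition e_monomial :: "nat \<Rightarrow> (nat \<Rightarrow> complex) \<Rightarrow> nat set set \<Rightarrow> complex mfps" where
  "e_monomial n v \<N> = t_prod (nsupp n v - \<Inter>\<N>)"

definition U_ideal :: "nat \<Rightarrow> nat \<Rightarrow> (nat \<Rightarrow> nat \<Rightarrow> int) \<Rightarrow> complex mfps set" where
  "U_ideal d n A = ideal_gen (series n) ((\<lambda>i. \<Sum>j<n. of_int (A i j) * mfps_var j) ` {..<d})"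

definition M_ideal :: "nat \<Rightarrow> nat set set \<Rightarrow> complex mfps set" where
  "M_ideal n \<N> = ideal_gen (series n) ((\<lambda>I. t_prod (I - \<Inter>\<N>)) ` \<N>)"

definition P_ideal ::
  "nat \<Rightarrow> nat \<Rightarrow> (nat \<Rightarrow> nat \<Rightarrow> int) \<Rightarrow> (nat \<Rightarrow> complex) \<Rightarrow> nat set set \<Rightarrow> complex mfps set" where
  "P_ideal d n A v \<N> = ideal_gen (series n)
     {t_prod ((I \<union> J) - \<Inter>\<N>) | I J. I \<in> \<N> \<and> J \<in> nsupps d n A v - \<N>}"

definition Q_ideal ::
  "nat \<Rightarrow> nat \<Rightarrow> (nat \<Rightarrow> nat \<Rightarrow> int) \<Rightarrow> (nat \<Rightarrow> complex) \<Rightarrow> nat set set \<Rightarrow> complex mfps set" where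
  "Q_ideal d n A v \<N> =
     ideal_sum (ideal_mult (series n) (U_ideal d n A) (M_ideal n \<N>)) (P_ideal d n A v \<N>)"

definition obstruction_num ::
  "nat \<Rightarrow> nat \<Rightarrow> (nat \<Rightarrow> nat \<Rightarrow> int) \<Rightarrow> (nat \<Rightarrow> complex) \<Rightarrow> nat set set \<Rightarrow> complex mfps set" where
  "obstruction_num d n A v \<N> =
     colon (series n) (ideal_sum (U_ideal d n A) (P_ideal d n A v \<N>)) (e_monomial n v \<N>)"

definition obstruction_den ::
  "nat \<Rightarrow> nat \<Rightarrow> (nat \<Rightarrow> nat \<Rightarrow> int) \<Rightarrow> (nat \<Rightarrow> complex) \<Rightarrow> nat set set \<Rightarrow> complex mfps set" where
  "obstruction_den d n A v \<N> = colon (series n) (Q_ideal d n A v \<N>) (e_monomial n v \<N>)"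

definition quotient_cosets :: "complex mfps set \<Rightarrow> complex mfps set \<Rightarrow> complex mfps set set" where
  "quotient_cosets V W = (\<lambda>f. {f + g | g. g \<in> W}) ` V"

definition obstruction_module ::
  "nat \<Rightarrow> nat \<Rightarrow> (nat \<Rightarrow> nat \<Rightarrow> int) \<Rightarrow> (nat \<Rightarrow> complex) \<Rightarrow> nat set set \<Rightarrow> complex mfps set set" where
  "obstruction_module d n A v \<N> =
     quotient_cosets (obstruction_num d n A v \<N>) (obstruction_den d n A v \<N>)"

text \<open>The classes of \<open>b\<^sub>0, \<dots>, b\<^bsub>k-1\<^esub>\<close> form a basis of the complex vector space \<open>V / W\<close>.\<close>

definition quotient_has_dim :: "complex mfps set \<Rightarrow> complex mfps set \<Rightarrow> nat \<Rightarrow> bool" where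
  "quotient_has_dim V W k \<longleftrightarrow>
     W \<subseteq> V \<and>
     (\<exists>b. (\<forall>i<k. b i \<in> V) \<and>
        (\<forall>f\<in>V. \<exists>!c. c \<in> vectors k \<and> f - (\<Sum>i<k. mfps_const (c i) * b i) \<in> W))"

definition gale_form :: "nat \<Rightarrow> (nat \<Rightarrow> nat \<Rightarrow> int) \<Rightarrow> nat \<Rightarrow> complex mfps" where
  "gale_form r B j = (\<Sum>i<r. of_int (B j i) * mfps_var i)"

text \<open>
  The substitution \<open>t\<^sub>j \<mapsto> (Bs)\<^sub>j\<close>.  The linear forms \<open>(Bs)\<^sub>j\<close> are homogeneous of degree \<open>1\<close>, so only the
  finitely many \<open>t\<close>-monomials of degree \<open>|k|\<close> contribute to the coefficient of \<open>s\<^sup>k\<close>.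
\<close>

definition Phi :: "nat \<Rightarrow> nat \<Rightarrow> (nat \<Rightarrow> nat \<Rightarrow> int) \<Rightarrow> complex mfps \<Rightarrow> complex mfps" where
  "Phi n r B f = Abs_mfps (\<lambda>k.
     \<Sum>m \<in> {m \<in> exps_of n. exp_degree m = exp_degree k}.
       mfps_nth f m * mfps_nth (\<Prod>j<n. gale_form r B j ^ lookup m j) k)"

section \<open>The ambient coefficient space\<close>

text \<open>
  A formal series \<open>\<Sum>\<^sub>u x\<^bsup>v+u\<^esup> p\<^sub>u(log x)\<close>, with \<open>u\<close> ranging over integer vectors, is the family
  \<open>u \<mapsto> p\<^sub>u\<close> of polynomials in \<open>y = log x\<close>.  The operators below read off the action on such a
  series from
  \<open>\<partial>\<^sub>j (x\<^sup>z q(log x)) = x\<^bsup>z - e\<^sub>j\<^esup> (z\<^sub>j q + \<partial>q/\<partial>y\<^sub>j)(log x)\<close>.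
\<close>

type_synonym log_series = "(nat \<Rightarrow> int) \<Rightarrow> complex mpoly"

definition x_act :: "nat \<Rightarrow> log_series \<Rightarrow> log_series" where
  "x_act j p = (\<lambda>u. p (u(j := u j - 1)))"

definition d_act :: "(nat \<Rightarrow> complex) \<Rightarrow> nat \<Rightarrow> log_series \<Rightarrow> log_series" where
  "d_act v j p = (\<lambda>u. let q = p (u(j := u j + 1)) in
     mp_const (v j + of_int (u j + 1)) * q + mp_deriv j q)"

definition monomial_act ::
  "nat \<Rightarrow> (nat \<Rightarrow> complex) \<Rightarrow> exps \<times> exps \<Rightarrow> log_series \<Rightarrow> log_series" where
  "monomial_act n v = (\<lambda>(a, b) p.
     foldr (\<lambda>j. x_act j ^^ lookup a j) [0..<n] (foldr (\<lambda>j. d_act v j ^^ lookup b j) [0..<n] p))"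

definition weyl_act ::
  "nat \<Rightarrow> (nat \<Rightarrow> complex) \<Rightarrow> weyl \<Rightarrow> log_series \<Rightarrow> log_series" where
  "weyl_act n v P p = (\<lambda>u. \<Sum>k\<in>keys P. mp_const (lookup P k) * monomial_act n v k p u)"

definition ambient_coefficient_space ::
  "nat \<Rightarrow> nat \<Rightarrow> (nat \<Rightarrow> nat \<Rightarrow> int) \<Rightarrow> (nat \<Rightarrow> complex) \<Rightarrow> (nat \<Rightarrow> complex) \<Rightarrow> nat set set
     \<Rightarrow> complex mpoly set" where
  "ambient_coefficient_space d n A \<beta> v \<N> =
     {p (\<lambda>_. 0) | p :: log_series.
        (\<forall>u. p u \<in> polys n) \<and>
        (\<forall>u. p u \<noteq> 0 \<longrightarrow> u \<in> relation_lattice d n A \<and> nsupp_at n v u \<in> \<N>) \<and>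
        (\<forall>P \<in> hypergeometric_ideal d n A \<beta>. weyl_act n v P p = (\<lambda>_. 0))}"

section \<open>The intrinsic coefficient space\<close>

definition gale_poly :: "nat \<Rightarrow> (nat \<Rightarrow> nat \<Rightarrow> int) \<Rightarrow> nat \<Rightarrow> complex mpoly" where
  "gale_poly r B j = (\<Sum>i<r. of_int (B j i) * mp_var i)"

definition P_poly_ideal ::
  "nat \<Rightarrow> nat \<Rightarrow> nat \<Rightarrow> (nat \<Rightarrow> nat \<Rightarrow> int) \<Rightarrow> (nat \<Rightarrow> nat \<Rightarrow> int) \<Rightarrow> (nat \<Rightarrow> complex) \<Rightarrow> nat set set
     \<Rightarrow> complex mpoly set" where
  "P_poly_ideal d n r A B v \<N> = ideal_gen (polys r)
     {\<Prod>j\<in>(I \<union> J) - \<Inter>\<N>. gale_poly r B j | I J. I \<in> \<N> \<and> J \<in> nsupps d n A v - \<N>}"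

text \<open>\<open>(q(\<partial>\<^sub>s) f)|\<^bsub>s=0\<^esub> = \<Sum>\<^sub>k q\<^sub>k k! f\<^sub>k\<close>, for a polynomial \<open>f\<close>.\<close>

definition orth_complement :: "nat \<Rightarrow> complex mpoly set \<Rightarrow> complex mpoly set" where
  "orth_complement r I =
     {q \<in> polys r. \<forall>f\<in>I. (\<Sum>k\<in>keys q. lookup q k * of_nat (exp_fact k) * lookup f k) = 0}"

text \<open>
  The series \<open>m(s) a\<^sub>u(s)\<close>.  The quotient is the unique solution of the division problem, since power
  series rings over a field are domains; it exists because \<open>m\<close> cancels the zeros at \<open>s = 0\<close> of
  the denominator of \<open>a\<^sub>u\<close> whenever \<open>I\<^sub>u \<in> \<N>\<close>.
\<close>

definition psi_factor ::
  "nat \<Rightarrow> nat \<Rightarrow> (nat \<Rightarrow> nat \<Rightarrow> int) \<Rightarrow> (nat \<Rightarrow> complex) \<Rightarrow> nat set set \<Rightarrow> (nat \<Rightarrow> int) \<Rightarrow> complex mfps" where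
  "psi_factor n r B v \<N> u = (THE f. f \<in> series r \<and>
     f * falling (\<lambda>j. mfps_const (v j) + gale_form r B j + of_int (u j)) (pos_part u) =
     Phi n r B (e_monomial n v \<N>) *
       falling (\<lambda>j. mfps_const (v j) + gale_form r B j) (neg_part u))"

text \<open>
  \<open>x\<^bsup>Bs\<^esup> = exp (\<Sum>\<^sub>i s\<^sub>i \<Sum>\<^sub>j b\<^sub>j\<^sub>i y\<^sub>j)\<close> with \<open>y = log x\<close>, as a power series in \<open>s\<close> with coefficients
  polynomials in \<open>y\<close>.
\<close>

definition x_power_Bs :: "nat \<Rightarrow> nat \<Rightarrow> (nat \<Rightarrow> nat \<Rightarrow> int) \<Rightarrow> complex mpoly mfps" where
  "x_power_Bs n r B = Abs_mfps (\<lambda>k. if k \<in> exps_of r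
     then mp_const (1 / of_nat (exp_fact k)) *
            (\<Prod>i<r. (\<Sum>j<n. of_int (B j i) * mp_var j) ^ lookup k i)
     else 0)"

text \<open>The coefficient of \<open>x\<^bsup>v+u\<^esup>\<close> in \<open>\<Psi>\<^sub>\<N>(x, s)\<close>.\<close>

definition Psi ::
  "nat \<Rightarrow> nat \<Rightarrow> nat \<Rightarrow> (nat \<Rightarrow> nat \<Rightarrow> int) \<Rightarrow> (nat \<Rightarrow> nat \<Rightarrow> int) \<Rightarrow> (nat \<Rightarrow> complex) \<Rightarrow> nat set set
     \<Rightarrow> (nat \<Rightarrow> int) \<Rightarrow> complex mpoly mfps" where
  "Psi d n r A B v \<N> u =
     (if u \<in> relation_lattice d n A \<and> nsupp_at n v u \<in> \<N>
      then Abs_mfps (\<lambda>k. mp_const (mfps_nth (psi_factor n r B v \<N> u) k)) * x_power_Bs n r B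
      else 0)"

definition intrinsic_series ::
  "nat \<Rightarrow> nat \<Rightarrow> nat \<Rightarrow> (nat \<Rightarrow> nat \<Rightarrow> int) \<Rightarrow> (nat \<Rightarrow> nat \<Rightarrow> int) \<Rightarrow> (nat \<Rightarrow> complex) \<Rightarrow> nat set set
     \<Rightarrow> complex mpoly \<Rightarrow> log_series" where
  "intrinsic_series d n r A B v \<N> q = (\<lambda>u.
     \<Sum>k\<in>keys q. mp_const (lookup q k * of_nat (exp_fact k)) * mfps_nth (Psi d n r A B v \<N> u) k)"

definition intrinsic_coefficient_space ::
  "nat \<Rightarrow> nat \<Rightarrow> nat \<Rightarrow> (nat \<Rightarrow> nat \<Rightarrow> int) \<Rightarrow> (nat \<Rightarrow> nat \<Rightarrow> int) \<Rightarrow> (nat \<Rightarrow> complex) \<Rightarrow> nat set set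
     \<Rightarrow> complex mpoly set" where
  "intrinsic_coefficient_space d n r A B v \<N> =
     (\<lambda>q. intrinsic_series d n r A B v \<N> q (\<lambda>_. 0)) ` orth_complement r (P_poly_ideal d n r A B v \<N>)"

definition involves_logs :: "complex mpoly \<Rightarrow> bool" where
  "involves_logs p \<longleftrightarrow> (\<exists>m\<in>keys p. m \<noteq> 0)"

end

theory Submission
  imports Defs
begin

text \<open>
  The example is the rational normal scroll \<open>S(2,1)\<close> with \<open>v = (0, 2, 0, 0, -1)\<close> and
  \<open>\<beta> = (1, 1, -1)\<close>.  Relations have coordinates \<open>(a, b)\<close>, and \<open>v + u\<close> is
  \<open>(a, 2 - a - b, b, b - a, a - b - 1)\<close>.  The three minors of the scroll form a reduced Groebner basis; its
  vectors \<open>(1, 1)\<close>, \<open>(1, 0)\<close>, \<open>(0, 1)\<close> span a quadrant, so the semigroup is normal.  The negative supports of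
  the quadrant \<open>a, b \<ge> 0\<close> are \<open>{3}, {4}, {1, 3}, {1, 4}\<close>.  They form the ordered family.  For a direction
  \<open>w\<close> under which \<open>(1, 0)\<close> is heavier than \<open>(0, 1)\<close>, the distinguished collection has the additional
  member \<open>{1, 2, 3}\<close>, but not \<open>{2, 3}\<close>, so it is not ordered (\<open>distinguished_scroll\<close>).  The intersection of
  either family is empty, and both give \<open>e = t\<^sub>4\<close>, \<open>M = \<langle>t\<^sub>3, t\<^sub>4\<rangle>\<close> and \<open>P = \<langle>t\<^sub>0 t\<^sub>4, t\<^sub>2 t\<^sub>3\<rangle>\<close>.

  The phenomenon rests on the row \<open>t\<^sub>3 + t\<^sub>4\<close> of \<open>A t\<close>.  It gives
  \<open>t\<^sub>2 t\<^sub>4 = t\<^sub>2 (t\<^sub>3 + t\<^sub>4) - t\<^sub>2 t\<^sub>3 \<in> U + P\<close>, while \<open>t\<^sub>2 t\<^sub>4\<close> is not in \<open>Q = U M + P\<close>, as a functional on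
  quadratic forms shows (\<open>Q5_dual\<close>).  Modulo \<open>Q\<close>, if \<open>g\<close> has no constant term, \<open>g t\<^sub>4\<close> is a multiple
  of \<open>t\<^sub>2 t\<^sub>4\<close>, which all variables annihilate.  So \<open>(U + P) : e\<close> consists of all series without
  constant term (\<open>num_scroll\<close>) and \<open>Q : e\<close> is the hyperplane in it where one linear condition holds
  (\<open>den_scroll\<close>): the obstruction module has dimension one.  The condition is visible after the
  substitution, which kills \<open>U\<close>, and therefore \<open>\<Phi>(t\<^sub>2)\<close> witnesses that the inclusion of ideals is
  strict (\<open>strict_inclusion\<close>).

  The functional that vanishes on \<open>Q\<close> turns the perturbed series into a logarithmic solution with
  coefficient \<open>y\<^sub>2 + y\<^sub>3 - y\<^sub>1 - y\<^sub>4\<close> at \<open>x\<^sup>v\<close>.  The solution is given explicitly: logarithms occur for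
  \<open>a + b \<le> 2\<close> only, and the tail is a quotient of factorials.  The box equations are recurrences in
  \<open>(a, b)\<close> (\<open>ambient_contains_log\<close>); that three box operators and three Euler operators suffice uses that
  logarithmic series form a module over the Weyl algebra (\<open>weyl_act_mult\<close>).  Intrinsic perturbation cannot
  produce \<open>y\<^sub>2\<close>: its coefficient is a pairing of \<open>q\<close> with \<open>(Bs)\<^sub>4 (Bs)\<^sub>2 = - (Bs)\<^sub>3 (Bs)\<^sub>2\<close>, an element of the
  ideal that \<open>q\<close> is orthogonal to (\<open>intrinsic_no_log\<close>).

  Genericity of the direction holds for every \<open>w\<close> whose entries are linearly independent over the
  integers, for any set of operators (\<open>independent_weight_in_interior\<close>).  The initial ideal of the
  homogenized ideal is determined by finitely many strict inequalities on weights: Dickson's lemma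
  provides a finite Groebner basis, for \<open>w\<close> refined by a tie-breaking weight, and division with remainder
  shows that the same elements form a basis for all nearby weights.  Associativity of the product of
  normally ordered operators, which division needs, follows from a recursion for the Leibniz
  coefficients.  The entries of \<open>w\<close> are powers of a transcendental number, which leaves room for the
  inequalities that single out the quadrant and the order of its edges.
\<close>

section \<open>The Leibniz coefficients\<close>

abbreviation var_exp :: "nat \<Rightarrow> exps" where "var_exp j \<equiv> Poly_Mapping.single j 1"

lemma exps_eqI: "(\<And>j. lookup a j = lookup b j) \<Longrightarrow> a = (b :: 'a \<Rightarrow>\<^sub>0 'b::zero)"
  by (rule poly_mapping_eqI)

lemma exps_induct [case_names zero add]:
  assumes "P 0" "\<And>a j. P a \<Longrightarrow> P (a + var_exp j)"
  shows "P (a :: exps)"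
proof (induction "\<Sum>i\<in>keys a. lookup a i" arbitrary: a rule: less_induct)
  case less
  show ?case
  proof (cases "a = 0")
    case False
    then obtain j where j: "j \<in> keys a" by (metis keys_eq_empty ex_in_conv)
    define b where "b = a - var_exp j"
    have ab: "a = b + var_exp j"
      using j by (intro exps_eqI) (auto simp: b_def lookup_add lookup_minus lookup_single in_keys_iff when_def)
    have kb: "keys b \<subseteq> keys a"
      by (auto simp: in_keys_iff ab lookup_add)
    have "(\<Sum>i\<in>keys b. lookup b i) = (\<Sum>i\<in>keys a. lookup b i)"
      by (rule sum.mono_neutral_left) (use kb in \<open>auto simp: in_keys_iff\<close>)
    also have "\<dots> < (\<Sum>i\<in>keys a. lookup a i)"
      by (rule sum_strict_mono_ex1) (use j in \<open>auto simp: ab lookup_add lookup_single when_def\<close>)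
    finally show ?thesis using less assms(2) ab by metis
  qed (use assms in auto)
qed

lemma exp_degree_superset:
  assumes "finite T" "keys a \<subseteq> T"
  shows "exp_degree a = (\<Sum>i\<in>T. lookup a i)"
  unfolding exp_degree_def by (rule sum.mono_neutral_left) (use assms in \<open>auto simp: in_keys_iff\<close>)

lemma exp_degree_add: "exp_degree (a + b) = exp_degree a + exp_degree b"
proof -
  have "keys (a + b) \<subseteq> keys a \<union> keys b" by (rule keys_add)
  then show ?thesis
    by (simp add: exp_degree_superset[of "keys a \<union> keys b"] lookup_add sum.distrib)
qed

lemma exp_degree_zero [simp]: "exp_degree 0 = 0" by (simp add: exp_degree_def)
lemma exp_degree_var [simp]: "exp_degree (var_exp j) = 1" by (simp add: exp_degree_def)

lemma finite_contractions [simp]: "finite (contractions b c)"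
  unfolding contractions_def using finite_exp_dvd[of b] by (rule rev_finite_subset) auto

lemma leibniz_coeff_superset:
  assumes "finite T" "keys k \<subseteq> T"
  shows "leibniz_coeff b c k =
    (\<Prod>i\<in>T. fact (lookup k i) * (lookup b i choose lookup k i) * (lookup c i choose lookup k i))"
  unfolding leibniz_coeff_def
  by (rule prod.mono_neutral_left) (use assms in \<open>auto simp: in_keys_iff\<close>)

lemma leibniz_coeff_zero [simp]: "leibniz_coeff b c 0 = 1"
  by (simp add: leibniz_coeff_def)

lemma leibniz_coeff_eq_0:
  assumes "k \<notin> contractions b c" shows "leibniz_coeff b c k = 0"
proof -
  from assms obtain i where i: "lookup b i < lookup k i \<or> lookup c i < lookup k i"
    by (auto simp: contractions_def exp_dvd_def not_le)
  then have "i \<in> keys k" by (auto simp: in_keys_iff)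
  with i show ?thesis unfolding leibniz_coeff_def by (auto intro!: prod_zero bexI[of _ i])
qed

text \<open>
  The number \<open>k! (b choose k) (c choose k)\<close> counts the ways to match \<open>k\<close> of \<open>b\<close> derivations with \<open>k\<close>
  of \<open>c\<close> factors \<open>x\<close>.  A new derivation stays unmatched, or takes one of the \<open>c - (k - 1)\<close> factors
  that the others left free.
\<close>

lemma choose_step:
  "fact k * (Suc b choose k) * (c choose k)
   = fact k * (b choose k) * (c choose k)
     + (if k > 0 then (c - (k - 1)) * (fact (k - 1) * (b choose (k - 1)) * (c choose (k - 1))) else 0)"
proof (cases k)
  case (Suc l)
  have *: "Suc l * (c choose Suc l) = (c - l) * (c choose l)"
    by (metis Suc_times_binomial_eq binomial_absorption binomial_absorb_comp diff_Suc_1 mult.commute)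
  have "fact (Suc l) * (b choose l) * (c choose Suc l) = fact l * (b choose l) * (Suc l * (c choose Suc l))"
    by (simp add: algebra_simps)
  also have "\<dots> = (c - l) * (fact l * (b choose l) * (c choose l))"
    unfolding * by (simp add: algebra_simps)
  finally show ?thesis unfolding Suc
    by (simp add: distrib_left distrib_right del: fact_Suc)
qed simp

lemma leibniz_coeff_step:
  "leibniz_coeff (b + var_exp j) c k = leibniz_coeff b c k
     + (if lookup k j > 0 then (lookup c j - (lookup k j - 1)) * leibniz_coeff b c (k - var_exp j) else 0)"
proof -
  define T where "T = keys k - {j}"
  let ?t = "\<lambda>b k i. fact (lookup k i) * (lookup b i choose lookup k i) * (lookup c i choose lookup k i)"
  have T: "finite (insert j T)" "keys k \<subseteq> insert j T" "j \<notin> T" "keys (k - var_exp j) \<subseteq> insert j T"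
    by (auto simp: T_def in_keys_iff lookup_minus)
  have e: "leibniz_coeff b' c k' = ?t b' k' j * (\<Prod>i\<in>T. ?t b' k' i)" if "keys k' \<subseteq> insert j T" for b' k'
    using T that by (simp add: leibniz_coeff_superset[OF T(1) that] del: insert_iff)
  have p1: "(\<Prod>i\<in>T. ?t (b + var_exp j) k i) = (\<Prod>i\<in>T. ?t b k i)"
    by (rule prod.cong) (use T in \<open>auto simp: lookup_add lookup_single when_def\<close>)
  have p2: "(\<Prod>i\<in>T. ?t b (k - var_exp j) i) = (\<Prod>i\<in>T. ?t b k i)"
    by (rule prod.cong) (use T in \<open>auto simp: lookup_minus lookup_single when_def\<close>)
  show ?thesis
    unfolding e[OF T(2)] e[OF T(4)] p1 p2
    using choose_step[of "lookup k j" "lookup b j" "lookup c j"]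
    by (simp add: lookup_add lookup_minus algebra_simps split: if_splits)
qed

text \<open>
  Carrying one more \<open>\<partial>\<^sub>j\<close> across \<open>x\<^sup>c\<close>: it passes, or it differentiates what is left of \<open>x\<^sup>c\<close>.  The
  function \<open>\<tau>\<close> says what a normally ordered monomial contributes, its last argument being the power of
  the homogenizing variable \<open>h\<close>; keeping it abstract makes the identity serve both Weyl algebras.
\<close>

lemma leibniz_step:
  fixes \<tau> :: "exps \<Rightarrow> exps \<Rightarrow> nat \<Rightarrow> 'r::comm_ring_1"
  shows "(\<Sum>k\<in>contractions b c. of_nat (leibniz_coeff b c k) *
            (\<tau> (c - k) (b - k + var_exp j) (2 * exp_degree k)
             + of_nat (lookup (c - k) j) * \<tau> (c - k - var_exp j) (b - k) (2 * exp_degree k + 2)))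
       = (\<Sum>k\<in>contractions (b + var_exp j) c. of_nat (leibniz_coeff (b + var_exp j) c k) *
            \<tau> (c - k) (b + var_exp j - k) (2 * exp_degree k))"
proof -
  let ?e = "var_exp j" and ?C = "contractions b c" and ?D = "contractions (b + var_exp j) c"
  let ?l = "\<lambda>k. of_nat (leibniz_coeff b c k) :: 'r"
  let ?t = "\<lambda>k. \<tau> (c - k) (b + ?e - k) (2 * exp_degree k)"
  have sub: "?C \<subseteq> ?D" by (auto simp: contractions_def exp_dvd_def lookup_add intro: trans_le_add1)
  have "(\<Sum>k\<in>?C. ?l k * \<tau> (c - k) (b - k + ?e) (2 * exp_degree k)) = (\<Sum>k\<in>?C. ?l k * ?t k)"
  proof (rule sum.cong[OF refl])
    fix k assume "k \<in> ?C"
    then have "b - k + ?e = b + ?e - k"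
      by (intro exps_eqI) (auto simp: contractions_def exp_dvd_def lookup_add lookup_minus)
    then show "?l k * \<tau> (c - k) (b - k + ?e) (2 * exp_degree k) = ?l k * ?t k" by simp
  qed
  also have "\<dots> = (\<Sum>k\<in>?D. ?l k * ?t k)"
    by (rule sum.mono_neutral_left) (use sub leibniz_coeff_eq_0 in auto)
  finally have 1: "(\<Sum>k\<in>?C. ?l k * \<tau> (c - k) (b - k + ?e) (2 * exp_degree k)) = (\<Sum>k\<in>?D. ?l k * ?t k)" .
  let ?D' = "{k \<in> ?D. lookup k j > 0}" and ?C' = "{k \<in> ?C. lookup (c - k) j > 0}"
  have "(\<Sum>k\<in>?C. ?l k * (of_nat (lookup (c - k) j) * \<tau> (c - k - ?e) (b - k) (2 * exp_degree k + 2)))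
      = (\<Sum>k\<in>?C'. ?l k * (of_nat (lookup (c - k) j) * \<tau> (c - k - ?e) (b - k) (2 * exp_degree k + 2)))"
    by (rule sum.mono_neutral_right) auto
  also have "\<dots> = (\<Sum>k\<in>?D'. ?l (k - ?e) * (of_nat (lookup c j - (lookup k j - 1)) * ?t k))"
  proof (rule sum.reindex_bij_witness[where i = "\<lambda>k. k - ?e" and j = "\<lambda>k. k + ?e"])
    fix k assume k: "k \<in> ?C'"
    then have le: "lookup k i \<le> lookup b i" "lookup k i \<le> lookup c i" "lookup k j < lookup c j" for i
      by (auto simp: contractions_def exp_dvd_def lookup_minus)
    show "k + ?e - ?e = k" by simp
    show "k + ?e \<in> ?D'" using le
      by (auto simp: contractions_def exp_dvd_def lookup_add lookup_single when_def Suc_leI)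
    have "c - (k + ?e) = c - k - ?e" "b + ?e - (k + ?e) = b - k"
      by (auto intro!: exps_eqI simp: lookup_add lookup_minus)
    moreover have "lookup c j - (lookup (k + ?e) j - 1) = lookup (c - k) j"
      by (simp add: lookup_add lookup_minus)
    ultimately show "?l (k + ?e - ?e) * (of_nat (lookup c j - (lookup (k + ?e) j - 1)) * ?t (k + ?e))
      = ?l k * (of_nat (lookup (c - k) j) * \<tau> (c - k - ?e) (b - k) (2 * exp_degree k + 2))"
      by (simp add: exp_degree_add flip: One_nat_def)
  next
    fix k assume k: "k \<in> ?D'"
    then have le: "lookup k i \<le> lookup (b + ?e) i" "lookup k i \<le> lookup c i" "lookup k j > 0" for i
      by (auto simp: contractions_def exp_dvd_def)
    show "k - ?e + ?e = k" using le(3)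
      by (intro exps_eqI) (auto simp: lookup_add lookup_minus lookup_single when_def)
    have "lookup (k - ?e) i \<le> lookup b i \<and> lookup (k - ?e) i \<le> lookup c i" for i
      using le(1)[of i] le(2)[of i] by (auto simp: lookup_add lookup_minus lookup_single when_def)
    moreover have "lookup (c - (k - ?e)) j > 0" using le(2)[of j] le(3) by (auto simp: lookup_minus)
    ultimately show "k - ?e \<in> ?C'" by (auto simp: contractions_def exp_dvd_def)
  qed
  also have "\<dots> = (\<Sum>k\<in>?D. (if lookup k j > 0 then ?l (k - ?e) * of_nat (lookup c j - (lookup k j - 1)) else 0) * ?t k)"
    by (rule sum.mono_neutral_cong_left) (auto simp: mult.assoc)
  finally have 2: "(\<Sum>k\<in>?C. ?l k * (of_nat (lookup (c - k) j) * \<tau> (c - k - ?e) (b - k) (2 * exp_degree k + 2)))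
     = (\<Sum>k\<in>?D. (if lookup k j > 0 then ?l (k - ?e) * of_nat (lookup c j - (lookup k j - 1)) else 0) * ?t k)" .
  have "(\<Sum>k\<in>?D. of_nat (leibniz_coeff (b + ?e) c k) * ?t k)
      = (\<Sum>k\<in>?D. ?l k * ?t k + (if lookup k j > 0 then ?l (k - ?e) * of_nat (lookup c j - (lookup k j - 1)) else 0) * ?t k)"
  proof (rule sum.cong[OF refl])
    fix k
    have "(of_nat (x + (if P then m * y else 0)) :: 'r) * z = of_nat x * z + (if P then of_nat y * of_nat m else 0) * z"
      for x m y P and z :: "'r" by (cases P) (simp_all add: distrib_right distrib_left mult.commute)
    then show "of_nat (leibniz_coeff (b + ?e) c k) * ?t k = ?l k * ?t k
      + (if lookup k j > 0 then ?l (k - ?e) * of_nat (lookup c j - (lookup k j - 1)) else 0) * ?t k"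
      unfolding leibniz_coeff_step .
  qed
  then show ?thesis
    by (simp only: distrib_left sum.distrib 1 2)
qed

section \<open>Linear extension\<close>

definition lin :: "('k \<Rightarrow> 'l \<Rightarrow>\<^sub>0 complex) \<Rightarrow> ('k \<Rightarrow>\<^sub>0 complex) \<Rightarrow> ('l::comm_monoid_add \<Rightarrow>\<^sub>0 complex)" where
  "lin f P = (\<Sum>k\<in>keys P. Poly_Mapping.single 0 (lookup P k) * f k)"

lemma lin_zero [simp]: "lin f 0 = 0" by (simp add: lin_def)

lemma lin_add: "lin f (P + Q) = lin f P + lin f Q"
  unfolding lin_def
  by (rule setsum_keys_plus_distrib) (auto simp: single_add algebra_simps)

lemma lin_single [simp]: "lin f (Poly_Mapping.single k c) = Poly_Mapping.single 0 c * f k"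
  by (simp add: lin_def)

lemma lin_sum: "lin f (sum g A) = (\<Sum>x\<in>A. lin f (g x))"
  by (induction A rule: infinite_finite_induct) (auto simp: lin_add)

lemma sum_singles: "P = (\<Sum>k\<in>keys P. Poly_Mapping.single k (lookup P k))"
  by (intro poly_mapping_eqI) (auto simp: lookup_sum lookup_single when_def in_keys_iff)

lemma poly_mapping_additive_induct [case_names zero add single]:
  fixes P :: "'k \<Rightarrow>\<^sub>0 'a::comm_monoid_add"
  assumes "Q 0" "\<And>P R. Q P \<Longrightarrow> Q R \<Longrightarrow> Q (P + R)" "\<And>k c. k \<in> keys P \<Longrightarrow> Q (Poly_Mapping.single k c)"
  shows "Q P"
proof -
  have "Q (\<Sum>k\<in>S. Poly_Mapping.single k (lookup P k))" if "finite S" "S \<subseteq> keys P" for S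
    using that by (induction S) (auto intro: assms)
  from this[of "keys P"] show ?thesis using sum_singles[of P] by simp
qed

lemma lin_scale:
  "lin f (Poly_Mapping.single 0 c * (P::'k::comm_monoid_add \<Rightarrow>\<^sub>0 complex)) = Poly_Mapping.single 0 c * lin f P"
  by (induction P rule: poly_mapping_additive_induct)
     (auto simp: distrib_left lin_add mult_single mult.assoc[symmetric])

lemma lin_add_fun: "lin (\<lambda>k. f k + g k) P = lin f P + lin g P"
  by (simp add: lin_def distrib_left sum.distrib)

lemma lin_scale_fun: "lin (\<lambda>k. Q * f k) P = Q * lin f P"
  by (simp add: lin_def sum_distrib_left mult.left_commute)

definition bil :: "('k \<Rightarrow> 'k \<Rightarrow> 'l \<Rightarrow>\<^sub>0 complex) \<Rightarrow> ('k \<Rightarrow>\<^sub>0 complex) \<Rightarrow> ('k \<Rightarrow>\<^sub>0 complex)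
     \<Rightarrow> ('l::comm_monoid_add \<Rightarrow>\<^sub>0 complex)" where
  "bil f P Q = lin (\<lambda>\<mu>. lin (f \<mu>) Q) P"

lemma bil_add_left: "bil f (P + Q) R = bil f P R + bil f Q R"
  by (simp add: bil_def lin_add)
lemma bil_add_right: "bil f R (P + Q) = bil f R P + bil f R Q"
  by (simp add: bil_def lin_add lin_add_fun)
lemma bil_zero [simp]: "bil f 0 P = 0" "bil f P 0 = 0"
  by (simp_all add: bil_def lin_def)
lemma bil_single: "bil f (Poly_Mapping.single k c) (Poly_Mapping.single l d) = Poly_Mapping.single 0 (c * d) * f k l"
  by (simp add: bil_def mult_single mult.assoc[symmetric])
lemma bil_scale_left: "bil f (Poly_Mapping.single 0 c * (P::'k::comm_monoid_add \<Rightarrow>\<^sub>0 complex)) Q = Poly_Mapping.single 0 c * bil f P Q"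
  by (simp add: bil_def lin_scale)
lemma bil_scale_right: "bil f P (Poly_Mapping.single 0 c * (Q::'k::comm_monoid_add \<Rightarrow>\<^sub>0 complex)) = Poly_Mapping.single 0 c * bil f P Q"
  by (simp add: bil_def lin_scale lin_scale_fun)

section \<open>The product of normally ordered operators\<close>

definition hweyl_basis_mult :: "exps \<times> exps \<times> nat \<Rightarrow> exps \<times> exps \<times> nat \<Rightarrow> hweyl" where
  "hweyl_basis_mult = (\<lambda>(a, b, p) (c, e, q). \<Sum>k\<in>contractions b c.
     Poly_Mapping.single (a + (c - k), (b - k) + e, p + q + 2 * exp_degree k) (of_nat (leibniz_coeff b c k)))"

lemma hweyl_mult_bil: "hweyl_mult P Q = bil hweyl_basis_mult P Q"
  unfolding hweyl_mult_def bil_def lin_def hweyl_basis_mult_def sum_distrib_left case_prod_beta mult_single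
  by (intro sum.cong refl) (simp add: ac_simps)

definition weyl_basis_mult :: "exps \<times> exps \<Rightarrow> exps \<times> exps \<Rightarrow> weyl" where
  "weyl_basis_mult = (\<lambda>(a, b) (c, e). \<Sum>k\<in>contractions b c.
     Poly_Mapping.single (a + (c - k), (b - k) + e) (of_nat (leibniz_coeff b c k)))"

lemma weyl_mult_bil: "weyl_mult P Q = bil weyl_basis_mult P Q"
  unfolding weyl_mult_def bil_def lin_def weyl_basis_mult_def sum_distrib_left case_prod_beta mult_single
  by (intro sum.cong refl) (simp add: ac_simps)

text \<open>
  Left multiplication by \<open>\<partial>\<^sub>j\<close>, read off on normally ordered monomials.
\<close>

definition hweyl_d :: "nat \<Rightarrow> hweyl \<Rightarrow> hweyl" where
  "hweyl_d j = lin (\<lambda>(x, y, p). Poly_Mapping.single (x, y + var_exp j, p) 1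
       + Poly_Mapping.single (x - var_exp j, y, p + 2) (of_nat (lookup x j)))"

definition weyl_d :: "nat \<Rightarrow> weyl \<Rightarrow> weyl" where
  "weyl_d j = lin (\<lambda>(x, y). Poly_Mapping.single (x, y + var_exp j) 1
       + Poly_Mapping.single (x - var_exp j, y) (of_nat (lookup x j)))"

lemma single_of_nat_mult: "Poly_Mapping.single k (of_nat m * c) = of_nat m * (Poly_Mapping.single k c :: 'k::comm_monoid_add \<Rightarrow>\<^sub>0 complex)"
  by (metis add.left_neutral mult_single single_of_nat)

lemma single_of_nat': "Poly_Mapping.single k (of_nat m) = of_nat m * (Poly_Mapping.single k 1 :: 'k::comm_monoid_add \<Rightarrow>\<^sub>0 complex)"
  using single_of_nat_mult[of k m 1] by simp

lemma minus_add_var_exp: "of_nat (lookup x j) * (F ((x::exps) - var_exp j + y) :: 'r::comm_ring_1) = of_nat (lookup x j) * F (x + y - var_exp j)"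
proof (cases "lookup x j = 0")
  case False
  then have "x - var_exp j + y = x + y - var_exp j"
    by (intro exps_eqI) (auto simp: lookup_add lookup_minus lookup_single when_def)
  then show ?thesis by simp
qed simp

lemma hweyl_d_add [simp]: "hweyl_d j 0 = 0" "hweyl_d j (P + Q) = hweyl_d j P + hweyl_d j Q"
  by (simp_all add: hweyl_d_def lin_add)
lemma hweyl_d_scale: "hweyl_d j (Poly_Mapping.single 0 c * P) = Poly_Mapping.single 0 c * hweyl_d j P"
  by (simp add: hweyl_d_def lin_scale)

text \<open>
  The first step towards associativity: \<open>\<partial>\<^sub>j (P Q) = (\<partial>\<^sub>j P) Q\<close> reduces to basis monomials, where it is
  the recursion for the Leibniz coefficients.
\<close>

lemma hweyl_d_mult: "hweyl_d j (bil hweyl_basis_mult P Q) = bil hweyl_basis_mult (hweyl_d j P) Q"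
proof (induction P rule: poly_mapping_additive_induct)
  case (single \<mu> s)
  show ?case
  proof (induction Q rule: poly_mapping_additive_induct)
    case (single \<nu> t)
    obtain a b p where \<mu>: "\<mu> = (a, b, p)" by (cases \<mu>) auto
    obtain c e q where \<nu>: "\<nu> = (c, e, q)" by (cases \<nu>) auto
    let ?\<tau> = "\<lambda>x y r. Poly_Mapping.single (a + x, y + e, p + q + r) 1 :: hweyl"
    let ?e = "var_exp j"
    let ?L = "\<lambda>k. of_nat (leibniz_coeff b c k) :: hweyl"
    have "hweyl_d j (hweyl_basis_mult \<mu> \<nu>) = (\<Sum>k\<in>contractions b c. ?L k *
        (Poly_Mapping.single (a + (c - k), b - k + e + ?e, p + q + 2 * exp_degree k) 1
        + of_nat (lookup (a + (c - k)) j) * Poly_Mapping.single (a + (c - k) - ?e, b - k + e, p + q + 2 * exp_degree k + 2) 1))"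
      by (simp only: \<mu> \<nu> hweyl_basis_mult_def hweyl_d_def lin_sum lin_single single_of_nat prod.case)
         (simp only: single_of_nat'[where k = "(_, _, _)"])
    also have "\<dots> = (\<Sum>k\<in>contractions b c. ?L k *
        (?\<tau> (c - k) (b - k + ?e) (2 * exp_degree k)
        + of_nat (lookup (c - k) j) * ?\<tau> (c - k - ?e) (b - k) (2 * exp_degree k + 2)))
      + (\<Sum>k\<in>contractions b c. ?L k * (of_nat (lookup a j) * Poly_Mapping.single (a - ?e + (c - k), b - k + e, p + q + 2 * exp_degree k + 2) 1))"
      unfolding sum.distrib[symmetric]
    proof (rule sum.cong[OF refl])
      fix k
      let ?F = "\<lambda>x. Poly_Mapping.single (x, b - k + e, p + q + 2 * exp_degree k + 2) 1 :: hweyl"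
      have 1: "of_nat (lookup a j) * ?F (a - ?e + (c - k)) = of_nat (lookup a j) * ?F (a + (c - k) - ?e)"
        by (rule minus_add_var_exp)
      have 2: "of_nat (lookup (c - k) j) * ?F (c - k - ?e + a) = of_nat (lookup (c - k) j) * ?F (c - k + a - ?e)"
        by (rule minus_add_var_exp)
      show "?L k * (Poly_Mapping.single (a + (c - k), b - k + e + ?e, p + q + 2 * exp_degree k) 1
        + of_nat (lookup (a + (c - k)) j) * ?F (a + (c - k) - ?e)) =
        ?L k * (?\<tau> (c - k) (b - k + ?e) (2 * exp_degree k)
        + of_nat (lookup (c - k) j) * ?\<tau> (c - k - ?e) (b - k) (2 * exp_degree k + 2))
        + ?L k * (of_nat (lookup a j) * ?F (a - ?e + (c - k)))"
        unfolding 1 using 2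
        by (simp only: lookup_add of_nat_add distrib_left distrib_right ac_simps)
    qed
    also have "\<dots> = (\<Sum>k\<in>contractions (b + ?e) c. of_nat (leibniz_coeff (b + ?e) c k) *
            ?\<tau> (c - k) (b + ?e - k) (2 * exp_degree k))
      + (\<Sum>k\<in>contractions b c. ?L k * (of_nat (lookup a j) * Poly_Mapping.single (a - ?e + (c - k), b - k + e, p + q + 2 * exp_degree k + 2) 1))"
      by (rule arg_cong2[where f = "(+)", OF leibniz_step[of b c ?\<tau> j] refl])
    also have "\<dots> = hweyl_basis_mult (a, b + ?e, p) \<nu> + of_nat (lookup a j) * hweyl_basis_mult (a - ?e, b, p + 2) \<nu>"
      by (simp only: \<nu> hweyl_basis_mult_def single_of_nat'[where k = "(_, _, _)"] sum_distrib_left prod.case ac_simps)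
    finally have "hweyl_d j (hweyl_basis_mult \<mu> \<nu>) = \<dots>" .
    moreover have "bil hweyl_basis_mult (hweyl_d j (Poly_Mapping.single \<mu> 1)) (Poly_Mapping.single \<nu> 1) = \<dots>"
      by (simp add: hweyl_d_def \<mu> bil_add_left bil_single single_of_nat del: One_nat_def)
    moreover have "Poly_Mapping.single \<mu> s = Poly_Mapping.single 0 s * Poly_Mapping.single \<mu> 1"
      "Poly_Mapping.single \<nu> t = Poly_Mapping.single 0 t * Poly_Mapping.single \<nu> 1"
      by (simp_all add: mult_single)
    ultimately show ?case
      by (simp only: bil_scale_left bil_scale_right hweyl_d_scale) (simp add: bil_single)
  qed (auto simp: bil_add_right hweyl_d_add)
qed (auto simp: bil_add_left hweyl_d_add)

lemma weyl_d_add [simp]: "weyl_d j 0 = 0" "weyl_d j (P + Q) = weyl_d j P + weyl_d j Q"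
  by (simp_all add: weyl_d_def lin_add)
lemma weyl_d_scale: "weyl_d j (Poly_Mapping.single 0 c * P) = Poly_Mapping.single 0 c * weyl_d j P"
  by (simp add: weyl_d_def lin_scale)

lemma weyl_d_mult: "weyl_d j (bil weyl_basis_mult P Q) = bil weyl_basis_mult (weyl_d j P) Q"
proof (induction P rule: poly_mapping_additive_induct)
  case (single \<mu> s)
  show ?case
  proof (induction Q rule: poly_mapping_additive_induct)
    case (single \<nu> t)
    obtain a b where \<mu>: "\<mu> = (a, b)" by (cases \<mu>) auto
    obtain c e where \<nu>: "\<nu> = (c, e)" by (cases \<nu>) auto
    let ?\<tau> = "\<lambda>x y r. Poly_Mapping.single (a + x, y + e) 1 :: weyl"
    let ?e = "var_exp j"
    let ?L = "\<lambda>k. of_nat (leibniz_coeff b c k) :: weyl"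
    have "weyl_d j (weyl_basis_mult \<mu> \<nu>) = (\<Sum>k\<in>contractions b c. ?L k *
        (Poly_Mapping.single (a + (c - k), b - k + e + ?e) 1
        + of_nat (lookup (a + (c - k)) j) * Poly_Mapping.single (a + (c - k) - ?e, b - k + e) 1))"
      by (simp only: \<mu> \<nu> weyl_basis_mult_def weyl_d_def lin_sum lin_single single_of_nat prod.case)
         (simp only: single_of_nat'[where k = "(_, _)"])
    also have "\<dots> = (\<Sum>k\<in>contractions b c. ?L k *
        (?\<tau> (c - k) (b - k + ?e) (2 * exp_degree k)
        + of_nat (lookup (c - k) j) * ?\<tau> (c - k - ?e) (b - k) (2 * exp_degree k + 2)))
      + (\<Sum>k\<in>contractions b c. ?L k * (of_nat (lookup a j) * Poly_Mapping.single (a - ?e + (c - k), b - k + e) 1))"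
      unfolding sum.distrib[symmetric]
    proof (rule sum.cong[OF refl])
      fix k
      let ?F = "\<lambda>x. Poly_Mapping.single (x, b - k + e) 1 :: weyl"
      have 1: "of_nat (lookup a j) * ?F (a - ?e + (c - k)) = of_nat (lookup a j) * ?F (a + (c - k) - ?e)"
        by (rule minus_add_var_exp)
      have 2: "of_nat (lookup (c - k) j) * ?F (c - k - ?e + a) = of_nat (lookup (c - k) j) * ?F (c - k + a - ?e)"
        by (rule minus_add_var_exp)
      show "?L k * (Poly_Mapping.single (a + (c - k), b - k + e + ?e) 1
        + of_nat (lookup (a + (c - k)) j) * ?F (a + (c - k) - ?e)) =
        ?L k * (?\<tau> (c - k) (b - k + ?e) (2 * exp_degree k)
        + of_nat (lookup (c - k) j) * ?\<tau> (c - k - ?e) (b - k) (2 * exp_degree k + 2))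
        + ?L k * (of_nat (lookup a j) * ?F (a - ?e + (c - k)))"
        unfolding 1 using 2
        by (simp only: lookup_add of_nat_add distrib_left distrib_right ac_simps)
    qed
    also have "\<dots> = (\<Sum>k\<in>contractions (b + ?e) c. of_nat (leibniz_coeff (b + ?e) c k) *
            ?\<tau> (c - k) (b + ?e - k) (2 * exp_degree k))
      + (\<Sum>k\<in>contractions b c. ?L k * (of_nat (lookup a j) * Poly_Mapping.single (a - ?e + (c - k), b - k + e) 1))"
      by (rule arg_cong2[where f = "(+)", OF leibniz_step[of b c ?\<tau> j] refl])
    also have "\<dots> = weyl_basis_mult (a, b + ?e) \<nu> + of_nat (lookup a j) * weyl_basis_mult (a - ?e, b) \<nu>"
      by (simp only: \<nu> weyl_basis_mult_def single_of_nat'[where k = "(_, _)"] sum_distrib_left prod.case ac_simps)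
    finally have "weyl_d j (weyl_basis_mult \<mu> \<nu>) = \<dots>" .
    moreover have "bil weyl_basis_mult (weyl_d j (Poly_Mapping.single \<mu> 1)) (Poly_Mapping.single \<nu> 1) = \<dots>"
      by (simp add: weyl_d_def \<mu> bil_add_left bil_single single_of_nat del: One_nat_def)
    moreover have "Poly_Mapping.single \<mu> s = Poly_Mapping.single 0 s * Poly_Mapping.single \<mu> 1"
      "Poly_Mapping.single \<nu> t = Poly_Mapping.single 0 t * Poly_Mapping.single \<nu> 1"
      by (simp_all add: mult_single)
    ultimately show ?case
      by (simp only: bil_scale_left bil_scale_right weyl_d_scale) (simp add: bil_single)
  qed (auto simp: bil_add_right weyl_d_add)
qed (auto simp: bil_add_left weyl_d_add)

lemma hweyl_shift_mult:
  "bil hweyl_basis_mult (Poly_Mapping.single (a, 0, p) 1 * P) Q = Poly_Mapping.single (a, 0, p) 1 * bil hweyl_basis_mult P Q"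
proof (induction P rule: poly_mapping_additive_induct)
  case (single \<mu> s)
  show ?case
  proof (induction Q rule: poly_mapping_additive_induct)
    case (single \<nu> t)
    obtain a' b' p' where \<mu>: "\<mu> = (a', b', p')" by (cases \<mu>) auto
    obtain c e q where \<nu>: "\<nu> = (c, e, q)" by (cases \<nu>) auto
    show ?case unfolding \<mu> \<nu>
      by (simp add: mult_single bil_single)
         (simp add: hweyl_basis_mult_def sum_distrib_left mult_single ac_simps)
  qed (auto simp: bil_add_right distrib_left)
qed (auto simp: bil_add_left distrib_left)

lemma weyl_shift_mult:
  "bil weyl_basis_mult (Poly_Mapping.single (a, 0) 1 * P) Q = Poly_Mapping.single (a, 0) 1 * bil weyl_basis_mult P Q"
proof (induction P rule: poly_mapping_additive_induct)
  case (single \<mu> s)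
  show ?case
  proof (induction Q rule: poly_mapping_additive_induct)
    case (single \<nu> t)
    obtain a' b' where \<mu>: "\<mu> = (a', b')" by (cases \<mu>) auto
    obtain c e where \<nu>: "\<nu> = (c, e)" by (cases \<nu>) auto
    show ?case unfolding \<mu> \<nu>
      by (simp add: mult_single bil_single)
         (simp add: weyl_basis_mult_def sum_distrib_left mult_single ac_simps)
  qed (auto simp: bil_add_right distrib_left)
qed (auto simp: bil_add_left distrib_left)

text \<open>
  Since \<open>x\<^sup>a h\<^sup>p\<close> multiplies normally ordered monomials from the left without contractions, only
  \<open>P = \<partial>\<^sup>b\<close> matters, and \<open>\<partial>\<^sup>b\<close> is built up by operators \<open>\<partial>\<^sub>j\<close> that commute with right multiplication.
\<close>

lemma hweyl_mult_assoc: "hweyl_mult (hweyl_mult P Q) R = hweyl_mult P (hweyl_mult Q R)"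
  unfolding hweyl_mult_bil
proof (induction P rule: poly_mapping_additive_induct)
  case (single \<mu> s)
  obtain a b p where \<mu>: "\<mu> = (a, b, p)" by (cases \<mu>) auto
  let ?m = "bil hweyl_basis_mult"
  have 1: "?m (?m (Poly_Mapping.single (0, b, 0) 1) Q) R = ?m (Poly_Mapping.single (0, b, 0) 1) (?m Q R)"
  proof (induction b rule: exps_induct)
    case zero
    have "?m (Poly_Mapping.single (0, 0, 0) 1) S = S" for S
    proof (induction S rule: poly_mapping_additive_induct)
      case (single \<nu> t)
      have "contractions 0 c = {0}" for c
        by (auto simp: contractions_def exp_dvd_def intro: exps_eqI)
      then show ?case by (cases \<nu>) (simp add: bil_single hweyl_basis_mult_def mult_single)
    qed (auto simp: bil_add_right)
    then show ?case by simp
  next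
    case (add b j)
    have "Poly_Mapping.single (0, b + var_exp j, 0) 1 = hweyl_d j (Poly_Mapping.single (0, b, 0) 1)"
      by (simp add: hweyl_d_def)
    then show ?case using add by (simp only: hweyl_d_mult[symmetric])
  qed
  have "Poly_Mapping.single \<mu> s = Poly_Mapping.single 0 s * (Poly_Mapping.single (a, 0, p) 1 * Poly_Mapping.single (0, b, 0) 1)"
    by (simp add: mult_single \<mu>)
  then show ?case by (simp only: bil_scale_left hweyl_shift_mult 1)
qed (auto simp: bil_add_left)

text \<open>
  Monomials of the homogenized Weyl algebra are triples, and quantifiers over them are better left whole.
\<close>

declare split_paired_All [simp del] split_paired_Ex [simp del]

section \<open>Dickson's lemma\<close>

lemma nat_seq_mono_subseq:
  fixes s :: "nat \<Rightarrow> nat"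
  shows "\<exists>\<phi>::nat \<Rightarrow> nat. strict_mono \<phi> \<and> mono (\<lambda>k. s (\<phi> k))"
proof -
  obtain f where f: "strict_mono f" "monoseq (\<lambda>n. s (f n))" using seq_monosub by blast
  show ?thesis
  proof (cases "incseq (\<lambda>n. s (f n))")
    case True
    then show ?thesis using f(1) by (intro exI[of _ f]) (auto simp: incseq_def mono_def)
  next
    case False
    then have dec: "s (f n) \<le> s (f m)" if "m \<le> n" for m n
      using f(2) that by (auto simp: monoseq_def incseq_def)
    define m where "m = (LEAST x. x \<in> range (\<lambda>n. s (f n)))"
    have "m \<in> range (\<lambda>n. s (f n))" unfolding m_def by (rule LeastI[of _ "s (f 0)"]) auto
    then obtain N where N: "m = s (f N)" by auto
    have "s (f k) = m" if "k \<ge> N" for k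
      using dec[OF that] N Least_le[of "\<lambda>x. x \<in> range (\<lambda>n. s (f n))" "s (f k)"] by (auto simp: m_def)
    then have "mono (\<lambda>k. s (f (k + N)))" by (auto simp: mono_def)
    moreover have "strict_mono (\<lambda>k. f (k + N))" using f(1) by (auto simp: strict_mono_def)
    ultimately show ?thesis by (intro exI[of _ "\<lambda>k. f (k + N)"]) auto
  qed
qed

lemma mono_subseq_finite:
  fixes s :: "nat \<Rightarrow> 'i \<Rightarrow> nat"
  assumes "finite T"
  shows "\<exists>\<phi>::nat \<Rightarrow> nat. strict_mono \<phi> \<and> (\<forall>i\<in>T. mono (\<lambda>k. s (\<phi> k) i))"
  using assms
proof (induction T)
  case empty
  show ?case by (auto intro!: exI[of _ id] simp: strict_mono_def)
next
  case (insert j T)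
  then obtain \<phi> :: "nat \<Rightarrow> nat" where \<phi>: "strict_mono \<phi>" "\<forall>i\<in>T. mono (\<lambda>k. s (\<phi> k) i)" by auto
  obtain \<psi> :: "nat \<Rightarrow> nat" where \<psi>: "strict_mono \<psi>" "mono (\<lambda>k. s (\<phi> (\<psi> k)) j)"
    using nat_seq_mono_subseq[of "\<lambda>k. s (\<phi> k) j"] by auto
  have "strict_mono (\<lambda>k. \<phi> (\<psi> k))" using \<phi>(1) \<psi>(1) by (auto simp: strict_mono_def)
  moreover have "mono (\<lambda>k. s (\<phi> (\<psi> k)) i)" if "i \<in> T" for i
    using \<phi>(2) \<psi>(1) that by (auto simp: mono_def strict_mono_less_eq)
  ultimately show ?case using \<psi>(2) by (intro exI[of _ "\<lambda>k. \<phi> (\<psi> k)"]) auto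
qed

text \<open>
  Otherwise some infinite sequence has no element that dominates an earlier one; but it has a
  subsequence that is monotone in every coordinate.
\<close>

lemma dickson:
  fixes crd :: "'k \<Rightarrow> 'i \<Rightarrow> nat"
  assumes "finite T"
  shows "\<exists>E0\<subseteq>E. finite E0 \<and> (\<forall>\<mu>\<in>E. \<exists>\<nu>\<in>E0. \<forall>i\<in>T. crd \<nu> i \<le> crd \<mu> i)"
proof (rule ccontr)
  assume neg: "\<not> ?thesis"
  have ex: "\<exists>\<mu>\<in>E. \<forall>\<nu>\<in>E0. \<not> (\<forall>i\<in>T. crd \<nu> i \<le> crd \<mu> i)" if "E0 \<subseteq> E" "finite E0" for E0
  proof (rule ccontr)
    assume "\<not> ?thesis"
    then have "\<forall>\<mu>\<in>E. \<exists>\<nu>\<in>E0. \<forall>i\<in>T. crd \<nu> i \<le> crd \<mu> i" by simp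
    with that neg show False by metis
  qed
  have "\<exists>f::nat \<Rightarrow> 'k. \<forall>k. f k \<in> E \<and> (\<forall>i<k. \<not> (\<forall>j\<in>T. crd (f i) j \<le> crd (f k) j))"
  proof (rule dependent_wellorder_choice)
    fix k and f :: "nat \<Rightarrow> 'k"
    assume "\<And>y. y < k \<Longrightarrow> f y \<in> E \<and> (\<forall>i<y. \<not> (\<forall>j\<in>T. crd (f i) j \<le> crd (f y) j))"
    then have "f ` {..<k} \<subseteq> E" by auto
    from ex[OF this] obtain r where "r \<in> E" "\<forall>\<nu>\<in>f ` {..<k}. \<not> (\<forall>j\<in>T. crd \<nu> j \<le> crd r j)" by auto
    then show "\<exists>r. r \<in> E \<and> (\<forall>i<k. \<not> (\<forall>j\<in>T. crd (f i) j \<le> crd r j))"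
      by (intro exI[of _ r]) simp
  qed simp
  then obtain f :: "nat \<Rightarrow> 'k" where f: "\<forall>i<k. \<not> (\<forall>j\<in>T. crd (f i) j \<le> crd (f k) j)" for k by metis
  obtain \<phi> :: "nat \<Rightarrow> nat" where \<phi>: "strict_mono \<phi>" "\<forall>i\<in>T. mono (\<lambda>k. crd (f (\<phi> k)) i)"
    using mono_subseq_finite[OF assms, of "\<lambda>k. crd (f k)"] by auto
  have "\<phi> 0 < \<phi> 1" using \<phi>(1) by (simp add: strict_mono_def)
  moreover have "\<forall>i\<in>T. crd (f (\<phi> 0)) i \<le> crd (f (\<phi> 1)) i"
    using \<phi>(2) by (auto simp: mono_def)
  ultimately show False using f[of "\<phi> 1"] by blast
qed

section \<open>Transcendental numbers\<close>

text \<open>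
  Transcendence, phrased with integer coefficients.  Powers of such a number serve twice:
  in a tie-breaking order on monomials, and as entries of a generic direction.
\<close>

definition int_independent_powers :: "real \<Rightarrow> bool" where
  "int_independent_powers \<tau> \<longleftrightarrow>
     (\<forall>N (c :: nat \<Rightarrow> int). (\<Sum>i<N. of_int (c i) * \<tau> ^ i) = 0 \<longrightarrow> (\<forall>i<N. c i = 0))"

lemma int_independent_powersD:
  "int_independent_powers \<tau> \<Longrightarrow> (\<Sum>i<N. of_int (c i) * \<tau> ^ i) = 0 \<Longrightarrow> i < N \<Longrightarrow> c i = 0"
  by (simp add: int_independent_powers_def)

text \<open>
  Only countably many reals are algebraic, and an interval is uncountable.
\<close>

lemma ex_int_independent_powers: "\<exists>\<tau>>a. int_independent_powers \<tau>"
proof -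
  let ?ev = "\<lambda>(cs::int list) x::real. \<Sum>i<length cs. of_int (cs ! i) * x ^ i"
  let ?R = "\<lambda>cs. {x. ?ev cs x = 0}"
  have "countable (\<Union>cs\<in>{cs. \<exists>i<length cs. cs ! i \<noteq> 0}. ?R cs)"
  proof (rule countable_UN)
    fix cs :: "int list" assume "cs \<in> {cs. \<exists>i<length cs. cs ! i \<noteq> 0}"
    then obtain i where i: "i < length cs" "cs ! i \<noteq> 0" by auto
    have "finite {x. (\<Sum>i\<le>length cs - 1. (of_int (cs ! i) :: real) * x ^ i) = 0}"
      by (rule polyfun_finite_roots[THEN iffD2]) (use i in \<open>auto intro!: exI[of _ i]\<close>)
    moreover have "{..length cs - 1} = {..<length cs}" using i by auto
    ultimately show "countable (?R cs)" by (simp add: countable_finite)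
  qed (rule countableI_type)
  moreover have "uncountable {a<..<a+1}" by (simp add: uncountable_open_interval)
  ultimately have "\<not> {a<..<a+1} \<subseteq> (\<Union>cs\<in>{cs. \<exists>i<length cs. cs ! i \<noteq> 0}. ?R cs)"
    using countable_subset by blast
  then obtain \<tau> where \<tau>: "\<tau> \<in> {a<..<a+1}" "\<tau> \<notin> (\<Union>cs\<in>{cs. \<exists>i<length cs. cs ! i \<noteq> 0}. ?R cs)"
    unfolding subset_iff by blast
  have \<tau>2: "\<forall>i<length cs. cs ! i = 0" if "?ev cs \<tau> = 0" for cs using \<tau>(2) that by blast
  have "c i = 0" if "(\<Sum>i<N. of_int (c i) * \<tau> ^ i) = 0" "i < N" for N c i
    using \<tau>2[of "map c [0..<N]"] that by simp
  then show ?thesis using \<tau>(1) unfolding greaterThanLessThan_iff int_independent_powers_def by blast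
qed

section \<open>Monomials of the homogenized Weyl algebra\<close>

type_synonym hkey = "exps \<times> exps \<times> nat"

definition hkeys :: "nat \<Rightarrow> hkey set" where "hkeys n = exps_of n \<times> exps_of n \<times> UNIV"

definition hdeg :: "hkey \<Rightarrow> nat" where "hdeg = (\<lambda>(a, b, c). exp_degree a + exp_degree b + c)"

text \<open>
  The exponents of \<open>x\<^sup>a \<partial>\<^sup>b h\<^sup>c\<close> in one list.  The sign of \<open>c\<close> matters: a contraction in a product
  removes factors \<open>x\<close> and \<open>\<partial>\<close> and creates factors \<open>h\<close>, so it raises no coordinate.
\<close>

definition hkey_coord :: "hkey \<Rightarrow> nat \<Rightarrow> int" where
  "hkey_coord = (\<lambda>(a, b, c) i. if i = 0 then - int c else
     if odd i then int (lookup a ((i - 1) div 2)) else int (lookup b ((i - 2) div 2)))"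

text \<open>
  For transcendental \<open>\<tau>\<close> this weight separates monomials, and it decides between those of equal weight
  for \<open>(-w, w)\<close>.
\<close>

definition tie :: "nat \<Rightarrow> real \<Rightarrow> hkey \<Rightarrow> real" where
  "tie n \<tau> \<mu> = (\<Sum>i<2*n+1. of_int (hkey_coord \<mu> i) * \<tau> ^ i)"

lemma exps_of_add [intro]: "a \<in> exps_of n \<Longrightarrow> b \<in> exps_of n \<Longrightarrow> a + b \<in> exps_of n"
  unfolding exps_of_def using keys_add[of a b] by auto
lemma exps_of_minus [intro]: "a \<in> exps_of n \<Longrightarrow> a - b \<in> exps_of n"
  by (auto simp: exps_of_def in_keys_iff lookup_minus subset_iff)
lemma exps_of_zero [simp]: "0 \<in> exps_of n" by (simp add: exps_of_def)
lemma exps_of_lookup: "a \<in> exps_of n \<longleftrightarrow> (\<forall>j\<ge>n. lookup a j = 0)"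
proof -
  have "a \<in> exps_of n \<longleftrightarrow> (\<forall>j. lookup a j \<noteq> 0 \<longrightarrow> j < n)"
    by (auto simp: exps_of_def in_keys_iff subset_iff)
  then show ?thesis by (meson not_le)
qed

lemma weight_eq: "a \<in> exps_of n \<Longrightarrow> weight w a = (\<Sum>j<n. w j * real (lookup a j))"
  unfolding weight_def exps_of_def by (rule sum.mono_neutral_left) (auto simp: in_keys_iff)

lemma weight_add: "weight w (a + b) = weight w a + weight w b"
proof -
  obtain n where "keys a \<union> keys b \<subseteq> {..<n}"
    by (metis finite_Un finite_keys finite_nat_iff_bounded)
  then have "a \<in> exps_of n" "b \<in> exps_of n" by (auto simp: exps_of_def)
  then show ?thesis using weight_eq exps_of_add
    by (simp add: weight_eq[OF exps_of_add] weight_eq lookup_add sum.distrib distrib_left)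
qed

lemma hweyl_weight_add: "hweyl_weight w (\<mu> + \<nu>) = hweyl_weight w \<mu> + hweyl_weight w \<nu>"
  by (auto simp: hweyl_weight_def weight_add split: prod.splits)
lemma hdeg_add: "hdeg (\<mu> + \<nu>) = hdeg \<mu> + hdeg \<nu>"
  by (auto simp: hdeg_def exp_degree_add split: prod.splits)
lemma hkey_coord_add: "hkey_coord (\<mu> + \<nu>) i = hkey_coord \<mu> i + hkey_coord \<nu> i"
  by (auto simp: hkey_coord_def lookup_add split: prod.splits)
lemma tie_add: "tie n \<tau> (\<mu> + \<nu>) = tie n \<tau> \<mu> + tie n \<tau> \<nu>"
  by (simp add: tie_def hkey_coord_add distrib_right sum.distrib)

lemma hkey_coord_eq:
  assumes "\<mu> \<in> hkeys n" "\<nu> \<in> hkeys n" "\<And>i. i < 2*n+1 \<Longrightarrow> hkey_coord \<mu> i = hkey_coord \<nu> i"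
  shows "\<mu> = \<nu>"
proof -
  obtain a b c where \<mu>: "\<mu> = (a, b, c)" by (cases \<mu>) auto
  obtain a' b' c' where \<nu>: "\<nu> = (a', b', c')" by (cases \<nu>) auto
  have "c = c'" using assms(3)[of 0] by (simp add: \<mu> \<nu> hkey_coord_def)
  moreover have "lookup a j = lookup a' j" for j
    using assms(3)[of "2*j+1"] assms(1,2) by (cases "j < n") (auto simp: \<mu> \<nu> hkey_coord_def hkeys_def exps_of_lookup not_less)
  moreover have "lookup b j = lookup b' j" for j
    using assms(3)[of "2*j+2"] assms(1,2) by (cases "j < n") (auto simp: \<mu> \<nu> hkey_coord_def hkeys_def exps_of_lookup not_less)
  ultimately show ?thesis by (auto simp: \<mu> \<nu> intro: exps_eqI)
qed

lemma tie_inj: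
  assumes "int_independent_powers \<tau>" "\<mu> \<in> hkeys n" "\<nu> \<in> hkeys n" "tie n \<tau> \<mu> = tie n \<tau> \<nu>"
  shows "\<mu> = \<nu>"
proof (rule hkey_coord_eq[OF assms(2,3)])
  have "(\<Sum>i<2*n+1. of_int (hkey_coord \<mu> i - hkey_coord \<nu> i) * \<tau> ^ i) = 0"
    using assms(4) by (simp add: tie_def left_diff_distrib sum_subtractf)
  then show "i < 2*n+1 \<Longrightarrow> hkey_coord \<mu> i = hkey_coord \<nu> i" for i
    using int_independent_powersD[OF assms(1), of "\<lambda>i. hkey_coord \<mu> i - hkey_coord \<nu> i" "2*n+1" i] by simp
qed

lemma finite_hkeys_hdeg: "finite {\<mu> \<in> hkeys n. hdeg \<mu> \<le> N}"
proof (rule finite_imageD)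
  let ?g = "\<lambda>\<mu> i. if i < 2*n+1 then hkey_coord \<mu> i else 0"
  have le: "lookup a j \<le> exp_degree a" for a j
    by (cases "j \<in> keys a") (auto simp: exp_degree_def in_keys_iff intro: member_le_sum)
  have "?g ` {\<mu> \<in> hkeys n. hdeg \<mu> \<le> N} \<subseteq>
    {f. \<forall>i. (i \<in> {..<2*n+1} \<longrightarrow> f i \<in> {- int N..int N}) \<and> (i \<notin> {..<2*n+1} \<longrightarrow> f i = 0)}"
  proof clarsimp
    fix a b c i assume "hdeg (a, b, c) \<le> N"
    then show "- int N \<le> hkey_coord (a, b, c) i \<and> hkey_coord (a, b, c) i \<le> int N"
      using le[of a "(i - 1) div 2"] le[of b "(i - 2) div 2"] by (auto simp: hdeg_def hkey_coord_def)
  qed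
  then show "finite (?g ` {\<mu> \<in> hkeys n. hdeg \<mu> \<le> N})"
    by (rule finite_subset) (rule finite_set_of_finite_funs; simp)
  show "inj_on ?g {\<mu> \<in> hkeys n. hdeg \<mu> \<le> N}"
  proof (rule inj_onI)
    fix \<mu> \<nu> assume *: "\<mu> \<in> {\<mu> \<in> hkeys n. hdeg \<mu> \<le> N}" "\<nu> \<in> {\<mu> \<in> hkeys n. hdeg \<mu> \<le> N}" "?g \<mu> = ?g \<nu>"
    show "\<mu> = \<nu>" by (rule hkey_coord_eq[of _ n]) (use * in \<open>auto dest!: fun_cong split: if_splits\<close>)
  qed
qed

lemma keys_sum_subset: "keys (sum f A) \<subseteq> (\<Union>x\<in>A. keys (f x :: 'k \<Rightarrow>\<^sub>0 'a::comm_monoid_add))"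
proof
  fix k assume "k \<in> keys (sum f A)"
  then have "(\<Sum>x\<in>A. lookup (f x) k) \<noteq> 0" by (simp add: in_keys_iff lookup_sum)
  then obtain x where "x \<in> A" "lookup (f x) k \<noteq> 0" by (metis sum.not_neutral_contains_not_neutral)
  then show "k \<in> (\<Union>x\<in>A. keys (f x))" by (auto simp: in_keys_iff)
qed

text \<open>
  The product of two monomials is homogeneous for the weight \<open>(-w, w)\<close> and for the total degree, because
  every contraction trades \<open>x\<^sub>j \<partial>\<^sub>j\<close>, of weight \<open>0\<close>, for \<open>h\<^sup>2\<close>.  The tie-breaking weight is not
  preserved: the uncontracted term is strictly on top.
\<close>

lemma keys_hweyl_basis_mult:
  assumes "\<kappa> \<in> keys (hweyl_basis_mult \<mu> \<nu>)"
  shows "hweyl_weight w \<kappa> = hweyl_weight w \<mu> + hweyl_weight w \<nu>"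
    and "hdeg \<kappa> = hdeg \<mu> + hdeg \<nu>"
    and "\<mu> \<in> hkeys n \<Longrightarrow> \<nu> \<in> hkeys n \<Longrightarrow> \<kappa> \<in> hkeys n"
    and "\<tau> > 0 \<Longrightarrow> \<kappa> = \<mu> + \<nu> \<or> tie n \<tau> \<kappa> < tie n \<tau> \<mu> + tie n \<tau> \<nu>"
proof -
  obtain a b p where \<mu>: "\<mu> = (a, b, p)" by (cases \<mu>) auto
  obtain c e q where \<nu>: "\<nu> = (c, e, q)" by (cases \<nu>) auto
  have "\<kappa> \<in> (\<Union>k\<in>contractions b c. keys (Poly_Mapping.single (a + (c - k), (b - k) + e, p + q + 2 * exp_degree k)
     (of_nat (leibniz_coeff b c k) :: complex)))"
    by (rule subsetD[OF keys_sum_subset]) (use assms in \<open>simp add: \<mu> \<nu> hweyl_basis_mult_def\<close>)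
  then obtain k where k: "k \<in> contractions b c" and \<kappa>: "\<kappa> = (a + (c - k), (b - k) + e, p + q + 2 * exp_degree k)"
    by (auto split: if_splits)
  have b: "b = (b - k) + k" and c: "c = (c - k) + k"
    using k by (auto intro!: exps_eqI simp: contractions_def exp_dvd_def lookup_add lookup_minus)
  have "weight w b = weight w (b - k) + weight w k" "weight w c = weight w (c - k) + weight w k"
    using b c by (metis weight_add)+
  then show "hweyl_weight w \<kappa> = hweyl_weight w \<mu> + hweyl_weight w \<nu>"
    by (simp add: \<mu> \<nu> \<kappa> hweyl_weight_def weight_add)
  have "exp_degree b = exp_degree (b - k) + exp_degree k" "exp_degree c = exp_degree (c - k) + exp_degree k"
    using b c by (metis exp_degree_add)+
  then show "hdeg \<kappa> = hdeg \<mu> + hdeg \<nu>"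
    by (simp add: \<mu> \<nu> \<kappa> hdeg_def exp_degree_add)
  show "\<mu> \<in> hkeys n \<Longrightarrow> \<nu> \<in> hkeys n \<Longrightarrow> \<kappa> \<in> hkeys n" by (auto simp: \<mu> \<nu> \<kappa> hkeys_def)
  assume \<tau>: "\<tau> > 0"
  show "\<kappa> = \<mu> + \<nu> \<or> tie n \<tau> \<kappa> < tie n \<tau> \<mu> + tie n \<tau> \<nu>"
  proof (cases "k = 0")
    case True
    then show ?thesis by (simp add: \<mu> \<nu> \<kappa>)
  next
    case False
    have "exp_degree k > 0" using False
      by (auto simp: exp_degree_def in_keys_iff intro!: poly_mapping_eqI)
    then have "hkey_coord \<kappa> 0 < hkey_coord (\<mu> + \<nu>) 0" by (simp add: \<mu> \<nu> \<kappa> hkey_coord_def)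
    moreover have "hkey_coord \<kappa> i \<le> hkey_coord (\<mu> + \<nu>) i" for i
      by (auto simp: \<mu> \<nu> \<kappa> hkey_coord_def lookup_add lookup_minus)
    ultimately have "tie n \<tau> \<kappa> < tie n \<tau> (\<mu> + \<nu>)"
      unfolding tie_def using \<tau>
      by (intro sum_strict_mono_ex1) (auto intro!: mult_right_mono bexI[of _ 0])
    then show ?thesis by (simp add: tie_add)
  qed
qed

lemma lookup_hweyl_basis_mult_top: "lookup (hweyl_basis_mult \<mu> \<nu>) (\<mu> + \<nu>) = 1"
proof -
  obtain a b p where \<mu>: "\<mu> = (a, b, p)" by (cases \<mu>) auto
  obtain c e q where \<nu>: "\<nu> = (c, e, q)" by (cases \<nu>) auto
  have pos: "exp_degree k = 0 \<Longrightarrow> k = 0" for k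
    by (auto simp: exp_degree_def in_keys_iff intro!: poly_mapping_eqI)
  have "lookup (hweyl_basis_mult \<mu> \<nu>) (\<mu> + \<nu>) = (\<Sum>k\<in>contractions b c. if k = 0 then 1 else 0)"
    unfolding \<mu> \<nu> hweyl_basis_mult_def prod.case lookup_sum
    by (rule sum.cong) (auto simp: lookup_single when_def dest: pos)
  also have "\<dots> = 1"
  proof -
    have "0 \<in> contractions b c" by (simp add: contractions_def exp_dvd_def)
    then show ?thesis by (simp add: sum.delta)
  qed
  finally show ?thesis .
qed

section \<open>Leading monomials\<close>

definition restr :: "'k set \<Rightarrow> ('k \<Rightarrow>\<^sub>0 complex) \<Rightarrow> ('k \<Rightarrow>\<^sub>0 complex)" where
  "restr S f = (\<Sum>m\<in>{m \<in> keys f. m \<in> S}. Poly_Mapping.single m (lookup f m))"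

lemma lookup_restr: "lookup (restr S f) m = (if m \<in> S then lookup f m else 0)"
  unfolding restr_def by (auto simp: lookup_sum lookup_single when_def in_keys_iff sum.If_cases intro!: sum.neutral)

lemma restr_add: "restr S (f + g) = restr S f + restr S g"
  by (intro poly_mapping_eqI) (simp add: lookup_restr lookup_add)
lemma restr_zero [simp]: "restr S 0 = 0"
  by (intro poly_mapping_eqI) (simp add: lookup_restr)
lemma lookup_scale: "lookup (Poly_Mapping.single 0 c * P) k = c * lookup (P :: 'k::comm_monoid_add \<Rightarrow>\<^sub>0 complex) k"
  by (simp flip: mult_map_scale_conv_mult add: Poly_Mapping.map.rep_eq when_def)
lemma restr_scale: "restr S (Poly_Mapping.single 0 c * P) = Poly_Mapping.single 0 c * restr S (P :: 'k::comm_monoid_add \<Rightarrow>\<^sub>0 complex)"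
  by (intro poly_mapping_eqI) (simp add: lookup_restr lookup_scale)
lemma keys_restr: "keys (restr S f) = keys f \<inter> S"
  by (auto simp: in_keys_iff lookup_restr split: if_splits)

lemma initial_form_restr: "initial_form wt f = restr {m. \<forall>m'\<in>keys f. wt m' \<le> wt m} f"
  unfolding initial_form_def restr_def by simp

abbreviation hm :: "hkey \<Rightarrow> hweyl \<Rightarrow> hweyl" where
  "hm \<mu> f \<equiv> hweyl_mult (Poly_Mapping.single \<mu> 1) f"

lemma hm_zero [simp]: "hm \<mu> 0 = 0" by (simp add: hweyl_mult_bil)
lemma hm_eq: "hm \<mu> f = lin (hweyl_basis_mult \<mu>) f" by (simp add: hweyl_mult_bil bil_def)

lemma lookup_hm: "lookup (hm \<mu> f) \<kappa> = (\<Sum>\<nu>\<in>keys f. lookup f \<nu> * lookup (hweyl_basis_mult \<mu> \<nu>) \<kappa>)"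
  by (simp add: hm_eq lin_def lookup_sum lookup_scale)

lemma keys_hm: "\<kappa> \<in> keys (hm \<mu> f) \<Longrightarrow> \<exists>\<nu>\<in>keys f. \<kappa> \<in> keys (hweyl_basis_mult \<mu> \<nu>)"
proof -
  assume "\<kappa> \<in> keys (hm \<mu> f)"
  then have "(\<Sum>\<nu>\<in>keys f. lookup f \<nu> * lookup (hweyl_basis_mult \<mu> \<nu>) \<kappa>) \<noteq> 0"
    by (simp add: in_keys_iff lookup_hm)
  then obtain \<nu> where "\<nu> \<in> keys f" "lookup f \<nu> * lookup (hweyl_basis_mult \<mu> \<nu>) \<kappa> \<noteq> 0"
    by (metis (mono_tags, lifting) sum.not_neutral_contains_not_neutral)
  then show ?thesis by (intro bexI[of _ \<nu>]) (auto simp: in_keys_iff)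
qed

text \<open>
  Graded parts of a product with a monomial come from graded parts of the other factor, for any grading
  that the product respects.
\<close>

lemma restr_hm:
  assumes \<pi>: "\<And>\<nu> \<kappa>. \<nu> \<in> keys f \<Longrightarrow> \<kappa> \<in> keys (hweyl_basis_mult \<mu> \<nu>) \<Longrightarrow> \<kappa> \<in> S \<longleftrightarrow> \<nu> \<in> T"
  shows "restr S (hm \<mu> f) = hm \<mu> (restr T f)"
proof (intro poly_mapping_eqI)
  fix \<kappa>
  have "(if \<kappa> \<in> S then (\<Sum>\<nu>\<in>keys f. lookup f \<nu> * lookup (hweyl_basis_mult \<mu> \<nu>) \<kappa>) else 0)
     = (\<Sum>\<nu>\<in>keys f \<inter> T. lookup f \<nu> * lookup (hweyl_basis_mult \<mu> \<nu>) \<kappa>)"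
  proof (cases "\<kappa> \<in> S")
    case True
    then show ?thesis using \<pi>[of _ \<kappa>] by (auto intro!: sum.mono_neutral_right simp: in_keys_iff)
  next
    case False
    have "(\<Sum>\<nu>\<in>keys f \<inter> T. lookup f \<nu> * lookup (hweyl_basis_mult \<mu> \<nu>) \<kappa>) = 0"
    proof (rule sum.neutral, rule ballI)
      fix \<nu> assume "\<nu> \<in> keys f \<inter> T"
      then have "\<kappa> \<notin> keys (hweyl_basis_mult \<mu> \<nu>)" using \<pi>[of \<nu> \<kappa>] False by blast
      then show "lookup f \<nu> * lookup (hweyl_basis_mult \<mu> \<nu>) \<kappa> = 0" by (simp add: in_keys_iff)
    qed
    then show ?thesis using False by simp
  qed
  moreover have "lookup (hm \<mu> (restr T f)) \<kappa> = (\<Sum>\<nu>\<in>keys f \<inter> T. lookup f \<nu> * lookup (hweyl_basis_mult \<mu> \<nu>) \<kappa>)"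
    unfolding lookup_hm keys_restr by (rule sum.cong) (simp_all add: lookup_restr)
  ultimately show "lookup (restr S (hm \<mu> f)) \<kappa> = lookup (hm \<mu> (restr T f)) \<kappa>"
    unfolding lookup_restr[of S] lookup_hm[of \<mu> f] by (rule trans[OF _ sym])
qed

text \<open>
  This is no well-order, as weights of monomials may be negative.  Arguments by descent therefore stay
  in bounded total degree, where only finitely many monomials exist.
\<close>

definition hless :: "nat \<Rightarrow> real \<Rightarrow> (nat \<Rightarrow> real) \<Rightarrow> hkey \<Rightarrow> hkey \<Rightarrow> bool" where
  "hless n \<tau> w \<mu> \<nu> \<longleftrightarrow> hweyl_weight w \<mu> < hweyl_weight w \<nu>
     \<or> hweyl_weight w \<mu> = hweyl_weight w \<nu> \<and> tie n \<tau> \<mu> < tie n \<tau> \<nu>"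

definition is_max :: "nat \<Rightarrow> real \<Rightarrow> (nat \<Rightarrow> real) \<Rightarrow> hkey set \<Rightarrow> hkey \<Rightarrow> bool" where
  "is_max n \<tau> w S \<mu> \<longleftrightarrow> \<mu> \<in> S \<and> (\<forall>\<nu>\<in>S. \<nu> = \<mu> \<or> hless n \<tau> w \<nu> \<mu>)"

lemma hless_trans: "hless n \<tau> w a b \<Longrightarrow> hless n \<tau> w b c \<Longrightarrow> hless n \<tau> w a c"
  by (auto simp: hless_def)
lemma hless_irrefl [simp]: "\<not> hless n \<tau> w a a"
  by (auto simp: hless_def)
lemma hless_asym: "hless n \<tau> w a b \<Longrightarrow> \<not> hless n \<tau> w b a"
  by (auto simp: hless_def)

text \<open>
  The tie-breaking weight separates monomials, so the largest one is unique.
\<close>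

lemma ex_is_max:
  assumes "int_independent_powers \<tau>" "finite S" "S \<noteq> {}" "S \<subseteq> hkeys n"
  shows "\<exists>\<mu>. is_max n \<tau> w S \<mu>"
proof -
  define S' where "S' = {\<mu>\<in>S. hweyl_weight w \<mu> = Max (hweyl_weight w ` S)}"
  have "Max (hweyl_weight w ` S) \<in> hweyl_weight w ` S" using assms by (intro Max_in) auto
  then obtain \<mu>0 where "\<mu>0 \<in> S" "hweyl_weight w \<mu>0 = Max (hweyl_weight w ` S)"
    by (metis (no_types, lifting) imageE)
  then have "\<mu>0 \<in> S'" by (simp add: S'_def)
  then have S': "S' \<noteq> {}" "finite S'" using assms(2) by (blast, simp add: S'_def)
  then have "Max (tie n \<tau> ` S') \<in> tie n \<tau> ` S'" by (intro Max_in) auto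
  then obtain \<mu> where \<mu>: "\<mu> \<in> S'" "tie n \<tau> \<mu> = Max (tie n \<tau> ` S')" by auto
  have top: "\<nu> = \<mu> \<or> hless n \<tau> w \<nu> \<mu>" if "\<nu> \<in> S" for \<nu>
  proof (cases "\<nu> \<in> S'")
    case True
    have "tie n \<tau> \<nu> \<le> tie n \<tau> \<mu>" using \<mu>(2) True S' by simp
    moreover have "\<nu> \<in> hkeys n" "\<mu> \<in> hkeys n" using that \<mu>(1) assms(4) by (auto simp: S'_def)
    ultimately show ?thesis using True \<mu>(1) tie_inj[OF assms(1), of \<nu> n \<mu>]
      by (auto simp: hless_def S'_def)
  next
    case False
    have "hweyl_weight w \<nu> \<le> hweyl_weight w \<mu>" using \<mu>(1) that assms(2) by (simp add: S'_def)
    then show ?thesis using False \<mu> that by (auto simp: hless_def S'_def)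
  qed
  have "\<mu> \<in> S" using \<mu>(1) by (simp add: S'_def)
  then show ?thesis using top unfolding is_max_def by blast
qed

lemma is_max_hm:
  assumes "\<tau> > 0" "is_max n \<tau> w (keys f) \<nu>"
  shows "is_max n \<tau> w (keys (hm \<mu> f)) (\<mu> + \<nu>)" and "lookup (hm \<mu> f) (\<mu> + \<nu>) = lookup f \<nu>"
proof -
  have A: "\<kappa> = \<mu> + \<nu> \<and> \<nu>' = \<nu> \<or> hless n \<tau> w \<kappa> (\<mu> + \<nu>)"
    if "\<nu>' \<in> keys f" "\<kappa> \<in> keys (hweyl_basis_mult \<mu> \<nu>')" for \<nu>' \<kappa>
  proof -
    have "\<nu>' = \<nu> \<or> hless n \<tau> w \<nu>' \<nu>" using assms(2) that(1) by (auto simp: is_max_def)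
    moreover have "\<kappa> = \<mu> + \<nu>' \<or> tie n \<tau> \<kappa> < tie n \<tau> \<mu> + tie n \<tau> \<nu>'"
      using keys_hweyl_basis_mult(4)[OF that(2) assms(1)] .
    moreover have "hweyl_weight w \<kappa> = hweyl_weight w \<mu> + hweyl_weight w \<nu>'"
      using keys_hweyl_basis_mult(1)[OF that(2)] .
    ultimately show ?thesis by (auto simp: hless_def hweyl_weight_add tie_add)
  qed
  have "lookup (hm \<mu> f) (\<mu> + \<nu>) = (\<Sum>\<nu>'\<in>keys f. if \<nu>' = \<nu> then lookup f \<nu> else 0)"
    unfolding lookup_hm
  proof (rule sum.cong[OF refl])
    fix \<nu>' assume \<nu>': "\<nu>' \<in> keys f"
    show "lookup f \<nu>' * lookup (hweyl_basis_mult \<mu> \<nu>') (\<mu> + \<nu>) = (if \<nu>' = \<nu> then lookup f \<nu> else 0)"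
      using A[OF \<nu>', of "\<mu> + \<nu>"] by (auto simp: lookup_hweyl_basis_mult_top in_keys_iff)
  qed
  also have "\<dots> = lookup f \<nu>" using assms(2) by (simp add: is_max_def sum.delta)
  finally show 1: "lookup (hm \<mu> f) (\<mu> + \<nu>) = lookup f \<nu>" .
  show "is_max n \<tau> w (keys (hm \<mu> f)) (\<mu> + \<nu>)"
    unfolding is_max_def
  proof (intro conjI ballI)
    show "\<mu> + \<nu> \<in> keys (hm \<mu> f)" using 1 assms(2) by (auto simp: is_max_def in_keys_iff)
    fix \<kappa> assume "\<kappa> \<in> keys (hm \<mu> f)"
    then show "\<kappa> = \<mu> + \<nu> \<or> hless n \<tau> w \<kappa> (\<mu> + \<nu>)" using keys_hm A by blast
  qed
qed

section \<open>Left ideals\<close>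

lemma left_ideal_gen_zero: "0 \<in> left_ideal_gen mul R S"
  unfolding left_ideal_gen_def by (auto intro!: exI[of _ "0::nat"])

lemma left_ideal_gen_incl: "a \<in> R \<Longrightarrow> s \<in> S \<Longrightarrow> mul a s \<in> left_ideal_gen mul R S"
  unfolding left_ideal_gen_def
  by (rule CollectI, rule exI[of _ "1::nat"], rule exI[of _ "\<lambda>_. a"], rule exI[of _ "\<lambda>_. s"]) simp

lemma left_ideal_gen_add:
  assumes "f \<in> left_ideal_gen mul R S" "g \<in> left_ideal_gen mul R S"
  shows "f + g \<in> left_ideal_gen mul R S"
proof -
  obtain k :: nat and a s where f: "f = (\<Sum>i<k. mul (a i) (s i))" "\<forall>i<k. a i \<in> R \<and> s i \<in> S"
    using assms(1) unfolding left_ideal_gen_def by blast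
  obtain l :: nat and b t where g: "g = (\<Sum>i<l. mul (b i) (t i))" "\<forall>i<l. b i \<in> R \<and> t i \<in> S"
    using assms(2) unfolding left_ideal_gen_def by blast
  let ?a = "\<lambda>i. if i < k then a i else b (i - k)" and ?s = "\<lambda>i. if i < k then s i else t (i - k)"
  have "(\<Sum>i<k+m. mul (?a i) (?s i)) = f + (\<Sum>i<m. mul (b i) (t i))" for m
    by (induction m) (simp_all add: f add.assoc)
  from this[of l] have "(\<Sum>i<k+l. mul (?a i) (?s i)) = f + g" by (simp add: g)
  moreover have "\<forall>i<k+l. ?a i \<in> R \<and> ?s i \<in> S" using f(2) g(2) by auto
  ultimately show ?thesis unfolding left_ideal_gen_def
    by (intro CollectI, rule_tac exI[of _ "k + l"], rule_tac exI[of _ ?a], rule_tac exI[of _ ?s]) simp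
qed

lemma left_ideal_gen_induct [consumes 1, case_names zero add mult]:
  assumes "f \<in> left_ideal_gen mul R S"
    and "P 0" "\<And>f g. P f \<Longrightarrow> P g \<Longrightarrow> P (f + g)" "\<And>a s. a \<in> R \<Longrightarrow> s \<in> S \<Longrightarrow> P (mul a s)"
  shows "P f"
proof -
  obtain k :: nat and a s where f: "f = (\<Sum>i<k. mul (a i) (s i))" "\<forall>i<k. a i \<in> R \<and> s i \<in> S"
    using assms(1) unfolding left_ideal_gen_def by blast
  have "P (\<Sum>i<m. mul (a i) (s i))" if "m \<le> k" for m
    using that by (induction m) (use f(2) in \<open>auto intro!: assms(2-4)\<close>)
  then show ?thesis using f(1) by simp
qed

definition is_left_ideal :: "('a::comm_monoid_add \<Rightarrow> 'a \<Rightarrow> 'a) \<Rightarrow> 'a set \<Rightarrow> 'a set \<Rightarrow> bool" where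
  "is_left_ideal mul R I \<longleftrightarrow> 0 \<in> I \<and> (\<forall>f\<in>I. \<forall>g\<in>I. f + g \<in> I) \<and> (\<forall>a\<in>R. \<forall>f\<in>I. mul a f \<in> I)"

lemma left_ideal_gen_subset:
  assumes "is_left_ideal mul R I" "S \<subseteq> I" shows "left_ideal_gen mul R S \<subseteq> I"
proof
  fix f assume "f \<in> left_ideal_gen mul R S"
  then show "f \<in> I"
    by (induction rule: left_ideal_gen_induct) (use assms in \<open>auto simp: is_left_ideal_def\<close>)
qed

lemma left_ideal_gen_mono: "S \<subseteq> S' \<Longrightarrow> left_ideal_gen mul R S \<subseteq> left_ideal_gen mul R S'"
  unfolding left_ideal_gen_def by blast

lemma is_left_ideal_gen:
  assumes "\<And>a. mul a 0 = 0" "\<And>a f g. mul a (f + g) = mul a f + mul a g"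
    "\<And>a b f. mul a (mul b f) = mul (mul a b) f" "\<And>a b. a \<in> R \<Longrightarrow> b \<in> R \<Longrightarrow> mul a b \<in> R"
  shows "is_left_ideal mul R (left_ideal_gen mul R S)"
  unfolding is_left_ideal_def
proof (intro conjI ballI)
  fix a f assume a: "a \<in> R" and "f \<in> left_ideal_gen mul R S"
  from this(2) show "mul a f \<in> left_ideal_gen mul R S"
    by (induction rule: left_ideal_gen_induct)
       (use a in \<open>auto simp: assms left_ideal_gen_zero intro: left_ideal_gen_add left_ideal_gen_incl\<close>)
qed (auto intro: left_ideal_gen_zero left_ideal_gen_add)

lemma hweyl_algebra_eq: "hweyl_algebra n = {P. keys P \<subseteq> hkeys n}"
  by (simp add: hweyl_algebra_def hkeys_def)

lemma lin_keys_subset: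
  assumes "\<And>k. k \<in> keys P \<Longrightarrow> keys (f k) \<subseteq> S" shows "keys (lin f P) \<subseteq> S"
proof -
  have "keys (Poly_Mapping.single 0 c * f k) \<subseteq> S" if "k \<in> keys P" for c k
    using assms[OF that] by (auto simp: in_keys_iff lookup_scale)
  then show ?thesis unfolding lin_def by (intro order.trans[OF keys_sum_subset] UN_least)
qed

lemma hweyl_mult_closed:
  assumes "P \<in> hweyl_algebra n" "Q \<in> hweyl_algebra n" shows "hweyl_mult P Q \<in> hweyl_algebra n"
  unfolding hweyl_mult_bil bil_def hweyl_algebra_eq mem_Collect_eq
  by (intro lin_keys_subset) (use assms keys_hweyl_basis_mult(3) in \<open>auto simp: hweyl_algebra_eq subset_iff\<close>)

lemma is_left_ideal_hweyl: "is_left_ideal hweyl_mult (hweyl_algebra n) (left_ideal_gen hweyl_mult (hweyl_algebra n) S)"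
  by (rule is_left_ideal_gen)
     (auto simp: hweyl_mult_bil bil_add_right hweyl_mult_assoc[symmetric, unfolded hweyl_mult_bil]
       intro: hweyl_mult_closed[unfolded hweyl_mult_bil])

lemma hweyl_scale_mult: "Poly_Mapping.single 0 c * f = hweyl_mult (Poly_Mapping.single 0 c) f"
proof (induction f rule: poly_mapping_additive_induct)
  case (single \<nu> t)
  have "contractions 0 x = {0}" for x
    by (auto simp: contractions_def exp_dvd_def intro: exps_eqI)
  then show ?case by (cases \<nu>) (simp add: hweyl_mult_bil bil_single zero_prod_def hweyl_basis_mult_def mult_single)
qed (auto simp: hweyl_mult_bil bil_add_right distrib_left)

text \<open>
  Homogeneous for the total degree in \<open>x\<close>, \<open>\<partial>\<close> and \<open>h\<close>.  Homogenization exists to get this property: with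
  homogeneous divisors, division stays in bounded degree, and hence ends.
\<close>

definition homogeneous_ideal :: "hweyl set \<Rightarrow> bool" where
  "homogeneous_ideal I \<longleftrightarrow> (\<forall>f\<in>I. \<forall>d. restr {\<mu>. hdeg \<mu> = d} f \<in> I)"

lemma hdeg_homogenize:
  assumes "\<mu> \<in> keys (homogenize P)" shows "hdeg \<mu> = weyl_degree P"
proof -
  have "\<mu> \<in> (\<Union>x\<in>keys P. keys (case x of (a, b) \<Rightarrow>
      Poly_Mapping.single (a, b, weyl_degree P - (exp_degree a + exp_degree b)) (lookup P (a, b))))"
    by (rule subsetD[OF keys_sum_subset]) (use assms in \<open>simp add: homogenize_def\<close>)
  then obtain a b where ab: "(a, b) \<in> keys P" "\<mu> = (a, b, weyl_degree P - (exp_degree a + exp_degree b))"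
    by (auto split: if_splits)
  have "exp_degree a + exp_degree b \<le> weyl_degree P"
    unfolding weyl_degree_def by (rule Max_ge) (use ab(1) in \<open>auto intro!: image_eqI[of _ _ "(a, b)"]\<close>)
  then show ?thesis by (simp add: ab hdeg_def)
qed

lemma homogenize_closed:
  assumes "P \<in> weyl_algebra n" shows "homogenize P \<in> hweyl_algebra n"
proof -
  have "keys (homogenize P) \<subseteq> (\<Union>x\<in>keys P. keys (case x of (a, b) \<Rightarrow>
      Poly_Mapping.single (a, b, weyl_degree P - (exp_degree a + exp_degree b)) (lookup P (a, b))))"
    unfolding homogenize_def by (rule keys_sum_subset)
  also have "\<dots> \<subseteq> hkeys n" using assms by (auto simp: weyl_algebra_def hkeys_def split: if_splits)
  finally show ?thesis by (simp add: hweyl_algebra_eq)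
qed

lemma restr_mult_homogeneous:
  assumes "\<And>\<nu>. \<nu> \<in> keys s \<Longrightarrow> hdeg \<nu> = e"
  shows "restr {\<kappa>. hdeg \<kappa> = d} (hweyl_mult a s) = hweyl_mult (restr {\<mu>. hdeg \<mu> + e = d} a) s"
proof (induction a rule: poly_mapping_additive_induct)
  case (single \<mu> c)
  have 1: "restr {\<kappa>. hdeg \<kappa> = d} (hm \<mu> s) = hm \<mu> (restr {\<nu>. hdeg \<mu> + e = d} s)"
    by (rule restr_hm) (use assms keys_hweyl_basis_mult(2) in auto)
  have 2: "Poly_Mapping.single \<mu> c = Poly_Mapping.single 0 c * Poly_Mapping.single \<mu> 1"
    by (simp add: mult_single)
  have 3: "restr {\<mu>. hdeg \<mu> + e = d} (Poly_Mapping.single \<mu> 1) = (if hdeg \<mu> + e = d then Poly_Mapping.single \<mu> 1 else 0)"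
    by (intro poly_mapping_eqI) (auto simp: lookup_restr lookup_single when_def)
  have 4: "restr {\<nu>. hdeg \<mu> + e = d} s = (if hdeg \<mu> + e = d then s else 0)"
    by (intro poly_mapping_eqI) (auto simp: lookup_restr)
  show ?case unfolding 2 hweyl_mult_bil bil_scale_left restr_scale 1[unfolded hweyl_mult_bil] 3 4
    by simp
qed (auto simp: hweyl_mult_bil bil_add_left restr_add)

lemma homogeneous_homogenized_ideal: "homogeneous_ideal (homogenized_ideal n H)"
  unfolding homogeneous_ideal_def
proof (intro ballI allI)
  fix f d assume "f \<in> homogenized_ideal n H"
  then show "restr {\<mu>. hdeg \<mu> = d} f \<in> homogenized_ideal n H"
    unfolding homogenized_ideal_def
  proof (induction rule: left_ideal_gen_induct)
    case (mult a s)
    then obtain P where s: "s = homogenize P" "P \<in> H" by auto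
    have "restr {\<mu>. hdeg \<mu> = d} (hweyl_mult a s) = hweyl_mult (restr {\<mu>. hdeg \<mu> + weyl_degree P = d} a) s"
      by (rule restr_mult_homogeneous) (simp add: s hdeg_homogenize)
    then show ?case using mult by (auto intro!: left_ideal_gen_incl simp: hweyl_algebra_eq keys_restr)
  qed (auto simp: restr_add left_ideal_gen_zero intro: left_ideal_gen_add)
qed

section \<open>Division with remainder\<close>

lemma single_closed: "\<mu> \<in> hkeys n \<Longrightarrow> Poly_Mapping.single \<mu> c \<in> hweyl_algebra n"
  by (simp add: hweyl_algebra_eq)

lemma zero_hkey: "0 \<in> hkeys n" by (simp add: hkeys_def zero_prod_def)

lemma left_ideal_scale:
  assumes "is_left_ideal hweyl_mult (hweyl_algebra n) I" "f \<in> I"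
  shows "Poly_Mapping.single 0 c * f \<in> I"
  using assms single_closed[OF zero_hkey] unfolding hweyl_scale_mult is_left_ideal_def by blast

lemma left_ideal_diff:
  assumes "is_left_ideal hweyl_mult (hweyl_algebra n) I" "f \<in> I" "g \<in> I"
  shows "f - g \<in> I"
proof -
  have "f - g = f + Poly_Mapping.single 0 (-1) * g"
    by (intro poly_mapping_eqI) (simp add: lookup_add lookup_minus lookup_scale)
  moreover have "f + Poly_Mapping.single 0 (-1) * g \<in> I"
    using left_ideal_scale[OF assms(1,3)] assms(1,2) unfolding is_left_ideal_def by blast
  ultimately show ?thesis by (simp only:)
qed

lemma hweyl_gen_incl: "f \<in> S \<Longrightarrow> f \<in> left_ideal_gen hweyl_mult (hweyl_algebra n) S"
proof -
  assume f: "f \<in> S"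
  have "hweyl_mult (Poly_Mapping.single 0 1) f = Poly_Mapping.single 0 1 * f" by (rule hweyl_scale_mult[symmetric])
  then show ?thesis using left_ideal_gen_incl[where mul = hweyl_mult, OF single_closed[OF zero_hkey[of n], of 1] f] by simp
qed

text \<open>
  Division by homogeneous elements \<open>F \<nu>\<close> with leading monomials \<open>\<nu>\<close>.  The point is the control on the
  part of top weight \<open>\<Omega>\<close>: every multiple \<open>c x\<^sup>a \<partial>\<^sup>b h\<^sup>p F \<nu>\<close> that is subtracted contributes to it only
  through the initial form of \<open>F \<nu>\<close>, so the part of weight \<open>\<Omega>\<close> of the quotient part \<open>g\<close> stays in any
  left ideal \<open>J\<close> that contains these initial forms.
\<close>

lemma groebner_division:
  fixes E0 :: "hkey set" and F :: "hkey \<Rightarrow> hweyl"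
  assumes I: "is_left_ideal hweyl_mult (hweyl_algebra n) I"
    and \<tau>: "int_independent_powers \<tau>" "\<tau> > 0"
    and F: "\<And>\<nu>. \<nu> \<in> E0 \<Longrightarrow> F \<nu> \<in> I" "\<And>\<nu>. \<nu> \<in> E0 \<Longrightarrow> F \<nu> \<in> hweyl_algebra n"
      "\<And>\<nu> \<kappa>. \<nu> \<in> E0 \<Longrightarrow> \<kappa> \<in> keys (F \<nu>) \<Longrightarrow> hdeg \<kappa> = hdeg \<nu>"
      "\<And>\<nu>. \<nu> \<in> E0 \<Longrightarrow> is_max n \<tau> w (keys (F \<nu>)) \<nu>"
    and J: "is_left_ideal hweyl_mult (hweyl_algebra n) J"
      "\<And>\<nu>. \<nu> \<in> E0 \<Longrightarrow> restr {\<kappa>. hweyl_weight w \<kappa> = hweyl_weight w \<nu>} (F \<nu>) \<in> J"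
    and f: "f \<in> hweyl_algebra n" "\<And>\<kappa>. \<kappa> \<in> keys f \<Longrightarrow> hweyl_weight w \<kappa> \<le> \<Omega>"
  shows "\<exists>g\<in>I. restr {\<kappa>. hweyl_weight w \<kappa> = \<Omega>} g \<in> J \<and>
     keys (f - g) \<inter> {\<mu> + \<nu> | \<mu> \<nu>. \<mu> \<in> hkeys n \<and> \<nu> \<in> E0} = {}"
proof -
  define Bad where "Bad = {\<mu> + \<nu> | \<mu> \<nu>. \<mu> \<in> hkeys n \<and> \<nu> \<in> E0}"
  define N where "N = Max (insert 0 (hdeg ` keys f))"
  \<comment> \<open>The monomials up to some divisible monomial of \<open>f\<close>, in the finitely many degrees that occur: the measure
    that decreases when the largest divisible monomial is cancelled.\<close>
  define D where "D f = {\<nu> \<in> hkeys n. hdeg \<nu> \<le> N \<and> (\<exists>\<beta>\<in>keys f \<inter> Bad. \<nu> = \<beta> \<or> hless n \<tau> w \<nu> \<beta>)}" for f :: hweyl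
  have finD: "finite (D f)" for f
    using finite_hkeys_hdeg[of n N] by (rule rev_finite_subset) (auto simp: D_def)
  have fN: "hdeg \<kappa> \<le> N" if "\<kappa> \<in> keys f" for \<kappa>
    unfolding N_def by (rule Max_ge) (use that in auto)
  have "\<exists>g\<in>I. restr {\<kappa>. hweyl_weight w \<kappa> = \<Omega>} g \<in> J \<and> keys (f - g) \<inter> Bad = {}"
    using f fN
  proof (induction "card (D f)" arbitrary: f rule: less_induct)
    case less
    have fh: "keys f \<subseteq> hkeys n" using less.prems(1) by (simp add: hweyl_algebra_eq)
    show ?case
    proof (cases "keys f \<inter> Bad = {}")
      case True
      then show ?thesis using I J(1) by (intro bexI[of _ 0]) (auto simp: is_left_ideal_def)
    next
      case False
      obtain \<beta> where \<beta>: "is_max n \<tau> w (keys f \<inter> Bad) \<beta>"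
        using ex_is_max[OF \<tau>(1) _ False, of n w] fh by (meson finite_Int finite_keys le_infI1)
      then have \<beta>f: "\<beta> \<in> keys f" and "\<beta> \<in> Bad" by (auto simp: is_max_def)
      then obtain \<mu> \<nu> where \<mu>: "\<mu> \<in> hkeys n" and \<nu>: "\<nu> \<in> E0" and \<beta>eq: "\<beta> = \<mu> + \<nu>"
        by (auto simp only: Bad_def)
      \<comment> \<open>The multiple of \<open>F \<nu>\<close> that cancels the largest divisible term \<open>\<beta>\<close>.\<close>
      define c where "c = lookup f \<beta> / lookup (F \<nu>) \<nu>"
      define h where "h = Poly_Mapping.single 0 c * hm \<mu> (F \<nu>)"
      have Fnz: "lookup (F \<nu>) \<nu> \<noteq> 0" using F(4)[OF \<nu>] by (auto simp: is_max_def in_keys_iff)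
      have mx: "is_max n \<tau> w (keys (hm \<mu> (F \<nu>))) \<beta>" and lc: "lookup (hm \<mu> (F \<nu>)) \<beta> = lookup (F \<nu>) \<nu>"
        using is_max_hm[OF \<tau>(2) F(4)[OF \<nu>], of \<mu>] unfolding \<beta>eq by auto
      have kh: "keys h \<subseteq> keys (hm \<mu> (F \<nu>))" by (auto simp: h_def in_keys_iff lookup_scale)
      have hI: "h \<in> I" unfolding h_def
        using I F(1)[OF \<nu>] single_closed[OF \<mu>] by (intro left_ideal_scale) (auto simp: is_left_ideal_def)
      have hR: "h \<in> hweyl_algebra n"
        using hweyl_mult_closed[OF single_closed[OF \<mu>] F(2)[OF \<nu>]] kh by (auto simp: hweyl_algebra_eq)
      have hless_h: "\<kappa> = \<beta> \<or> hless n \<tau> w \<kappa> \<beta>" if "\<kappa> \<in> keys h" for \<kappa>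
        using mx kh that unfolding is_max_def by blast
      have wt\<beta>: "hweyl_weight w \<beta> \<le> \<Omega>" using less.prems(2) \<beta>f by blast
      have wth: "hweyl_weight w \<kappa> \<le> \<Omega>" if "\<kappa> \<in> keys h" for \<kappa>
        using hless_h[OF that] wt\<beta> by (auto simp: hless_def)
      have degh: "hdeg \<kappa> \<le> N" if \<kappa>h: "\<kappa> \<in> keys h" for \<kappa>
      proof -
        obtain \<nu>' where "\<nu>' \<in> keys (F \<nu>)" "\<kappa> \<in> keys (hweyl_basis_mult \<mu> \<nu>')"
          using keys_hm[OF subsetD[OF kh \<kappa>h]] by blast
        then have "hdeg \<kappa> = hdeg \<beta>" using keys_hweyl_basis_mult(2) F(3)[OF \<nu>] by (simp add: \<beta>eq hdeg_add)
        then show ?thesis using less.prems(3)[OF \<beta>f] by simp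
      qed
      define f' where "f' = f - h"
      have kf': "keys f' \<subseteq> keys f \<union> keys h" by (auto simp: f'_def in_keys_iff lookup_minus)
      have f'\<beta>: "\<beta> \<notin> keys f'"
        using Fnz by (simp add: f'_def in_keys_iff lookup_minus h_def lookup_scale lc c_def)
      have bad': "hless n \<tau> w \<kappa> \<beta>" if "\<kappa> \<in> keys f' \<inter> Bad" for \<kappa>
      proof -
        have "\<kappa> \<noteq> \<beta>" using that f'\<beta> by auto
        moreover have "\<kappa> \<in> keys f \<inter> Bad \<or> \<kappa> \<in> keys h" using that kf' by blast
        ultimately show ?thesis using \<beta> hless_h unfolding is_max_def by blast
      qed
      have "D f' \<subset> D f"
      proof
        show "D f' \<subseteq> D f"
        proof
          fix \<kappa> assume "\<kappa> \<in> D f'"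
          then obtain \<beta>' where \<beta>': "\<beta>' \<in> keys f' \<inter> Bad" "\<kappa> = \<beta>' \<or> hless n \<tau> w \<kappa> \<beta>'" and \<kappa>: "\<kappa> \<in> hkeys n" "hdeg \<kappa> \<le> N"
            unfolding D_def by blast
          have "hless n \<tau> w \<kappa> \<beta>" using \<beta>'(2) bad'[OF \<beta>'(1)] hless_trans by blast
          then show "\<kappa> \<in> D f" using \<kappa> \<beta>f \<open>\<beta> \<in> Bad\<close> unfolding D_def by blast
        qed
        have "\<beta> \<in> D f" using \<beta>f \<open>\<beta> \<in> Bad\<close> fh less.prems(3) unfolding D_def by blast
        moreover have "\<beta> \<notin> D f'" using bad' f'\<beta> hless_asym unfolding D_def by blast
        ultimately show "D f' \<noteq> D f" by blast
      qed
      then have "card (D f') < card (D f)" by (rule psubset_card_mono[OF finD])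
      moreover have "f' \<in> hweyl_algebra n" using kf' fh hR by (auto simp: hweyl_algebra_eq)
      moreover have "hweyl_weight w \<kappa> \<le> \<Omega>" "hdeg \<kappa> \<le> N" if "\<kappa> \<in> keys f'" for \<kappa>
        using kf' that wth degh less.prems(2,3) by blast+
      ultimately obtain g' where g': "g' \<in> I" "restr {\<kappa>. hweyl_weight w \<kappa> = \<Omega>} g' \<in> J" "keys (f' - g') \<inter> Bad = {}"
        using less.hyps by blast
      have "restr {\<kappa>. hweyl_weight w \<kappa> = \<Omega>} (hm \<mu> (F \<nu>)) = hm \<mu> (restr {\<kappa>. hweyl_weight w \<kappa> = \<Omega> - hweyl_weight w \<mu>} (F \<nu>))"
      proof (rule restr_hm)
        fix \<nu>' \<kappa> assume "\<kappa> \<in> keys (hweyl_basis_mult \<mu> \<nu>')"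
        from keys_hweyl_basis_mult(1)[OF this, of w]
        show "\<kappa> \<in> {\<kappa>. hweyl_weight w \<kappa> = \<Omega>} \<longleftrightarrow> \<nu>' \<in> {\<kappa>. hweyl_weight w \<kappa> = \<Omega> - hweyl_weight w \<mu>}"
          by auto
      qed
      also have "\<dots> \<in> J"
      proof (cases "hweyl_weight w \<beta> = \<Omega>")
        case True
        then have "\<Omega> - hweyl_weight w \<mu> = hweyl_weight w \<nu>" by (simp add: \<beta>eq hweyl_weight_add)
        then show ?thesis using J(1) J(2)[OF \<nu>] single_closed[OF \<mu>] by (simp add: is_left_ideal_def)
      next
        case False
        then have "hweyl_weight w \<nu> < \<Omega> - hweyl_weight w \<mu>" using wt\<beta> by (simp add: \<beta>eq hweyl_weight_add)
        moreover have "hweyl_weight w \<kappa> \<le> hweyl_weight w \<nu>" if "\<kappa> \<in> keys (F \<nu>)" for \<kappa>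
          using F(4)[OF \<nu>] that unfolding is_max_def hless_def by force
        ultimately have "restr {\<kappa>. hweyl_weight w \<kappa> = \<Omega> - hweyl_weight w \<mu>} (F \<nu>) = 0"
          by (intro poly_mapping_eqI) (force simp: lookup_restr in_keys_iff)
        then show ?thesis using J(1) by (simp add: is_left_ideal_def)
      qed
      finally have "restr {\<kappa>. hweyl_weight w \<kappa> = \<Omega>} h \<in> J"
        unfolding h_def restr_scale by (rule left_ideal_scale[OF J(1)])
      then have "restr {\<kappa>. hweyl_weight w \<kappa> = \<Omega>} (g' + h) \<in> J" using g'(2) J(1) by (simp add: restr_add is_left_ideal_def)
      moreover have "g' + h \<in> I" using g'(1) hI I by (simp add: is_left_ideal_def)
      moreover have "f - (g' + h) = f' - g'" by (simp add: f'_def)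
      ultimately show ?thesis using g'(3) by metis
    qed
  qed
  then show ?thesis by (simp add: Bad_def)
qed

section \<open>Local constancy of the initial ideal\<close>

definition wvec :: "hkey \<Rightarrow> nat \<Rightarrow> int" where
  "wvec \<mu> j = int (lookup (fst (snd \<mu>)) j) - int (lookup (fst \<mu>) j)"

lemma hweyl_weight_wvec: "\<mu> \<in> hkeys n \<Longrightarrow> hweyl_weight w \<mu> = (\<Sum>j<n. w j * of_int (wvec \<mu> j))"
  by (auto simp: hkeys_def hweyl_weight_def wvec_def weight_eq right_diff_distrib sum_subtractf)

lemma initial_form_max:
  assumes "\<mu> \<in> keys f" "\<And>\<nu>. \<nu> \<in> keys f \<Longrightarrow> wt \<nu> \<le> wt \<mu>"
  shows "initial_form wt f = restr {\<nu>. wt \<nu> = wt \<mu>} f"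
  unfolding initial_form_restr
  by (intro poly_mapping_eqI) (use assms in \<open>force simp: lookup_restr in_keys_iff intro: antisym\<close>)

text \<open>
  If no nonzero integer vector is orthogonal to \<open>w\<close>, the set \<open>C\<close> of differences \<open>m\<close> of weight vectors
  occurring in a finite Groebner basis, oriented by \<open>w \<bullet> m > 0\<close>, describes an open cone around \<open>w\<close>.
  For \<open>w'\<close> in this cone all comparisons inside basis elements, hence their leading monomials and initial
  forms, are the same as for \<open>w\<close>.  Division then shows that these initial forms generate the initial
  ideal for \<open>w'\<close> as well.
\<close>

theorem hweyl_initial_ideal_locally_constant:
  assumes I: "is_left_ideal hweyl_mult (hweyl_algebra n) I" "I \<subseteq> hweyl_algebra n" "homogeneous_ideal I"
    and w: "\<And>m :: nat \<Rightarrow> int. (\<Sum>j<n. w j * of_int (m j)) = 0 \<Longrightarrow> \<forall>j<n. m j = 0"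
  shows "\<exists>C. finite C \<and> (\<forall>m\<in>C. (\<Sum>j<n. w j * of_int (m j :: int)) > 0) \<and>
    (\<forall>w' :: nat \<Rightarrow> real. (\<forall>m\<in>C. (\<Sum>j<n. w' j * of_int (m j)) > 0) \<longrightarrow> hweyl_initial_ideal n w' I = hweyl_initial_ideal n w I)"
proof -
  obtain \<tau> where \<tau>: "\<tau> > 0" "int_independent_powers \<tau>" using ex_int_independent_powers by blast
  define E where "E = {\<mu>. \<exists>f\<in>I. is_max n \<tau> w (keys f) \<mu>}"
  \<comment> \<open>Absolute values, because the coordinate of \<open>h\<close> is a negated exponent.\<close>
  obtain E0 where E0: "E0 \<subseteq> E" "finite E0"
    and E0': "\<forall>\<mu>\<in>E. \<exists>\<nu>\<in>E0. \<forall>i\<in>{..<2*n+1}. nat \<bar>hkey_coord \<nu> i\<bar> \<le> nat \<bar>hkey_coord \<mu> i\<bar>"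
    using dickson[of "{..<2*n+1}" E "\<lambda>\<mu> i. nat \<bar>hkey_coord \<mu> i\<bar>"] by auto
  have Ehk: "\<mu> \<in> hkeys n" if "\<mu> \<in> E" for \<mu>
    using that I(2) unfolding E_def is_max_def hweyl_algebra_eq by blast
  have bad: "\<exists>\<kappa> \<nu>. \<mu> = \<kappa> + \<nu> \<and> \<kappa> \<in> hkeys n \<and> \<nu> \<in> E0" if \<mu>E: "\<mu> \<in> E" for \<mu>
  proof -
    obtain \<nu> where \<nu>: "\<nu> \<in> E0" "\<forall>i\<in>{..<2*n+1}. nat \<bar>hkey_coord \<nu> i\<bar> \<le> nat \<bar>hkey_coord \<mu> i\<bar>" using E0' \<mu>E by blast
    obtain a b c where \<mu>: "\<mu> = (a, b, c)" by (cases \<mu>) auto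
    obtain a' b' c' where \<nu>': "\<nu> = (a', b', c')" by (cases \<nu>) auto
    have hk: "a \<in> exps_of n" "b \<in> exps_of n" "a' \<in> exps_of n" "b' \<in> exps_of n"
      using Ehk[OF \<mu>E] Ehk[OF subsetD[OF E0(1) \<nu>(1)]] by (auto simp: \<mu> \<nu>' hkeys_def)
    have c: "c' \<le> c" using \<nu>(2)[rule_format, of 0] by (simp add: \<mu> \<nu>' hkey_coord_def)
    have a: "lookup a' j \<le> lookup a j" for j
      using \<nu>(2)[rule_format, of "2*j+1"] hk by (cases "j < n") (auto simp: \<mu> \<nu>' hkey_coord_def exps_of_lookup not_less)
    have b: "lookup b' j \<le> lookup b j" for j
      using \<nu>(2)[rule_format, of "2*j+2"] hk by (cases "j < n") (auto simp: \<mu> \<nu>' hkey_coord_def exps_of_lookup not_less)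
    have "\<mu> = (a - a', b - b', c - c') + \<nu>"
      using a b c by (auto simp: \<mu> \<nu>' lookup_add lookup_minus intro!: exps_eqI)
    moreover have "(a - a', b - b', c - c') \<in> hkeys n" using hk by (auto simp: hkeys_def)
    ultimately show ?thesis using \<nu>(1) by blast
  qed
  \<comment> \<open>Passing to a homogeneous component keeps the leading monomial.\<close>
  have "\<exists>f. \<nu> \<in> E0 \<longrightarrow> f \<in> I \<and> (\<forall>\<kappa>\<in>keys f. hdeg \<kappa> = hdeg \<nu>) \<and> is_max n \<tau> w (keys f) \<nu>" for \<nu>
  proof (cases "\<nu> \<in> E0")
    case True
    then obtain f where f: "f \<in> I" "is_max n \<tau> w (keys f) \<nu>" using E0(1) by (auto simp only: E_def)
    have "restr {\<mu>. hdeg \<mu> = hdeg \<nu>} f \<in> I" using I(3) f(1) by (simp add: homogeneous_ideal_def)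
    moreover have "is_max n \<tau> w (keys (restr {\<mu>. hdeg \<mu> = hdeg \<nu>} f)) \<nu>"
      using f(2) by (auto simp: is_max_def keys_restr)
    ultimately show ?thesis by (intro exI[of _ "restr {\<mu>. hdeg \<mu> = hdeg \<nu>} f"]) (auto simp: keys_restr)
  qed auto
  then obtain F where F: "\<And>\<nu>. \<nu> \<in> E0 \<Longrightarrow> F \<nu> \<in> I \<and> (\<forall>\<kappa>\<in>keys (F \<nu>). hdeg \<kappa> = hdeg \<nu>) \<and> is_max n \<tau> w (keys (F \<nu>)) \<nu>"
    by metis
  \<comment> \<open>All comparisons of weights inside the basis elements, oriented by \<open>w\<close>.\<close>
  define C where "C = {m \<in> (\<lambda>(\<nu>, \<mu>, \<kappa>) j. wvec \<mu> j - wvec \<kappa> j) ` (SIGMA \<nu>:E0. keys (F \<nu>) \<times> keys (F \<nu>)).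
     (\<Sum>j<n. w j * of_int (m j :: int)) > 0}"
  have "finite C" unfolding C_def using E0(2) by auto
  have Fk: "\<mu> \<in> hkeys n" if "\<nu> \<in> E0" "\<mu> \<in> keys (F \<nu>)" for \<mu> \<nu>
    using F[OF that(1)] that(2) I(2) unfolding hweyl_algebra_eq by blast
  define J where "J = left_ideal_gen hweyl_mult (hweyl_algebra n)
     ((\<lambda>\<nu>. restr {\<kappa>. hweyl_weight w \<kappa> = hweyl_weight w \<nu>} (F \<nu>)) ` E0)"
  have Jid: "is_left_ideal hweyl_mult (hweyl_algebra n) J" unfolding J_def by (rule is_left_ideal_hweyl)
  have main: "hweyl_initial_ideal n w' I = J" if w': "\<forall>m\<in>C. (\<Sum>j<n. w' j * of_int (m j)) > 0" for w' :: "nat \<Rightarrow> real"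
  proof -
    have diff: "hweyl_weight u \<mu> - hweyl_weight u \<kappa> = (\<Sum>j<n. u j * of_int (wvec \<mu> j - wvec \<kappa> j))"
      if "\<nu> \<in> E0" "\<mu> \<in> keys (F \<nu>)" "\<kappa> \<in> keys (F \<nu>)" for \<mu> \<kappa> \<nu> u
      using Fk[OF that(1,2)] Fk[OF that(1,3)]
      by (simp add: hweyl_weight_wvec right_diff_distrib sum_subtractf)
    have less: "hweyl_weight w' \<kappa> < hweyl_weight w' \<mu>"
      if "\<nu> \<in> E0" "\<mu> \<in> keys (F \<nu>)" "\<kappa> \<in> keys (F \<nu>)" "hweyl_weight w \<kappa> < hweyl_weight w \<mu>" for \<mu> \<kappa> \<nu>
    proof -
      have "(\<lambda>j. wvec \<mu> j - wvec \<kappa> j) \<in> (\<lambda>(\<nu>, \<mu>, \<kappa>) j. wvec \<mu> j - wvec \<kappa> j) ` (SIGMA \<nu>:E0. keys (F \<nu>) \<times> keys (F \<nu>))"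
        by (rule image_eqI[of _ _ "(\<nu>, \<mu>, \<kappa>)"]) (use that in auto)
      moreover have "(\<Sum>j<n. w j * of_int (wvec \<mu> j - wvec \<kappa> j)) > 0"
        using diff[OF that(1-3), of w] that(4) by simp
      ultimately have "(\<lambda>j. wvec \<mu> j - wvec \<kappa> j) \<in> C" unfolding C_def by simp
      then show ?thesis using w' diff[OF that(1-3), of w'] by auto
    qed
    have eq: "hweyl_weight w' \<kappa> = hweyl_weight w' \<mu>"
      if "\<nu> \<in> E0" "\<mu> \<in> keys (F \<nu>)" "\<kappa> \<in> keys (F \<nu>)" "hweyl_weight w \<kappa> = hweyl_weight w \<mu>" for \<mu> \<kappa> \<nu>
    proof -
      have "\<forall>j<n. wvec \<mu> j - wvec \<kappa> j = 0"
        by (rule w) (use diff[OF that(1-3), of w] that(4) in simp)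
      then show ?thesis using diff[OF that(1-3), of w'] by simp
    qed
    have hl: "hless n \<tau> w' \<kappa> \<mu>" if "\<nu> \<in> E0" "\<mu> \<in> keys (F \<nu>)" "\<kappa> \<in> keys (F \<nu>)" "hless n \<tau> w \<kappa> \<mu>" for \<mu> \<kappa> \<nu>
      using that(4) less[OF that(1-3)] eq[OF that(1-3)] unfolding hless_def by blast
    have mx: "is_max n \<tau> w' (keys (F \<nu>)) \<nu>" if "\<nu> \<in> E0" for \<nu>
      using F[OF that] hl[OF that] unfolding is_max_def by blast
    have same: "restr {\<kappa>. hweyl_weight w' \<kappa> = hweyl_weight w' \<nu>} (F \<nu>) = restr {\<kappa>. hweyl_weight w \<kappa> = hweyl_weight w \<nu>} (F \<nu>)"
      if \<nu>: "\<nu> \<in> E0" for \<nu>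
    proof (intro poly_mapping_eqI)
      fix \<kappa>
      have \<nu>k: "\<nu> \<in> keys (F \<nu>)" using F[OF \<nu>] by (simp add: is_max_def)
      show "lookup (restr {\<kappa>. hweyl_weight w' \<kappa> = hweyl_weight w' \<nu>} (F \<nu>)) \<kappa>
        = lookup (restr {\<kappa>. hweyl_weight w \<kappa> = hweyl_weight w \<nu>} (F \<nu>)) \<kappa>"
      proof (cases "\<kappa> \<in> keys (F \<nu>)")
        case True
        have "hweyl_weight w' \<kappa> = hweyl_weight w' \<nu> \<longleftrightarrow> hweyl_weight w \<kappa> = hweyl_weight w \<nu>"
          using less[OF \<nu> True \<nu>k] less[OF \<nu> \<nu>k True] eq[OF \<nu> \<nu>k True] by linarith
        then show ?thesis by (simp add: lookup_restr)
      qed (simp add: lookup_restr in_keys_iff)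
    qed
    have ini: "initial_form (hweyl_weight w') (F \<nu>) = restr {\<kappa>. hweyl_weight w \<kappa> = hweyl_weight w \<nu>} (F \<nu>)"
      if \<nu>: "\<nu> \<in> E0" for \<nu>
      unfolding same[OF \<nu>, symmetric]
      by (rule initial_form_max) (use mx[OF \<nu>] in \<open>force simp: is_max_def hless_def\<close>)+
    show ?thesis
    proof (rule antisym)
      show "J \<subseteq> hweyl_initial_ideal n w' I"
        unfolding J_def hweyl_initial_ideal_def
      proof (rule left_ideal_gen_mono, rule image_subsetI)
        fix \<nu> assume "\<nu> \<in> E0"
        from ini[OF this] F[OF this] show "restr {\<kappa>. hweyl_weight w \<kappa> = hweyl_weight w \<nu>} (F \<nu>) \<in> initial_form (hweyl_weight w') ` I"
          by (metis imageI)
      qed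
      show "hweyl_initial_ideal n w' I \<subseteq> J"
        unfolding hweyl_initial_ideal_def
      proof (rule left_ideal_gen_subset[OF Jid], rule image_subsetI)
        fix f assume fI: "f \<in> I"
        show "initial_form (hweyl_weight w') f \<in> J"
        proof (cases "f = 0")
          case True
          then show ?thesis using Jid by (simp add: initial_form_restr is_left_ideal_def)
        next
          case False
          then have ne: "keys f \<noteq> {}" by (simp add: keys_eq_empty)
          define \<Omega> where "\<Omega> = Max (hweyl_weight w' ` keys f)"
          have "\<Omega> \<in> hweyl_weight w' ` keys f" unfolding \<Omega>_def by (rule Max_in) (use ne in auto)
          then obtain \<mu>0 where \<mu>0: "\<mu>0 \<in> keys f" "\<Omega> = hweyl_weight w' \<mu>0" by blast
          have le: "hweyl_weight w' \<kappa> \<le> \<Omega>" if "\<kappa> \<in> keys f" for \<kappa> unfolding \<Omega>_def using that by simp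
          obtain g where g: "g \<in> I" "restr {\<kappa>. hweyl_weight w' \<kappa> = \<Omega>} g \<in> J"
            "keys (f - g) \<inter> {\<mu> + \<nu> | \<mu> \<nu>. \<mu> \<in> hkeys n \<and> \<nu> \<in> E0} = {}"
          proof -
            have "restr {\<kappa>. hweyl_weight w' \<kappa> = hweyl_weight w' \<nu>} (F \<nu>) \<in> J" if "\<nu> \<in> E0" for \<nu>
              unfolding same[OF that] J_def by (rule hweyl_gen_incl, rule imageI, rule that)
            then have "\<exists>g\<in>I. restr {\<kappa>. hweyl_weight w' \<kappa> = \<Omega>} g \<in> J \<and>
              keys (f - g) \<inter> {\<mu> + \<nu> | \<mu> \<nu>. \<mu> \<in> hkeys n \<and> \<nu> \<in> E0} = {}"
              using F I(2) fI by (intro groebner_division[OF I(1) \<tau>(2,1) _ _ _ mx Jid _ _ le]) blast+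
            then show ?thesis using that by blast
          qed
          have rI: "f - g \<in> I" by (rule left_ideal_diff[OF I(1) fI g(1)])
          \<comment> \<open>A remainder in \<open>I\<close> would have a leading monomial divisible by an element of \<open>E0\<close>.\<close>
          have "f - g = 0"
          proof (rule ccontr)
            assume "f - g \<noteq> 0"
            then have "keys (f - g) \<noteq> {}" by (simp add: keys_eq_empty)
            moreover have "keys (f - g) \<subseteq> hkeys n" using rI I(2) by (auto simp: hweyl_algebra_eq)
            ultimately obtain \<mu> where \<mu>: "is_max n \<tau> w (keys (f - g)) \<mu>"
              using ex_is_max[OF \<tau>(2), of "keys (f - g)" n w] by auto
            then have "\<mu> \<in> E" using rI by (auto simp only: E_def)
            from bad[OF this] have "\<mu> \<in> {\<mu> + \<nu> | \<mu> \<nu>. \<mu> \<in> hkeys n \<and> \<nu> \<in> E0}" by blast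
            then show False using g(3) \<mu> unfolding is_max_def by blast
          qed
          then have "f = g" by simp
          moreover have "initial_form (hweyl_weight w') f = restr {\<kappa>. hweyl_weight w' \<kappa> = \<Omega>} f"
            unfolding \<mu>0(2) by (rule initial_form_max) (use \<mu>0 le in auto)
          ultimately show ?thesis using g(2) by simp
        qed
      qed
    qed
  qed
  have wC: "\<forall>m\<in>C. (\<Sum>j<n. w j * of_int (m j)) > 0" by (simp add: C_def)
  show ?thesis
  proof (intro exI[of _ C] conjI allI impI)
    fix w' :: "nat \<Rightarrow> real" assume "\<forall>m\<in>C. (\<Sum>j<n. w' j * of_int (m j)) > 0"
    then show "hweyl_initial_ideal n w' I = hweyl_initial_ideal n w I" using main wC by metis
  qed (use \<open>finite C\<close> wC in auto)
qed

section \<open>Interior points of Groebner cones\<close>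

lemma homogenized_ideal_closed:
  assumes "H \<subseteq> weyl_algebra n" shows "homogenized_ideal n H \<subseteq> hweyl_algebra n"
proof
  fix f assume "f \<in> homogenized_ideal n H"
  then show "f \<in> hweyl_algebra n" unfolding homogenized_ideal_def
  proof (induction rule: left_ideal_gen_induct)
    case (add f g)
    then show ?case using keys_add[of f g] by (auto simp: hweyl_algebra_eq)
  next
    case (mult a s)
    then show ?case using assms homogenize_closed by (blast intro: hweyl_mult_closed)
  qed (simp add: hweyl_algebra_eq)
qed

text \<open>
  The finitely many strict inequalities around \<open>w\<close> cut out an open set inside its equivalence class.
\<close>

theorem independent_weight_in_interior:
  assumes H: "H \<subseteq> weyl_algebra n" and wt: "w \<in> topspace (Euclidean_space n)"
    and w: "\<And>m :: nat \<Rightarrow> int. (\<Sum>j<n. w j * of_int (m j)) = 0 \<Longrightarrow> \<forall>j<n. m j = 0"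
  shows "\<exists>C \<in> small_groebner_fan n H. w \<in> Euclidean_space n interior_of C"
proof
  let ?I = "homogenized_ideal n H" and ?E = "Euclidean_space n"
  have "is_left_ideal hweyl_mult (hweyl_algebra n) ?I" unfolding homogenized_ideal_def by (rule is_left_ideal_hweyl)
  from hweyl_initial_ideal_locally_constant[OF this homogenized_ideal_closed[OF H] homogeneous_homogenized_ideal w]
  obtain C where C': "finite C \<and> (\<forall>m\<in>C. (\<Sum>j<n. w j * of_int (m j :: int)) > 0) \<and>
    (\<forall>w' :: nat \<Rightarrow> real. (\<forall>m\<in>C. (\<Sum>j<n. w' j * of_int (m j)) > 0) \<longrightarrow>
       hweyl_initial_ideal n w' ?I = hweyl_initial_ideal n w ?I)" ..
  note C = conjunct1[OF C'] conjunct1[OF conjunct2[OF C']] conjunct2[OF conjunct2[OF C'], rule_format]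
  define T where "T = {w' \<in> topspace ?E. \<forall>m\<in>C. (\<Sum>j<n. w' j * of_int (m j :: int)) > 0}"
  have proj: "continuous_map ?E euclideanreal (\<lambda>x. x j)" for j
    unfolding Euclidean_space_def by (intro continuous_map_from_subtopology continuous_map_product_projection) simp
  have "openin ?E {w' \<in> topspace ?E. (\<Sum>j<n. w' j * of_int (m j :: int)) \<in> {0<..}}" for m
    by (rule openin_continuous_map_preimage[of _ euclideanreal])
       (auto intro!: continuous_map_sum continuous_map_real_mult_right proj)
  then have half: "openin ?E {w' \<in> topspace ?E. (\<Sum>j<n. w' j * of_int (m j :: int)) > 0}" for m by simp
  have "openin ?E {w' \<in> topspace ?E. \<forall>m\<in>D. (\<Sum>j<n. w' j * of_int (m j :: int)) > 0}" if "finite D" for D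
    using that
  proof (induction D)
    case (insert m D)
    have "{w' \<in> topspace ?E. \<forall>m\<in>insert m D. (\<Sum>j<n. w' j * of_int (m j :: int)) > 0}
      = {w' \<in> topspace ?E. (\<Sum>j<n. w' j * of_int (m j :: int)) > 0}
        \<inter> {w' \<in> topspace ?E. \<forall>m\<in>D. (\<Sum>j<n. w' j * of_int (m j :: int)) > 0}" by blast
    then show ?case using openin_Int[OF half insert.IH] by simp
  qed simp
  then have "openin ?E T" unfolding T_def using C(1) .
  moreover have "T \<subseteq> small_groebner_cone n H w"
  proof -
    let ?K = "{w' \<in> topspace ?E. hweyl_initial_ideal n w' ?I = hweyl_initial_ideal n w ?I}"
    have "T \<subseteq> ?K" using C(3) by (auto simp: T_def)
    also have "?K \<subseteq> ?E closure_of ?K" by (rule closure_of_subset) auto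
    finally show ?thesis by (simp add: small_groebner_cone_def)
  qed
  moreover have "w \<in> T" using wt C(2) by (simp add: T_def)
  ultimately show "w \<in> ?E interior_of (small_groebner_cone n H w)" by (auto simp: interior_of_def)
  show "small_groebner_cone n H w \<in> small_groebner_fan n H"
    unfolding small_groebner_fan_def using wt by (rule imageI)
qed

section \<open>The rational normal scroll\<close>

text \<open>
  As a rewrite rule, this would turn the exponent \<open>var_exp 0\<close> into the unit of a ring.
\<close>

declare single_one [simp del]

lemma sum_less5: "(\<Sum>j<5. f j) = f 0 + f 1 + f 2 + f 3 + (f (4::nat) :: 'a::comm_monoid_add)"
  by (simp add: numeral_eq_Suc ac_simps)
lemma sum_less3: "(\<Sum>j<3. f j) = f 0 + f 1 + (f (2::nat) :: 'a::comm_monoid_add)"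
  by (simp add: numeral_eq_Suc ac_simps)
lemma sum_less2: "(\<Sum>j<2. f j) = f 0 + (f (1::nat) :: 'a::comm_monoid_add)"
  by (simp add: numeral_eq_Suc ac_simps)
lemma all_less5: "(\<forall>j<5. P j) \<longleftrightarrow> P 0 \<and> P 1 \<and> P 2 \<and> P 3 \<and> P (4::nat)"
  by (auto simp: numeral_eq_Suc All_less_Suc)
lemma all_less3: "(\<forall>j<3. P j) \<longleftrightarrow> P 0 \<and> P 1 \<and> P (2::nat)"
  by (auto simp: numeral_eq_Suc All_less_Suc)
lemma less5_cases: "j < 5 \<Longrightarrow> j = 0 \<or> j = 1 \<or> j = 2 \<or> j = 3 \<or> j = (4::nat)" by auto

definition list_vec :: "'a::zero list \<Rightarrow> nat \<Rightarrow> 'a" where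
  "list_vec xs j = (if j < length xs then xs ! j else 0)"

lemma list_vec5 [simp]:
  "list_vec [a,b,c,d,e] 0 = a" "list_vec [a,b,c,d,e] 1 = b" "list_vec [a,b,c,d,e] (Suc 0) = b"
  "list_vec [a,b,c,d,e] 2 = c" "list_vec [a,b,c,d,e] 3 = d" "list_vec [a,b,c,d,e] 4 = e"
  "j \<ge> 5 \<Longrightarrow> list_vec [a,b,c,d,e] j = 0"
  by (simp_all add: list_vec_def)

lemma list_vec5_vectors [simp]: "list_vec [a,b,c,d,e] \<in> vectors 5"
  by (simp add: vectors_def)

lemma vectors5_eqI:
  assumes "u \<in> vectors 5" "u' \<in> vectors 5" "\<forall>j<5. u j = u' j" shows "u = u'"
proof
  fix j show "u j = u' j" using assms by (cases "j < 5") (auto simp: vectors_def)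
qed

text \<open>
  The columns are the exponents of \<open>s, s x, s x\<^sup>2, s y, s x y\<close>: the lattice points of a trapezoid, which
  parametrize the rational normal scroll \<open>S(2,1)\<close>.
\<close>

definition scroll_matrix :: "nat \<Rightarrow> nat \<Rightarrow> int" where
  "scroll_matrix i = list_vec ([[1,1,1,1,1], [0,1,2,0,1], [0,0,0,1,1]] ! i)"

lemma scroll_matrix_rows [simp]:
  "scroll_matrix 0 = list_vec [1,1,1,1,1]" "scroll_matrix 1 = list_vec [0,1,2,0,1]"
  "scroll_matrix (Suc 0) = list_vec [0,1,2,0,1]" "scroll_matrix 2 = list_vec [0,0,0,1,1]"
  by (simp_all add: scroll_matrix_def)

text \<open>
  Relations are determined by their entries at the positions \<open>0\<close> and \<open>2\<close>, which become coordinates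
  \<open>(a, b)\<close> on the lattice.
\<close>

definition rel_vec :: "int \<Rightarrow> int \<Rightarrow> nat \<Rightarrow> int" where
  "rel_vec a b = list_vec [a, - a - b, b, b - a, a - b]"

lemma rel_vec_simps [simp]:
  "rel_vec a b 0 = a" "rel_vec a b 1 = - a - b" "rel_vec a b (Suc 0) = - a - b" "rel_vec a b 2 = b" "rel_vec a b 3 = b - a"
  "rel_vec a b 4 = a - b" "rel_vec a b \<in> vectors 5"
  by (simp_all add: rel_vec_def)

abbreviation scroll_lattice :: "(nat \<Rightarrow> int) set" where
  "scroll_lattice \<equiv> relation_lattice 3 5 scroll_matrix"

lemma scroll_lattice_iff: "u \<in> scroll_lattice \<longleftrightarrow> (\<exists>a b. u = rel_vec a b)"
proof
  assume "u \<in> scroll_lattice"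
  then have u: "u \<in> vectors 5" "u 0 + u 1 + u 2 + u 3 + u 4 = 0" "u 1 + 2 * u 2 + u 4 = 0" "u 3 + u 4 = 0"
    by (auto simp: relation_lattice_def all_less3 sum_less5)
  then have "u = rel_vec (u 0) (u 2)"
    by (intro vectors5_eqI) (auto simp: all_less5)
  then show "\<exists>a b. u = rel_vec a b" by blast
next
  assume "\<exists>a b. u = rel_vec a b"
  then show "u \<in> scroll_lattice" by (auto simp: relation_lattice_def all_less3 sum_less5)
qed

lemma rel_vec_0 [simp]: "rel_vec 0 0 j = 0"
  by (cases "j < 5") (auto dest!: less5_cases simp: rel_vec_def)

lemma rel_vec_inj: "rel_vec a b = rel_vec c d \<longleftrightarrow> a = c \<and> b = d"
  by (metis rel_vec_simps(1,4))

lemma rel_vec_arith: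
  "(\<lambda>j. rel_vec a b j + rel_vec c d j) = rel_vec (a + c) (b + d)" "(\<lambda>j. - rel_vec a b j) = rel_vec (- a) (- b)"
  by (rule vectors5_eqI; simp add: all_less5 vectors_def rel_vec_def)+

lemma pos_part_lookup: "u \<in> vectors n \<Longrightarrow> lookup (pos_part u) j = nat (u j)"
  and neg_part_lookup: "u \<in> vectors n \<Longrightarrow> lookup (neg_part u) j = nat (- u j)"
proof -
  assume u: "u \<in> vectors n"
  have "{j. nat (u j) \<noteq> 0} \<subseteq> {..<n}" "{j. nat (- u j) \<noteq> 0} \<subseteq> {..<n}"
    using u by (auto simp: vectors_def intro: not_le_imp_less)
  then have "finite {j. nat (u j) \<noteq> 0}" "finite {j. nat (- u j) \<noteq> 0}"
    by (auto intro: finite_subset)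
  then show "lookup (pos_part u) j = nat (u j)" "lookup (neg_part u) j = nat (- u j)"
    by (simp_all add: pos_part_def neg_part_def)
qed

lemma exps_of_5_eqI:
  assumes "a \<in> exps_of 5" "b \<in> exps_of 5" "\<forall>j<5. lookup a j = lookup b j" shows "a = b"
  by (rule exps_eqI) (use assms in \<open>metis exps_of_lookup not_le\<close>)

lemma var_exp_exps_of [simp]: "j < n \<Longrightarrow> var_exp j \<in> exps_of n" "j < n \<Longrightarrow> Poly_Mapping.single j (Suc 0) \<in> exps_of n"
  by (simp_all add: exps_of_def)

lemma lookup_var_exp: "lookup (var_exp i) j = (if i = j then 1 else 0)"
  by (simp add: lookup_single when_def)

text \<open>
  The scroll is cut out by the \<open>2 \<times> 2\<close> minors of the matrix with rows \<open>\<partial>\<^sub>0, \<partial>\<^sub>1, \<partial>\<^sub>3\<close> and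
  \<open>\<partial>\<^sub>1, \<partial>\<^sub>2, \<partial>\<^sub>4\<close>, namely \<open>\<partial>\<^sub>0\<partial>\<^sub>2 - \<partial>\<^sub>1\<^sup>2\<close>, \<open>\<partial>\<^sub>0\<partial>\<^sub>4 - \<partial>\<^sub>1\<partial>\<^sub>3\<close> and \<open>\<partial>\<^sub>2\<partial>\<^sub>3 - \<partial>\<^sub>1\<partial>\<^sub>4\<close> (up to sign).
\<close>

definition lead_exp :: "nat \<Rightarrow> exps" where
  "lead_exp i = [var_exp 0 + var_exp 2, var_exp 0 + var_exp 4, var_exp 2 + var_exp 3] ! i"
definition trail_exp :: "nat \<Rightarrow> exps" where
  "trail_exp i = [var_exp 1 + var_exp 1, var_exp 1 + var_exp 3, var_exp 1 + var_exp 4] ! i"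
definition scroll_vec :: "nat \<Rightarrow> nat \<Rightarrow> int" where
  "scroll_vec i = [rel_vec 1 1, rel_vec 1 0, rel_vec 0 1] ! i"

lemmas lead_trail_simps = lead_exp_def trail_exp_def

lemma less3_cases: "i < 3 \<Longrightarrow> i = 0 \<or> i = 1 \<or> i = (2::nat)" by auto

lemma lead_trail_exps_of: "i < 3 \<Longrightarrow> lead_exp i \<in> exps_of 5" "i < 3 \<Longrightarrow> trail_exp i \<in> exps_of 5"
  by (auto dest!: less3_cases simp: lead_trail_simps intro!: exps_of_add simp del: One_nat_def)

lemma lookup_lead_trail:
  "lookup (lead_exp 0) j = (if j = 0 then 1 else 0) + (if j = 2 then 1 else 0)"
  "lookup (lead_exp 1) j = (if j = 0 then 1 else 0) + (if j = 4 then 1 else 0)"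
  "lookup (lead_exp 2) j = (if j = 2 then 1 else 0) + (if j = 3 then 1 else 0)"
  "lookup (trail_exp 0) j = (if j = 1 then 2 else 0)"
  "lookup (trail_exp 1) j = (if j = 1 then 1 else 0) + (if j = 3 then 1 else 0)"
  "lookup (trail_exp 2) j = (if j = 1 then 1 else 0) + (if j = 4 then 1 else 0)"
  by (auto simp: lead_trail_simps lookup_add lookup_single when_def)

lemma scroll_vec_parts:
  assumes "i < 3" shows "pos_part (scroll_vec i) = lead_exp i" "neg_part (scroll_vec i) = trail_exp i"
proof -
  have v: "scroll_vec i \<in> vectors 5" using assms by (auto dest!: less3_cases simp: scroll_vec_def)
  have pn: "pos_part (scroll_vec i) \<in> exps_of 5" "neg_part (scroll_vec i) \<in> exps_of 5"
    using v by (auto simp: exps_of_lookup pos_part_lookup[OF v] neg_part_lookup[OF v]) (auto simp: vectors_def)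
  show "pos_part (scroll_vec i) = lead_exp i"
    by (rule exps_of_5_eqI[OF pn(1) lead_trail_exps_of(1)[OF assms]])
       (use assms in \<open>auto dest!: less3_cases simp: all_less5 pos_part_lookup[OF v] lookup_lead_trail lookup_lead_trail(2)[simplified] lookup_lead_trail(5)[simplified] simp flip: One_nat_def, (simp add: scroll_vec_def)+\<close>)
  show "neg_part (scroll_vec i) = trail_exp i"
    by (rule exps_of_5_eqI[OF pn(2) lead_trail_exps_of(2)[OF assms]])
       (use assms in \<open>auto dest!: less3_cases simp: all_less5 neg_part_lookup[OF v] lookup_lead_trail simp flip: One_nat_def, (simp add: scroll_vec_def)+\<close>)
qed

text \<open>
  Congruence modulo the lattice: the fibres of the map from monomials to degrees in \<open>\<int>\<^sup>3\<close>.
\<close>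

definition lattice_equiv :: "exps \<Rightarrow> exps \<Rightarrow> bool" where
  "lattice_equiv m m' \<longleftrightarrow> (\<lambda>j. int (lookup m j) - int (lookup m' j)) \<in> scroll_lattice"

lemma lattice_equivE:
  assumes "lattice_equiv m m'"
  obtains a b where "\<And>j. int (lookup m j) = int (lookup m' j) + rel_vec a b j"
proof -
  obtain a b where "(\<lambda>j. int (lookup m j) - int (lookup m' j)) = rel_vec a b"
    using assms unfolding lattice_equiv_def scroll_lattice_iff by blast
  then have "int (lookup m j) = int (lookup m' j) + rel_vec a b j" for j by (simp add: fun_eq_iff algebra_simps)
  then show thesis by (rule that)
qed

lemma lattice_equivI: "(\<And>j. int (lookup m j) = int (lookup m' j) + rel_vec a b j) \<Longrightarrow> lattice_equiv m m'"
  unfolding lattice_equiv_def scroll_lattice_iff by (intro exI[of _ a] exI[of _ b]) auto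

lemma lattice_equiv_sym: "lattice_equiv m m' \<Longrightarrow> lattice_equiv m' m"
proof (elim lattice_equivE)
  fix a b assume "\<And>j. int (lookup m j) = int (lookup m' j) + rel_vec a b j"
  then have "int (lookup m' j) = int (lookup m j) + rel_vec (-a) (-b) j" for j
    using rel_vec_arith(2)[of a b] by (metis add.right_inverse add.right_neutral add.assoc)
  then show ?thesis by (rule lattice_equivI)
qed

lemma lattice_equiv_trans: "lattice_equiv m m' \<Longrightarrow> lattice_equiv m' m'' \<Longrightarrow> lattice_equiv m m''"
proof (elim lattice_equivE)
  fix a b c d assume "\<And>j. int (lookup m j) = int (lookup m' j) + rel_vec a b j"
    "\<And>j. int (lookup m' j) = int (lookup m'' j) + rel_vec c d j"
  then have "int (lookup m j) = int (lookup m'' j) + rel_vec (c+a) (d+b) j" for j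
    by (simp flip: rel_vec_arith(1))
  then show ?thesis by (rule lattice_equivI)
qed

lemma lattice_equiv_lead_trail: "i < 3 \<Longrightarrow> lattice_equiv (k + lead_exp i) (k + trail_exp i)"
proof -
  assume i: "i < 3"
  have v: "scroll_vec i \<in> vectors 5" using i by (auto dest!: less3_cases simp: scroll_vec_def)
  have "\<exists>a b. scroll_vec i = rel_vec a b" using less3_cases[OF i] by (elim disjE) (simp add: scroll_vec_def, blast)+
  then obtain a b where ab: "scroll_vec i = rel_vec a b" by blast
  have "int (lookup (lead_exp i) j) = int (lookup (trail_exp i) j) + rel_vec a b j" for j
    unfolding scroll_vec_parts[OF i, symmetric] ab pos_part_lookup[OF v[unfolded ab]] neg_part_lookup[OF v[unfolded ab]] by simp
  then show ?thesis by (intro lattice_equivI[of _ _ a b]) (simp add: lookup_add)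
qed

text \<open>
  Moving along \<open>rel_vec a b\<close> with \<open>a > 0\<close> or \<open>b > 0\<close> forces positive exponents at two positions that
  form a leading monomial; which one depends on the signs of \<open>a\<close> and \<open>b\<close>.
\<close>

lemma divisible_by_lead:
  assumes "\<And>j. int (lookup m j) = int (lookup m' j) + rel_vec a b j" "a > 0 \<or> b > 0"
  shows "\<exists>i<3. \<exists>k. m = k + lead_exp i"
proof -
  have *: "\<exists>k. m = k + var_exp p + var_exp q" if "lookup m p \<ge> 1" "lookup m q \<ge> 1" "p \<noteq> q" for p q
    by (rule exI[of _ "m - var_exp p - var_exp q"], rule exps_eqI)
       (use that in \<open>auto simp: lookup_add lookup_minus lookup_single when_def\<close>)
  have m: "int (lookup m 0) \<ge> a" "int (lookup m 2) \<ge> b" "int (lookup m 3) \<ge> b - a" "int (lookup m 4) \<ge> a - b"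
    using assms(1)[of 0] assms(1)[of 2] assms(1)[of 3] assms(1)[of 4] by simp_all
  consider "a > 0" "b > 0" | "a > 0" "b \<le> 0" | "a \<le> 0" "b > 0" using assms(2) by linarith
  then show ?thesis
  proof cases
    case 1
    then show ?thesis using *[of 0 2] m by (intro exI[of _ 0]) (auto simp: lead_exp_def add.assoc)
  next
    case 2
    then show ?thesis using *[of 0 4] m by (intro exI[of _ 1]) (auto simp: lead_exp_def add.assoc)
  next
    case 3
    then show ?thesis using *[of 2 3] m by (intro exI[of _ 2]) (auto simp: lead_exp_def add.assoc)
  qed
qed

abbreviation toric :: "complex mpoly set" where "toric \<equiv> toric_ideal 3 5 scroll_matrix"

definition scroll_binomial :: "nat \<Rightarrow> complex mpoly" where
  "scroll_binomial i = Poly_Mapping.single (lead_exp i) 1 - Poly_Mapping.single (trail_exp i) 1"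

definition scroll_ideal :: "complex mpoly set" where
  "scroll_ideal = ideal_gen (polys 5) (scroll_binomial ` {..<3})"

lemma polys_closed:
  "P \<in> polys n \<Longrightarrow> Q \<in> polys n \<Longrightarrow> P * Q \<in> (polys n :: 'a::comm_ring_1 mpoly set)"
  "P \<in> polys n \<Longrightarrow> Q \<in> polys n \<Longrightarrow> P + Q \<in> (polys n :: 'a::comm_ring_1 mpoly set)"
  "P \<in> polys n \<Longrightarrow> Q \<in> polys n \<Longrightarrow> P - Q \<in> (polys n :: 'a::comm_ring_1 mpoly set)"
  "k \<in> exps_of n \<Longrightarrow> Poly_Mapping.single k c \<in> (polys n :: 'a::comm_ring_1 mpoly set)"
  "0 \<in> (polys n :: 'a::comm_ring_1 mpoly set)"
proof -
  assume P: "P \<in> polys n" "Q \<in> polys n"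
  show "P * Q \<in> polys n"
    using keys_mult[of P Q] P unfolding polys_def by (auto intro: exps_of_add dest!: subsetD)
  show "P + Q \<in> polys n"
    using keys_add[of P Q] P unfolding polys_def by blast
  show "P - Q \<in> polys n"
    using P unfolding polys_def by (auto simp: in_keys_iff lookup_minus subset_iff) (metis diff_self)
qed (auto simp: polys_def)

lemma is_left_ideal_polys: "is_left_ideal (*) (polys n) (ideal_gen (polys n) (S :: 'a::comm_ring_1 mpoly set))"
  by (rule is_left_ideal_gen) (auto simp: algebra_simps intro: polys_closed)

lemma ideal_incl_polys: "s \<in> S \<Longrightarrow> s \<in> ideal_gen (polys n) (S :: 'a::comm_ring_1 mpoly set)"
  using left_ideal_gen_incl[where mul = "(*)" and a = 1 and R = "polys n" and s = s and S = S] polys_closed(4)[of 0 n 1]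
  by (simp add: single_one)

lemma ideal_gen_polys_closed: "S \<subseteq> polys n \<Longrightarrow> ideal_gen (polys n) (S :: 'a::comm_ring_1 mpoly set) \<subseteq> polys n"
  by (rule left_ideal_gen_subset) (auto simp: is_left_ideal_def intro: polys_closed)

lemma sum_in_left_ideal:
  assumes "is_left_ideal mul R I" "\<And>x. x \<in> A \<Longrightarrow> f x \<in> I" shows "sum f A \<in> I"
  using assms(2)
  by (induction A rule: infinite_finite_induct) (use assms(1) in \<open>auto simp: is_left_ideal_def\<close>)

text \<open>
  Of two distinct equivalent monomials one is divisible by a leading monomial.  Replacing it by the
  trailing monomial lowers the sum of the exponents at the positions \<open>0\<close> and \<open>2\<close>, so the process ends.
\<close>

lemma monomial_diff_in_scroll_ideal:
  assumes "m \<in> exps_of 5" "m' \<in> exps_of 5" "lattice_equiv m m'"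
  shows "Poly_Mapping.single m 1 - Poly_Mapping.single m' 1 \<in> scroll_ideal"
  using assms
proof (induction "lookup m 0 + lookup m 2 + lookup m' 0 + lookup m' 2" arbitrary: m m' rule: less_induct)
  case less
  have J: "is_left_ideal (*) (polys 5) scroll_ideal" unfolding scroll_ideal_def by (rule is_left_ideal_polys)
  have step: "Poly_Mapping.single (k + lead_exp i) 1 - Poly_Mapping.single (k + trail_exp i) 1 \<in> scroll_ideal"
    "k + trail_exp i \<in> exps_of 5"
    "lookup (k + trail_exp i) 0 + lookup (k + trail_exp i) 2 < lookup (k + lead_exp i) 0 + lookup (k + lead_exp i) 2"
    if i: "i < 3" and k: "k + lead_exp i \<in> exps_of 5" for i k
  proof -
    have k5: "k \<in> exps_of 5" using k by (auto simp: exps_of_lookup lookup_add)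
    have "Poly_Mapping.single k 1 * scroll_binomial i \<in> scroll_ideal"
      unfolding scroll_ideal_def by (rule left_ideal_gen_incl) (use i k5 in \<open>auto intro: polys_closed\<close>)
    then show "Poly_Mapping.single (k + lead_exp i) 1 - Poly_Mapping.single (k + trail_exp i) 1 \<in> scroll_ideal"
      by (simp add: scroll_binomial_def right_diff_distrib mult_single)
    show "k + trail_exp i \<in> exps_of 5" using k5 lead_trail_exps_of[OF i] by auto
    show "lookup (k + trail_exp i) 0 + lookup (k + trail_exp i) 2 < lookup (k + lead_exp i) 0 + lookup (k + lead_exp i) 2"
      using less3_cases[OF i] by (elim disjE) (simp_all add: lookup_add lookup_lead_trail del: One_nat_def)
  qed
  obtain a b where ab: "\<And>j. int (lookup m j) = int (lookup m' j) + rel_vec a b j"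
    using lattice_equivE[OF less.prems(3)] by blast
  consider "a > 0 \<or> b > 0" | "-a > 0 \<or> -b > 0" | "a = 0" "b = 0" by linarith
  then show ?case
  proof cases
    case 1
    from divisible_by_lead[OF ab 1] obtain i k where i: "i < 3" "m = k + lead_exp i" by blast
    note st = step[OF i(1), of k, folded i(2), OF less.prems(1)]
    have eq: "lattice_equiv (k + trail_exp i) m'"
      using lattice_equiv_sym[OF lattice_equiv_lead_trail[OF i(1), of k]] less.prems(3) lattice_equiv_trans unfolding i(2) by blast
    have "Poly_Mapping.single (k + trail_exp i) 1 - Poly_Mapping.single m' 1 \<in> scroll_ideal"
      by (rule less.hyps[OF _ st(2) less.prems(2) eq]) (use st(3) in linarith)
    from J[unfolded is_left_ideal_def, THEN conjunct2, THEN conjunct1, rule_format, OF st(1) this]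
    show ?thesis by simp
  next
    case 2
    have ab': "int (lookup m' j) = int (lookup m j) + rel_vec (-a) (-b) j" for j
      using ab[of j] rel_vec_arith(2)[of a b] by (metis add.right_inverse add.right_neutral add.assoc)
    from divisible_by_lead[OF ab' 2] obtain i k where i: "i < 3" "m' = k + lead_exp i" by blast
    note st = step[OF i(1), of k, folded i(2), OF less.prems(2)]
    have eq: "lattice_equiv m (k + trail_exp i)"
      using lattice_equiv_lead_trail[OF i(1), of k] less.prems(3) lattice_equiv_trans unfolding i(2) by blast
    have 1: "Poly_Mapping.single m 1 - Poly_Mapping.single (k + trail_exp i) 1 \<in> scroll_ideal"
      by (rule less.hyps[OF _ less.prems(1) st(2) eq]) (use st(3) in linarith)
    have "Poly_Mapping.single 0 (-1) * (Poly_Mapping.single m' 1 - Poly_Mapping.single (k + trail_exp i) 1) \<in> scroll_ideal"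
      using J st(1) polys_closed(4)[OF exps_of_zero] unfolding is_left_ideal_def by blast
    from J[unfolded is_left_ideal_def, THEN conjunct2, THEN conjunct1, rule_format, OF 1 this]
    show ?thesis by (simp add: right_diff_distrib mult_single single_uminus)
  next
    case 3
    then have "m = m'" using ab by (intro exps_of_5_eqI[OF less.prems(1,2)]) (auto simp: all_less5)
    then show ?thesis using J by (simp add: is_left_ideal_def)
  qed
qed

lemma toric_eq: "toric = scroll_ideal"
proof (rule antisym)
  show "toric \<subseteq> scroll_ideal"
    unfolding toric_ideal_def
  proof (rule left_ideal_gen_subset)
    show "is_left_ideal (*) (polys 5) scroll_ideal" unfolding scroll_ideal_def by (rule is_left_ideal_polys)
    show "toric_binomial ` scroll_lattice \<subseteq> scroll_ideal"
    proof (rule image_subsetI)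
      fix u assume u: "u \<in> scroll_lattice"
      then have v: "u \<in> vectors 5" by (simp add: relation_lattice_def)
      have "pos_part u \<in> exps_of 5" "neg_part u \<in> exps_of 5"
        unfolding exps_of_lookup pos_part_lookup[OF v] neg_part_lookup[OF v] using v by (auto simp: vectors_def)
      moreover have "lattice_equiv (pos_part u) (neg_part u)"
      proof -
        have "(\<lambda>j. int (lookup (pos_part u) j) - int (lookup (neg_part u) j)) = u"
          by (auto simp: pos_part_lookup[OF v] neg_part_lookup[OF v])
        then show ?thesis using u by (simp add: lattice_equiv_def)
      qed
      ultimately show "toric_binomial u \<in> scroll_ideal"
        unfolding toric_binomial_def by (rule monomial_diff_in_scroll_ideal)
    qed
  qed
  show "scroll_ideal \<subseteq> toric"
    unfolding scroll_ideal_def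
  proof (rule left_ideal_gen_subset)
    show "is_left_ideal (*) (polys 5) toric" unfolding toric_ideal_def by (rule is_left_ideal_polys)
    show "scroll_binomial ` {..<3} \<subseteq> toric"
    proof (rule image_subsetI)
      fix i :: nat assume "i \<in> {..<3}"
      then have i: "i < 3" by simp
      have "scroll_vec i \<in> scroll_lattice"
        unfolding scroll_lattice_iff using less3_cases[OF i] by (elim disjE) (simp add: scroll_vec_def, blast)+
      moreover have "scroll_binomial i = toric_binomial (scroll_vec i)"
        by (simp add: scroll_binomial_def toric_binomial_def scroll_vec_parts[OF i])
      ultimately show "scroll_binomial i \<in> toric" unfolding toric_ideal_def by (auto intro: ideal_incl_polys)
    qed
  qed
qed

lemma scroll_ideal_closed: "scroll_ideal \<subseteq> polys 5"
  unfolding scroll_ideal_def scroll_binomial_def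
  by (rule ideal_gen_polys_closed) (auto intro!: polys_closed lead_trail_exps_of)

text \<open>
  The sum of the coefficients over one fibre vanishes on the toric ideal, since binomials cancel inside
  a fibre.
\<close>

definition class_sum :: "exps \<Rightarrow> complex mpoly \<Rightarrow> complex" where
  "class_sum m f = (\<Sum>k\<in>keys f. lookup f k * (if lattice_equiv k m then 1 else 0))"

lemma class_sum_add: "class_sum m (f + g) = class_sum m f + class_sum m g"
  unfolding class_sum_def by (rule setsum_keys_plus_distrib) (auto simp: distrib_right)

lemma class_sum_single: "class_sum m (Poly_Mapping.single k c) = (if lattice_equiv k m then c else 0)"
  by (simp add: class_sum_def)

lemma class_sum_scroll_ideal:
  assumes "f \<in> scroll_ideal" shows "class_sum m f = 0"
  using assms unfolding scroll_ideal_def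
proof (induction rule: left_ideal_gen_induct)
  case (mult a s)
  then obtain i where i: "i < 3" "s = scroll_binomial i" by auto
  show ?case unfolding i(2)
  proof (induction a rule: poly_mapping_additive_induct)
    case (single k c)
    have eq: "lattice_equiv (k + lead_exp i) m \<longleftrightarrow> lattice_equiv (k + trail_exp i) m"
      using lattice_equiv_lead_trail[OF i(1), of k] lattice_equiv_trans lattice_equiv_sym by blast
    have "Poly_Mapping.single k c * scroll_binomial i
        = Poly_Mapping.single (k + lead_exp i) c + Poly_Mapping.single (k + trail_exp i) (- c)"
      by (simp add: scroll_binomial_def right_diff_distrib mult_single single_uminus)
    then show ?case using eq by (simp add: class_sum_add class_sum_single)
  qed (simp_all add: class_sum_add distrib_right, simp add: class_sum_def)
qed (simp_all add: class_sum_add, simp add: class_sum_def)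

section \<open>The initial ideal of the scroll\<close>

definition lead_ideal :: "complex mpoly set" where
  "lead_ideal = ideal_gen (polys 5) ((\<lambda>m. Poly_Mapping.single m 1) ` (lead_exp ` {..<3}))"

lemma lead_ideal_keys:
  assumes "f \<in> lead_ideal" "k \<in> keys f" shows "\<exists>i<3. \<exists>l. k = l + lead_exp i"
proof -
  have "\<forall>k\<in>keys f. \<exists>i<3. \<exists>l. k = l + lead_exp i"
    using assms(1) unfolding lead_ideal_def
  proof (induction rule: left_ideal_gen_induct)
    case (add f g)
    then show ?case using keys_add[of f g] by blast
  next
    case (mult a s)
    then obtain i where i: "i < 3" "s = Poly_Mapping.single (lead_exp i) 1" by auto
    show ?case
    proof
      fix k assume "k \<in> keys (a * s)"
      then have "k \<in> {x + y |x y. x \<in> keys a \<and> y \<in> keys s}" by (rule subsetD[OF keys_mult])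
      then obtain x y where "k = x + y" "y \<in> keys s" by blast
      then show "\<exists>i<3. \<exists>l. k = l + lead_exp i" using i by auto
    qed
  qed simp
  then show ?thesis using assms(2) by blast
qed

lemma weight5: "m \<in> exps_of 5 \<Longrightarrow> weight w m = w 0 * lookup m 0 + w 1 * lookup m 1 + w 2 * lookup m 2 + w 3 * lookup m 3 + w 4 * lookup m 4"
  by (simp add: weight_eq sum_less5)

text \<open>
  The two inequalities make the vectors \<open>rel_vec 1 0\<close> and \<open>rel_vec 0 1\<close> positive, hence also their sum
  \<open>rel_vec 1 1\<close>.
\<close>

definition leading_weight :: "(nat \<Rightarrow> real) \<Rightarrow> bool" where
  "leading_weight w \<longleftrightarrow> w 0 + w 4 > w 1 + w 3 \<and> w 2 + w 3 > w 1 + w 4"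

lemma initial_form_scroll_binomial:
  assumes "leading_weight w" "i < 3"
  shows "initial_form (weight w) (scroll_binomial i) = Poly_Mapping.single (lead_exp i) 1"
proof -
  have lt: "weight w (trail_exp i) < weight w (lead_exp i)"
    unfolding weight5[OF lead_trail_exps_of(1)[OF assms(2)]] weight5[OF lead_trail_exps_of(2)[OF assms(2)]]
    using less3_cases[OF assms(2)] assms(1)
    by (elim disjE) (simp_all add: lookup_lead_trail leading_weight_def del: One_nat_def)
  then have ne: "lead_exp i \<noteq> trail_exp i" by auto
  then have keys: "keys (scroll_binomial i) = {lead_exp i, trail_exp i}"
    by (auto simp: in_keys_iff scroll_binomial_def lookup_minus lookup_single when_def split: if_splits)
  have "{m \<in> keys (scroll_binomial i). \<forall>m'\<in>keys (scroll_binomial i). weight w m' \<le> weight w m} = {lead_exp i}"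
    using lt unfolding keys by force
  then show ?thesis using ne
    by (simp add: initial_form_def scroll_binomial_def lookup_minus lookup_single when_def)
qed

text \<open>
  A monomial \<open>m\<close> of largest weight in an element of the toric ideal has a partner \<open>k\<close> in its fibre, because
  the coefficients of the fibre add up to zero.  The vector from \<open>k\<close> to \<open>m\<close> has nonnegative weight, so one
  of its lattice coordinates is positive, and \<open>m\<close> is divisible by a leading monomial.
\<close>

lemma initial_ideal_scroll:
  assumes w: "leading_weight w" shows "initial_ideal 5 w toric = lead_ideal"
proof (rule antisym)
  have L: "is_left_ideal (*) (polys 5) lead_ideal" unfolding lead_ideal_def by (rule is_left_ideal_polys)
  show "initial_ideal 5 w toric \<subseteq> lead_ideal"
    unfolding initial_ideal_def toric_eq
  proof (rule left_ideal_gen_subset[OF L], rule image_subsetI)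
    fix f assume f: "f \<in> scroll_ideal"
    have div: "\<exists>i<3. \<exists>k. m = k + lead_exp i" if m: "m \<in> keys f" "\<forall>m'\<in>keys f. weight w m' \<le> weight w m" for m
    proof -
      \<comment> \<open>The coefficients in the fibre of \<open>m\<close> cannot add up to zero if \<open>m\<close> is alone in it.\<close>
      have "\<exists>k\<in>keys f. k \<noteq> m \<and> lattice_equiv k m"
      proof (rule ccontr)
        assume neg: "\<not> ?thesis"
        have mm: "lattice_equiv m m" by (rule lattice_equivI[of _ _ 0 0]) simp
        have "class_sum m f = (\<Sum>k\<in>keys f. if k = m then lookup f k else 0)"
          unfolding class_sum_def by (rule sum.cong) (use neg mm in auto)
        then have "lookup f m = 0" using class_sum_scroll_ideal[OF f, of m] m(1) by (simp add: sum.delta)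
        then show False using m(1) by (simp add: in_keys_iff)
      qed
      then obtain k where k: "k \<in> keys f" "k \<noteq> m" "lattice_equiv k m" by blast
      obtain a b where ab: "\<And>j. int (lookup m j) = int (lookup k j) + rel_vec a b j"
        using lattice_equivE[OF lattice_equiv_sym[OF k(3)]] by blast
      show ?thesis
      proof (cases "a > 0 \<or> b > 0")
        case True
        then show ?thesis by (rule divisible_by_lead[OF ab])
      next
        case False
        have mk: "m \<in> exps_of 5" "k \<in> exps_of 5" using f m(1) k(1) scroll_ideal_closed by (auto simp: polys_def)
        have "\<not> (a = 0 \<and> b = 0)"
        proof
          assume "a = 0 \<and> b = 0"
          then have "m = k" using ab by (intro exps_of_5_eqI[OF mk]) (auto simp: all_less5)
          then show False using k(2) by simp
        qed
        have r: "real (lookup m j) = real (lookup k j) + of_int (rel_vec a b j)" for j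
          using ab[of j] by (metis of_int_add of_int_of_nat_eq)
        have "weight w m - weight w k = a * (w 0 + w 4 - w 1 - w 3) + b * (w 2 + w 3 - w 1 - w 4)"
          unfolding weight5[OF mk(1)] weight5[OF mk(2)] r by (simp add: algebra_simps)
        moreover have "\<dots> < 0"
        proof -
          let ?A = "w 0 + w 4 - w 1 - w 3" and ?B = "w 2 + w 3 - w 1 - w 4"
          have "?A > 0" "?B > 0" using w by (auto simp: leading_weight_def)
          moreover have "real_of_int a \<le> 0" "real_of_int b \<le> 0" "real_of_int a < 0 \<or> real_of_int b < 0"
            using False \<open>\<not> (a = 0 \<and> b = 0)\<close> by auto
          ultimately show ?thesis
            by (metis add_neg_nonpos add_nonpos_neg less_eq_real_def mult_neg_pos mult_nonpos_nonneg)
        qed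
        ultimately show ?thesis using m(2) k(1) by force
      qed
    qed
    have "Poly_Mapping.single m (lookup f m) \<in> lead_ideal" if m: "m \<in> keys f" "\<forall>m'\<in>keys f. weight w m' \<le> weight w m" for m
    proof -
      obtain i k where i: "i < 3" "m = k + lead_exp i" using div[OF m] by blast
      have "m \<in> exps_of 5" using f m(1) scroll_ideal_closed by (auto simp: polys_def)
      then have "k \<in> exps_of 5" by (auto simp: i(2) exps_of_lookup lookup_add)
      then have "Poly_Mapping.single k (lookup f m) * Poly_Mapping.single (lead_exp i) 1 \<in> lead_ideal"
        unfolding lead_ideal_def by (intro left_ideal_gen_incl) (use i(1) in \<open>auto intro: polys_closed\<close>)
      then show ?thesis by (simp add: mult_single i(2))
    qed
    then show "initial_form (weight w) f \<in> lead_ideal"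
      unfolding initial_form_def
      using L by (intro sum_in_left_ideal) auto
  qed
  show "lead_ideal \<subseteq> initial_ideal 5 w toric"
    unfolding lead_ideal_def initial_ideal_def
  proof (rule left_ideal_gen_mono, rule image_subsetI)
    fix m assume "m \<in> lead_exp ` {..<3}"
    then obtain i where i: "i < 3" "m = lead_exp i" by auto
    have "scroll_binomial i \<in> toric"
      unfolding toric_eq scroll_ideal_def by (rule ideal_incl_polys) (use i in auto)
    then show "Poly_Mapping.single m 1 \<in> initial_form (weight w) ` toric"
      using initial_form_scroll_binomial[OF w i(1)] i(2) by (metis imageI)
  qed
qed

lemma exp_dvd_lead: "exp_dvd (lead_exp i) m \<Longrightarrow> i < 3 \<Longrightarrow>
   (i = 0 \<and> lookup m 0 > 0 \<and> lookup m 2 > 0) \<or> (i = 1 \<and> lookup m 0 > 0 \<and> lookup m 4 > 0) \<or> (i = 2 \<and> lookup m 2 > 0 \<and> lookup m 3 > 0)"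
proof -
  assume a: "exp_dvd (lead_exp i) m" "i < 3"
  have d: "lookup (lead_exp i) j \<le> lookup m j" for j using a(1) by (simp add: exp_dvd_def)
  show ?thesis using less3_cases[OF a(2)] d[of 0] d[of 2] d[of 3] d[of 4]
    by (elim disjE) (auto simp: lookup_lead_trail simp flip: One_nat_def)
qed

abbreviation scroll_vecs :: "(nat \<Rightarrow> int) set" where "scroll_vecs \<equiv> scroll_vec ` {..<3}"

lemma toric_binomial_scroll_vec: "i < 3 \<Longrightarrow> toric_binomial (scroll_vec i) = scroll_binomial i"
  by (simp add: toric_binomial_def scroll_binomial_def scroll_vec_parts)

lemma lead_neq_trail: "i < 3 \<Longrightarrow> lead_exp i \<noteq> trail_exp i"
proof
  assume i: "i < 3" and "lead_exp i = trail_exp i"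
  then have "lookup (lead_exp i) 1 = lookup (trail_exp i) 1" by simp
  then show False using less3_cases[OF i] by (elim disjE) (simp_all add: lookup_lead_trail del: One_nat_def)
qed

lemma keys_scroll_binomial: "i < 3 \<Longrightarrow> keys (scroll_binomial i) = {lead_exp i, trail_exp i}"
  using lead_neq_trail[of i]
  by (auto simp: in_keys_iff scroll_binomial_def lookup_minus lookup_single when_def split: if_splits)

lemma groebner_vectors_scroll:
  assumes w: "leading_weight w" shows "groebner_vectors 3 5 scroll_matrix w scroll_vecs"
  unfolding groebner_vectors_def reduced_groebner_basis_def
proof (intro conjI)
  have img: "toric_binomial ` scroll_vecs = scroll_binomial ` {..<3}"
    unfolding image_image by (rule image_cong) (simp_all add: toric_binomial_scroll_vec)
  show "scroll_vecs \<subseteq> scroll_lattice"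
  proof (rule image_subsetI)
    fix i :: nat assume "i \<in> {..<3}"
    then have "i < 3" by simp
    from less3_cases[OF this] show "scroll_vec i \<in> scroll_lattice"
      unfolding scroll_lattice_iff by (elim disjE) (simp add: scroll_vec_def, blast)+
  qed
  show "\<forall>g\<in>scroll_vecs. initial_form (weight w) (toric_binomial g) = Poly_Mapping.single (pos_part g) 1"
    using initial_form_scroll_binomial[OF w] by (auto simp: toric_binomial_scroll_vec scroll_vec_parts)
  show "toric_binomial ` scroll_vecs \<subseteq> toric"
    unfolding img toric_eq scroll_ideal_def by (auto intro: ideal_incl_polys)
  show "\<forall>f\<in>toric_binomial ` scroll_vecs. \<exists>m. initial_form (weight w) f = Poly_Mapping.single m 1"
    unfolding img using initial_form_scroll_binomial[OF w] by auto
  have "initial_form (weight w) ` scroll_binomial ` {..<3} = (\<lambda>m. Poly_Mapping.single m 1) ` (lead_exp ` {..<3})"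
    unfolding image_image by (rule image_cong) (simp_all add: initial_form_scroll_binomial[OF w])
  then show "ideal_gen (polys 5) (initial_form (weight w) ` toric_binomial ` scroll_vecs) = initial_ideal 5 w toric"
    unfolding img initial_ideal_scroll[OF w] lead_ideal_def by simp
  show "\<forall>f\<in>toric_binomial ` scroll_vecs. \<forall>g\<in>toric_binomial ` scroll_vecs. \<forall>m\<in>keys f.
      \<forall>l\<in>keys (initial_form (weight w) g). exp_dvd l m \<longrightarrow> g = f \<and> l = m"
    unfolding img
  proof (intro ballI impI)
    fix f g m l assume fg: "f \<in> scroll_binomial ` {..<3}" "g \<in> scroll_binomial ` {..<3}" "m \<in> keys f"
      "l \<in> keys (initial_form (weight w) g)" "exp_dvd l m"
    then obtain i k where i: "i < 3" "f = scroll_binomial i" and k: "k < 3" "g = scroll_binomial k" by auto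
    have l: "l = lead_exp k" using fg(4) by (simp add: k initial_form_scroll_binomial[OF w])
    have m: "m = lead_exp i \<or> m = trail_exp i" using fg(3) by (simp add: i keys_scroll_binomial)
    have "i = k \<and> m = lead_exp i"
      using exp_dvd_lead[OF fg(5)[unfolded l] k(1)] m less3_cases[OF i(1)]
      by (elim disjE) (auto simp: lookup_lead_trail simp flip: One_nat_def)
    then show "g = f \<and> l = m" using i k l by simp
  qed
qed simp_all

section \<open>The fake exponent\<close>

definition scroll_exponent_int :: "nat \<Rightarrow> int" where "scroll_exponent_int = list_vec [0, 2, 0, 0, -1]"
definition scroll_exponent :: "nat \<Rightarrow> complex" where "scroll_exponent j = of_int (scroll_exponent_int j)"
definition scroll_beta :: "nat \<Rightarrow> complex" where "scroll_beta i = (if i = 0 then 1 else if i = 1 then 1 else if i = 2 then -1 else 0)"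

lemma scroll_exponent_int_simps [simp]: "scroll_exponent_int 0 = 0" "scroll_exponent_int 1 = 2" "scroll_exponent_int (Suc 0) = 2" "scroll_exponent_int 2 = 0" "scroll_exponent_int 3 = 0" "scroll_exponent_int 4 = -1" "j \<ge> 5 \<Longrightarrow> scroll_exponent_int j = 0"
  by (simp_all add: scroll_exponent_int_def)

text \<open>
  Each leading monomial involves position \<open>0\<close> or position \<open>2\<close>, and the exponent vanishes at both.
\<close>

lemma fake_exponent_scroll:
  assumes w: "leading_weight w" shows "fake_exponent 3 5 scroll_matrix scroll_beta w scroll_exponent"
  unfolding fake_exponent_def
proof (intro conjI allI impI)
  show "scroll_exponent \<in> vectors 5" by (simp add: vectors_def scroll_exponent_def)
  fix i :: nat assume "i < 3"
  then show "(\<Sum>j<5. of_int (scroll_matrix i j) * scroll_exponent j) = scroll_beta i"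
    using less3_cases[of i] by (auto simp: sum_less5 scroll_exponent_def scroll_beta_def)
next
  fix p assume p: "Poly_Mapping.single p 1 \<in> initial_ideal 5 w toric"
  then obtain i l where i: "i < 3" "p = l + lead_exp i"
    using lead_ideal_keys[of "Poly_Mapping.single p 1" p] by (auto simp: initial_ideal_scroll[OF w])
  have "\<exists>j. lookup p j > 0 \<and> scroll_exponent j = 0"
    using less3_cases[OF i(1)]
    by (elim disjE) (auto simp: i(2) lookup_add lookup_lead_trail scroll_exponent_def simp flip: One_nat_def
        intro: exI[of _ 0] exI[of _ 2])
  then obtain j where j: "lookup p j > 0" "scroll_exponent j = 0" by blast
  have "(\<Prod>k<lookup p j. scroll_exponent j - of_nat k) = 0"
    by (rule prod_zero) (use j in \<open>auto intro!: bexI[of _ 0]\<close>)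
  moreover have "j \<in> keys p" using j by (simp add: in_keys_iff)
  ultimately show "falling scroll_exponent p = 0"
    unfolding falling_def by (meson finite_keys prod_zero)
qed

lemma scroll_beta_vectors: "scroll_beta \<in> vectors 3" by (simp add: vectors_def scroll_beta_def)

section \<open>Normality, Gale dual and rank\<close>

lemma sum_scroll_vecs: "(\<Sum>g\<in>scroll_vecs. F g) = F (rel_vec 1 1) + F (rel_vec 1 0) + (F (rel_vec 0 1) :: 'a::comm_monoid_add)"
proof -
  have "scroll_vecs = {rel_vec 1 1, rel_vec 1 0, rel_vec 0 1}"
    by (auto simp: scroll_vec_def numeral_eq_Suc lessThan_Suc)
  then show ?thesis by (simp add: rel_vec_inj ac_simps)
qed

lemma rel_vec_out: "j \<ge> 5 \<Longrightarrow> rel_vec a b j = 0"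
  by (simp add: rel_vec_def)

text \<open>
  The cone is a quadrant in the lattice coordinates, and \<open>rel_vec 1 0\<close>, \<open>rel_vec 0 1\<close> form a lattice basis
  on its edges.
\<close>

lemma normal_scroll: "normal_semigroup scroll_vecs"
  unfolding normal_semigroup_def
proof (intro ballI impI)
  fix u assume u: "u \<in> group_gen scroll_vecs" and r: "(\<lambda>j. real_of_int (u j)) \<in> real_cone scroll_vecs"
  obtain c where c: "u = (\<lambda>j. c (rel_vec 1 1) * rel_vec 1 1 j + c (rel_vec 1 0) * rel_vec 1 0 j + c (rel_vec 0 1) * rel_vec 0 1 j)"
    using u by (auto simp: group_gen_def sum_scroll_vecs)
  define a b where "a = u 0" and "b = u 2"
  have u_eq: "u = rel_vec a b"
    by (rule vectors5_eqI) (auto simp: c a_def b_def all_less5 vectors_def rel_vec_def algebra_simps)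
  obtain d :: "(nat \<Rightarrow> int) \<Rightarrow> real" where d: "\<forall>g\<in>scroll_vecs. d g \<ge> 0"
    "(\<lambda>j. real_of_int (u j)) = (\<lambda>j. d (rel_vec 1 1) * rel_vec 1 1 j + d (rel_vec 1 0) * rel_vec 1 0 j + d (rel_vec 0 1) * rel_vec 0 1 j)"
    using r by (auto simp: real_cone_def sum_scroll_vecs)
  have mem: "rel_vec 1 1 \<in> scroll_vecs" "rel_vec 1 0 \<in> scroll_vecs" "rel_vec 0 1 \<in> scroll_vecs"
    using imageI[of 0 "{..<3}" scroll_vec] imageI[of 1 "{..<3}" scroll_vec] imageI[of 2 "{..<3}" scroll_vec]
    by (simp_all add: scroll_vec_def)
  have dn: "d (rel_vec 1 1) \<ge> 0" "d (rel_vec 1 0) \<ge> 0" "d (rel_vec 0 1) \<ge> 0" using d(1) mem by auto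
  have "real_of_int a = d (rel_vec 1 1) + d (rel_vec 1 0)" "real_of_int b = d (rel_vec 1 1) + d (rel_vec 0 1)"
    using fun_cong[OF d(2), of 0] fun_cong[OF d(2), of 2] by (simp_all add: a_def b_def)
  then have ab: "a \<ge> 0" "b \<ge> 0" using dn by linarith+
  show "u \<in> semigroup_gen scroll_vecs"
    unfolding semigroup_gen_def
  proof (rule CollectI, rule exI[of _ "\<lambda>g. if g = rel_vec 1 0 then nat a else if g = rel_vec 0 1 then nat b else 0"])
    show "u = (\<lambda>j. \<Sum>g\<in>scroll_vecs. int (if g = rel_vec 1 0 then nat a else if g = rel_vec 0 1 then nat b else 0) * g j)"
      unfolding sum_scroll_vecs u_eq using ab
      by (intro vectors5_eqI) (simp_all add: rel_vec_inj all_less5 vectors_def rel_vec_out)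
  qed
qed

definition scroll_gale :: "nat \<Rightarrow> nat \<Rightarrow> int" where
  "scroll_gale j i = (if i = 0 then rel_vec 1 0 j else rel_vec 0 1 j)"

lemma gale_dual_scroll: "gale_dual 3 5 2 scroll_matrix scroll_gale"
  unfolding gale_dual_def
proof (intro conjI allI impI ballI)
  fix i :: nat assume "i < 2"
  then show "(\<lambda>j. scroll_gale j i) \<in> scroll_lattice"
    by (cases "i = 0") (auto simp: scroll_gale_def scroll_lattice_iff)
next
  fix u assume "u \<in> scroll_lattice"
  then obtain a b where u: "u = rel_vec a b" by (auto simp: scroll_lattice_iff)
  show "\<exists>!c. c \<in> vectors 2 \<and> (\<forall>j<5. u j = (\<Sum>i<2. scroll_gale j i * c i))"
  proof (rule ex1I[of _ "list_vec [a, b]"])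
    show "list_vec [a, b] \<in> vectors 2 \<and> (\<forall>j<5. u j = (\<Sum>i<2. scroll_gale j i * list_vec [a, b] i))"
      unfolding all_less5 sum_less2 by (simp add: u scroll_gale_def vectors_def list_vec_def)
    fix c assume c: "c \<in> vectors 2 \<and> (\<forall>j<5. u j = (\<Sum>i<2. scroll_gale j i * c i))"
    then have "c 0 = a" "c 1 = b" unfolding all_less5 sum_less2 by (auto simp: u scroll_gale_def)
    then show "c = list_vec [a, b]"
      using c by (auto simp: list_vec_def vectors_def fun_eq_iff less_2_cases_iff not_less simp flip: One_nat_def)
  qed
qed

text \<open>
  The columns \<open>0\<close>, \<open>1\<close>, \<open>3\<close> form an upper triangular matrix with unit diagonal.
\<close>

lemma rank_scroll: "vec_space.rank 3 (mat 3 5 (\<lambda>(i, j). rat_of_int (scroll_matrix i j))) = 3"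
proof -
  interpret vec_space "TYPE(rat)" 3 .
  let ?A = "mat 3 5 (\<lambda>(i, j). rat_of_int (scroll_matrix i j))"
  have A: "?A \<in> carrier_mat 3 5" by simp
  define M where "M = mat 3 3 (\<lambda>(i, j). rat_of_int (scroll_matrix i (if j = 2 then 3 else j)))"
  have M: "M \<in> carrier_mat 3 3" by (simp add: M_def)
  have ut: "upper_triangular M"
    by (auto simp: upper_triangular_def M_def numeral_eq_Suc less_Suc_eq scroll_matrix_def list_vec_def)
  have "det M = prod_list (diag_mat M)" by (rule det_upper_triangular[OF ut M])
  also have "\<dots> = 1" by (simp add: diag_mat_def M_def numeral_eq_Suc scroll_matrix_def list_vec_def)
  finally have d: "det M \<noteq> 0" by simp
  then have "rank M = 3" using det_rank_iff[OF M] by simp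
  have sub: "set (cols M) \<subseteq> set (cols ?A)"
  proof
    fix x assume "x \<in> set (cols M)"
    then obtain j where j: "j < 3" "x = col M j" by (auto simp: cols_def M_def)
    have "x = col ?A (if j = 2 then 3 else j)"
      unfolding j(2) by (rule eq_vecI) (use j(1) in \<open>auto simp: M_def\<close>)
    then show "x \<in> set (cols ?A)" using j(1) by (auto simp: cols_def)
  qed
  have dist: "distinct (cols M)" using d det_identical_cols non_distinct_low_rank[OF M] \<open>rank M = 3\<close> by force
  have li: "lin_indpt (set (cols M))" by (rule full_rank_lin_indpt[OF M \<open>rank M = 3\<close> dist])
  have "card (set (cols M)) = 3" using dist M by (simp add: distinct_card)
  then have ge: "rank ?A \<ge> 3" using rank_ge_card_indpt[OF A sub li] by simp
  obtain S where S: "maximal S (\<lambda>T. T \<subseteq> set (cols ?A) \<and> lin_indpt T)"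
    using maximal_exists_superset[of "set (cols ?A)" "\<lambda>T. T \<subseteq> set (cols ?A) \<and> lin_indpt T" "set (cols M)"] sub li by blast
  then have S': "S \<subseteq> set (cols ?A)" "lin_indpt S" by (auto simp: maximal_def)
  have "S \<subseteq> carrier_vec 3" using S'(1) cols_dim[of ?A] by auto
  then have "card S \<le> 3" using li_le_dim(2)[OF fin_dim _ S'(2)] dim_is_n by simp
  then show ?thesis using ge rank_card_indpt[OF A S] by simp
qed

lemma homogeneous_scroll: "homogeneous_matrix 3 5 scroll_matrix"
  unfolding homogeneous_matrix_def
proof (intro conjI rank_scroll exI[of _ "list_vec [1,0,0] :: nat \<Rightarrow> real"] exI[of _ "1 :: real"])
  show "\<forall>j<5. (\<Sum>i<3. (list_vec [1,0,0] i :: real) * of_int (scroll_matrix i j)) = 1"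
    unfolding all_less5 sum_less3 by (simp add: list_vec_def)
qed simp

section \<open>Negative supports\<close>

text \<open>
  The negative support at \<open>rel_vec a b\<close>, where the exponent becomes \<open>(a, 2 - a - b, b, b - a, a - b - 1)\<close>.
  The last two entries are negatives of each other up to the shift by one, so exactly one of them is
  negative.
\<close>

definition supp :: "int \<Rightarrow> int \<Rightarrow> nat set" where
  "supp a b = (if a < 0 then {0} else {}) \<union> (if a + b \<ge> 3 then {1} else {}) \<union> (if b < 0 then {2} else {})
     \<union> (if b < a then {3} else {4})"

lemma nsupp_at_rel_vec: "nsupp_at 5 scroll_exponent (rel_vec a b) = supp a b"
proof -
  have "j \<in> nsupp_at 5 scroll_exponent (rel_vec a b) \<longleftrightarrow> j < 5 \<and> scroll_exponent_int j + rel_vec a b j < 0" for j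
  proof -
    have "scroll_exponent j + of_int (rel_vec a b j) = of_int (scroll_exponent_int j + rel_vec a b j)"
      by (simp add: scroll_exponent_def)
    then show ?thesis unfolding nsupp_at_def nsupp_def mem_Collect_eq by (simp only: of_int_eq_iff) auto
  qed
  moreover have "j < 5 \<and> scroll_exponent_int j + rel_vec a b j < 0 \<longleftrightarrow> j \<in> supp a b" for j
  proof (cases "j < 5")
    case True
    from less5_cases[OF this] show ?thesis
      by (elim disjE) (simp add: supp_def; linarith)+
  qed (simp add: supp_def)
  ultimately show ?thesis by blast
qed

lemma nsupps_scroll: "nsupps 3 5 scroll_matrix scroll_exponent = {supp a b | a b. True}"
proof (rule Set.set_eqI, rule iffI)
  fix I assume "I \<in> nsupps 3 5 scroll_matrix scroll_exponent"
  then obtain u where u: "u \<in> scroll_lattice" "I = nsupp_at 5 scroll_exponent u" unfolding nsupps_def by blast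
  then obtain a b where "u = rel_vec a b" unfolding scroll_lattice_iff by blast
  with u have "I = supp a b" by (simp add: nsupp_at_rel_vec)
  then show "I \<in> {supp a b | a b. True}" by blast
next
  fix I assume "I \<in> {supp a b | a b. True}"
  then obtain a b where "I = supp a b" by blast
  then have "I = nsupp_at 5 scroll_exponent (rel_vec a b)" by (simp add: nsupp_at_rel_vec)
  moreover have "rel_vec a b \<in> scroll_lattice" unfolding scroll_lattice_iff by blast
  ultimately show "I \<in> nsupps 3 5 scroll_matrix scroll_exponent" unfolding nsupps_def by (rule image_eqI)
qed

lemma supp_in_nsupps: "supp a b \<in> nsupps 3 5 scroll_matrix scroll_exponent"
  unfolding nsupps_scroll by blast

lemma nsupp_scroll_exponent: "nsupp 5 scroll_exponent = {4}"
proof -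
  have "nsupp 5 scroll_exponent = nsupp_at 5 scroll_exponent (rel_vec 0 0)" by (simp add: nsupp_at_def)
  then show ?thesis by (simp add: nsupp_at_rel_vec supp_def)
qed

text \<open>
  The negative supports of the quadrant \<open>a, b \<ge> 0\<close>.
\<close>

definition scroll_family :: "nat set set" where "scroll_family = {{3}, {4}, {1, 3}, {1, 4}}"

lemma supp_in_family: "supp a b \<in> scroll_family \<longleftrightarrow> a \<ge> 0 \<and> b \<ge> 0"
proof
  assume "supp a b \<in> scroll_family"
  then have "0 \<notin> supp a b" "2 \<notin> supp a b" by (auto simp: scroll_family_def)
  then show "a \<ge> 0 \<and> b \<ge> 0" by (auto simp: supp_def split: if_splits)
qed (auto simp: supp_def scroll_family_def)

lemma family_supps: "I \<in> scroll_family \<Longrightarrow> \<exists>a\<ge>0. \<exists>b\<ge>0. I = supp a b"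
proof -
  have "supp 0 0 = {4}" "supp 1 0 = {3}" "supp 3 0 = {1,3}" "supp 0 3 = {1,4}" by (auto simp: supp_def)
  then show "I \<in> scroll_family \<Longrightarrow> ?thesis" unfolding scroll_family_def
    by (metis insert_iff empty_iff order_refl zero_le_numeral zero_le_one)
qed

text \<open>
  The second inequality decides the two supports outside the quadrant that occur in unbounded regions
  with \<open>a + b \<ge> 3\<close>: the region with \<open>b < 0\<close> has positive weight, the region with \<open>a < 0\<close> has not.
\<close>

definition scroll_weight :: "(nat \<Rightarrow> real) \<Rightarrow> bool" where
  "scroll_weight w \<longleftrightarrow> leading_weight w \<and> w 0 + w 4 - w 1 - w 3 > w 2 + w 3 - w 1 - w 4"

text \<open>
  The region \<open>b < 0\<close>, \<open>a + b \<ge> 3\<close> has support \<open>{1, 2, 3}\<close>, and it will turn out to be the only addition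
  needed for the distinguished collection.
\<close>

definition full_family :: "nat set set" where "full_family = insert {1, 2, 3} scroll_family"

lemma weight_rel_vec:
  "(\<Sum>j<5. w j * real_of_int (rel_vec a b j)) = a * (w 0 + w 4 - w 1 - w 3) + b * (w 2 + w 3 - w 1 - w 4)"
  by (simp add: sum_less5 algebra_simps)

text \<open>
  The plane of coordinates \<open>(a, b)\<close> splits into regions of constant support.  Every region other than the
  quadrant and the one of \<open>{1, 2, 3}\<close> contains a vector of negative weight.
\<close>

lemma distinguished_scroll:
  assumes w: "scroll_weight w" shows "distinguished_collection 3 5 scroll_matrix w scroll_exponent = full_family"
proof -
  define \<alpha> \<beta> where "\<alpha> = w 0 + w 4 - w 1 - w 3" and "\<beta> = w 2 + w 3 - w 1 - w 4"
  have ab: "\<beta> > 0" "\<alpha> > \<beta>" using w by (auto simp: scroll_weight_def leading_weight_def \<alpha>_def \<beta>_def)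
  have D: "I \<in> distinguished_collection 3 5 scroll_matrix w scroll_exponent \<longleftrightarrow>
      (\<exists>a b. I = supp a b) \<and> (\<forall>a b. supp a b = I \<longrightarrow> a * \<alpha> + b * \<beta> \<ge> 0)" for I
  proof -
    have ball: "(\<forall>u\<in>scroll_lattice. Q u) \<longleftrightarrow> (\<forall>a b. Q (rel_vec a b))" for Q
    proof -
      have "rel_vec a b \<in> scroll_lattice" for a b unfolding scroll_lattice_iff by blast
      then show ?thesis by (metis scroll_lattice_iff)
    qed
    show ?thesis unfolding distinguished_collection_def nsupps_scroll mem_Collect_eq ball nsupp_at_rel_vec weight_rel_vec \<alpha>_def \<beta>_def
      by simp
  qed
  have nn: "a * \<alpha> + b * \<beta> \<ge> 0" if "a \<ge> 0" "b \<ge> 0" for a b :: int using that ab by simp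
  show ?thesis
  proof (rule Set.set_eqI, rule iffI)
    fix I assume "I \<in> distinguished_collection 3 5 scroll_matrix w scroll_exponent"
    then obtain a b where I: "I = supp a b" and pos: "\<And>a' b'. supp a' b' = supp a b \<Longrightarrow> a' * \<alpha> + b' * \<beta> \<ge> 0"
      unfolding D by blast
    consider "a \<ge> 0" "b \<ge> 0" | "a < 0" "b < 0" | "a < 0" "b \<ge> 0" "a + b < 3" | "a < 0" "a + b \<ge> 3"
      | "a \<ge> 0" "b < 0" "a + b < 3" | "b < 0" "a + b \<ge> 3" by linarith
    then show "I \<in> full_family"
    proof cases
      case 1
      then show ?thesis by (simp add: I full_family_def supp_in_family)
    next
      case 2
      have "a * \<alpha> < 0" "b * \<beta> < 0" using 2 ab by (simp_all add: mult_less_0_iff)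
      then show ?thesis using pos[of a b] by simp
    next
      case 3
      have "supp (-1) 0 = supp a b" using 3 by (auto simp: supp_def)
      from pos[OF this] show ?thesis using ab by simp
    next
      case 4
      \<comment> \<open>Far out in the region \<open>a < 0\<close>, \<open>a + b \<ge> 3\<close>, along its edge \<open>a + b = 3\<close>, the weight becomes negative.\<close>
      obtain N :: nat where N: "3 * \<beta> < real N * (\<alpha> - \<beta>)"
        using reals_Archimedean3[of "\<alpha> - \<beta>"] ab by auto
      have "supp (- int (Suc N)) (int (Suc N) + 3) = supp a b" using 4 by (auto simp: supp_def)
      from pos[OF this] have "real (Suc N) * (\<alpha> - \<beta>) \<le> 3 * \<beta>" by (simp add: algebra_simps)
      moreover have "real N * (\<alpha> - \<beta>) \<le> real (Suc N) * (\<alpha> - \<beta>)" using ab by (intro mult_right_mono) auto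
      ultimately show ?thesis using N by linarith
    next
      case 5
      have "supp 0 (-1) = supp a b" using 5 by (auto simp: supp_def)
      from pos[OF this] show ?thesis using ab by simp
    next
      case 6
      then have "supp a b = {1, 2, 3}" by (auto simp: supp_def)
      then show ?thesis by (simp add: I full_family_def)
    qed
  next
    fix I assume "I \<in> full_family"
    then consider "I = {1, 2, 3}" | "I \<in> scroll_family" by (auto simp: full_family_def)
    then show "I \<in> distinguished_collection 3 5 scroll_matrix w scroll_exponent"
    proof cases
      case 1
      have "I = supp 4 (-1)" by (auto simp: 1 supp_def)
      moreover have "a * \<alpha> + b * \<beta> \<ge> 0" if s: "supp a b = I" for a b
      proof -
        have "0 \<notin> supp a b" "1 \<in> supp a b" by (auto simp: s 1)
        then have a: "a \<ge> 0" "a + b \<ge> 3" by (auto simp: supp_def split: if_splits)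
        have "0 \<le> real_of_int (a + b) * \<beta>" using a(2) ab by simp
        also have "\<dots> \<le> a * \<alpha> + b * \<beta>" using mult_left_mono[of \<beta> \<alpha> "real_of_int a"] a(1) ab by (simp add: algebra_simps)
        finally show ?thesis .
      qed
      ultimately show ?thesis unfolding D by blast
    next
      case 2
      then obtain a b where "I = supp a b" using family_supps by blast
      moreover have "a * \<alpha> + b * \<beta> \<ge> 0" if "supp a b = I" for a b
        using nn supp_in_family[of a b] 2 that by simp
      ultimately show ?thesis unfolding D by blast
    qed
  qed
qed

lemma Inter_families: "\<Inter>scroll_family = {}" "\<Inter>full_family = {}"
  by (auto simp: scroll_family_def full_family_def)

lemma ordered_scroll: "ordered_family 3 5 scroll_matrix scroll_exponent scroll_family"
  unfolding ordered_family_def nsupps_scroll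
proof (intro ballI impI)
  fix I J assume I: "I \<in> scroll_family" and "J \<in> {supp a b |a b. True}" and JI: "J \<subseteq> I"
  then obtain a b where J: "J = supp a b" by blast
  have "0 \<notin> supp a b" "2 \<notin> supp a b" using I JI by (auto simp: J scroll_family_def)
  then show "J \<in> scroll_family" unfolding J supp_in_family by (auto simp: supp_def split: if_splits)
qed

lemma ne_23_123: "{2, 3} \<noteq> {1, 2, 3::nat}"
proof
  assume "{2, 3} = {1, 2, 3::nat}"
  then have "1 \<in> {2, 3::nat}" by (rule ssubst) simp
  then show False by simp
qed

text \<open>
  The support \<open>{2, 3}\<close> lies below \<open>{1, 2, 3}\<close> and is attained at \<open>(0, -1)\<close>, of negative weight.
\<close>

lemma not_ordered_full: "\<not> ordered_family 3 5 scroll_matrix scroll_exponent full_family"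
proof
  assume o: "ordered_family 3 5 scroll_matrix scroll_exponent full_family"
  have "supp 0 (-1) = {2, 3}" by (auto simp: supp_def)
  then have "{2, 3} \<in> nsupps 3 5 scroll_matrix scroll_exponent" using supp_in_nsupps[of 0 "-1"] by simp
  moreover have "{1, 2, 3} \<in> full_family" "{2, 3} \<subseteq> {1, 2, 3::nat}" by (auto simp: full_family_def)
  ultimately have "{2, 3} \<in> full_family" using o unfolding ordered_family_def by blast
  then show False using ne_23_123 by (auto simp: full_family_def scroll_family_def doubleton_eq_iff)
qed

text \<open>
  With \<open>a < 0 \<le> b\<close> the entry at \<open>4\<close> is negative too, with \<open>b < 0 \<le> a\<close> the entry at \<open>3\<close>.  This is why the
  ideal \<open>P\<close> has only the two generators \<open>t\<^sub>0 t\<^sub>4\<close> and \<open>t\<^sub>2 t\<^sub>3\<close>; if \<open>a\<close> and \<open>b\<close> are both negative, one of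
  the two cases still applies.
\<close>

lemma outside_family_contains:
  assumes "J \<in> nsupps 3 5 scroll_matrix scroll_exponent - scroll_family"
  shows "{0, 4} \<subseteq> J \<or> {2, 3} \<subseteq> J"
proof -
  obtain a b where J: "J = supp a b" using assms unfolding nsupps_scroll by blast
  then have "\<not> (a \<ge> 0 \<and> b \<ge> 0)" using assms supp_in_family[of a b] by simp
  then have "a < 0 \<or> b < 0" by linarith
  then show ?thesis by (auto simp: J supp_def)
qed

lemma outside_family_examples:
  "{0, 4} \<in> nsupps 3 5 scroll_matrix scroll_exponent - full_family"
  "{2, 3} \<in> nsupps 3 5 scroll_matrix scroll_exponent - full_family"
proof -
  have s: "supp (-1) 0 = {0, 4}" "supp 0 (-1) = {2, 3}" by (auto simp: supp_def)
  then have "{0, 4} \<in> nsupps 3 5 scroll_matrix scroll_exponent" "{2, 3} \<in> nsupps 3 5 scroll_matrix scroll_exponent"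
    using supp_in_nsupps[of 0 "-1"] supp_in_nsupps[of "-1" 0] by simp_all
  moreover have "{0, 4} \<notin> full_family" "{2, 3} \<notin> full_family"
    using ne_23_123 by (auto simp: full_family_def scroll_family_def doubleton_eq_iff)
  ultimately show "{0, 4} \<in> nsupps 3 5 scroll_matrix scroll_exponent - full_family"
    "{2, 3} \<in> nsupps 3 5 scroll_matrix scroll_exponent - full_family" by auto
qed

section \<open>A generic direction\<close>

text \<open>
  Distinct powers of a transcendental number are independent over the integers, and a base larger than
  \<open>2\<close> makes each power dominate the sum of the lower ones that occur.
\<close>

lemma ex_scroll_weight:
  "\<exists>w. w \<in> topspace (Euclidean_space 5) \<and> scroll_weight w \<and>
     (\<forall>m :: nat \<Rightarrow> int. (\<Sum>j<5. w j * of_int (m j)) = 0 \<longrightarrow> (\<forall>j<5. m j = 0))"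
proof -
  obtain \<tau> where \<tau>: "\<tau> > 2" "int_independent_powers \<tau>" using ex_int_independent_powers by blast
  \<comment> \<open>Exponents chosen so that \<open>w\<^sub>0 + w\<^sub>4\<close> dominates and \<open>w\<^sub>2\<close> exceeds \<open>w\<^sub>1 + w\<^sub>4\<close>.\<close>
  define w :: "nat \<Rightarrow> real" where "w = list_vec [\<tau>^5, \<tau>, \<tau>^4, \<tau>^2, \<tau>^3]"
  have "m j = 0" if m: "(\<Sum>j<5. w j * of_int (m j)) = 0" "j < 5" for m :: "nat \<Rightarrow> int" and j
  proof -
    let ?c = "list_vec [0, m 1, m 3, m 4, m 2, m 0]"
    have "(\<Sum>i<6. of_int (?c i) * \<tau> ^ i) = (\<Sum>j<5. w j * of_int (m j))"
      by (simp add: w_def numeral_eq_Suc list_vec_def)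
    then have "?c i = 0" if "i < 6" for i
      using int_independent_powersD[OF \<tau>(2), of ?c 6 i] m that by simp
    from this[of 1] this[of 2] this[of 3] this[of 4] this[of 5] show ?thesis
      using less5_cases[OF m(2)] by (auto simp: list_vec_def numeral_eq_Suc)
  qed
  moreover have "w \<in> topspace (Euclidean_space 5)" by (simp add: topspace_Euclidean_space w_def)
  moreover have "scroll_weight w"
  proof -
    have p: "\<tau> ^ k * 2 < \<tau> ^ Suc k" for k using \<tau>(1) by simp
    have t: "\<tau> * 2 < \<tau>^2" "\<tau>^2 * 2 < \<tau>^3" "\<tau>^3 * 2 < \<tau>^4" "\<tau>^4 * 2 < \<tau>^5"
      using p[of 1] p[of 2] p[of 3] p[of 4] by (simp_all add: eval_nat_numeral)
    show ?thesis unfolding scroll_weight_def leading_weight_def w_def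
      using t \<tau>(1) by (simp add: list_vec_def)
  qed
  ultimately show ?thesis by blast
qed

section \<open>Coefficients of power series\<close>

lemmas mfps_nth_simps [simp] = zero_mfps.rep_eq one_mfps.rep_eq plus_mfps.rep_eq minus_mfps.rep_eq uminus_mfps.rep_eq

lemma mfps_nth_Abs [simp]: "mfps_nth (Abs_mfps f) = f"
  by (simp add: Abs_mfps_inverse)

lemma mfps_nth_sum: "mfps_nth (sum f A) m = (\<Sum>x\<in>A. mfps_nth (f x :: 'a::comm_ring_1 mfps) m)"
  by (induction A rule: infinite_finite_induct) auto

lemma var_exp_eq: "Poly_Mapping.single i (Suc 0) = Poly_Mapping.single j (Suc 0) \<longleftrightarrow> i = j"
  "Poly_Mapping.single i (Suc 0) \<noteq> 0" "0 \<noteq> Poly_Mapping.single i (Suc 0)"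
  by (metis lookup_single_eq lookup_single_not_eq lookup_zero zero_neq_one One_nat_def)+

lemma mfps_nth_var: "mfps_nth (mfps_var j) m = (if m = var_exp j then 1 else 0)"
  by (simp add: mfps_var_def)

lemma mfps_nth_mult: "mfps_nth (f * g) m = (\<Sum>(a, b) | a + b = m. mfps_nth f a * mfps_nth g b)"
  by (simp add: times_mfps.rep_eq)

lemma mfps_nth_var_mult:
  "mfps_nth (mfps_var j * f) m = (if lookup m j > 0 then mfps_nth (f :: 'a::comm_ring_1 mfps) (m - var_exp j) else 0)"
proof -
  have eq: "a + b = m \<and> a = var_exp j \<longleftrightarrow> lookup m j > 0 \<and> a = var_exp j \<and> b = m - var_exp j" for a b
  proof
    assume "a + b = m \<and> a = var_exp j"
    then show "lookup m j > 0 \<and> a = var_exp j \<and> b = m - var_exp j" by (auto simp: lookup_add)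
  next
    assume *: "lookup m j > 0 \<and> a = var_exp j \<and> b = m - var_exp j"
    then have "var_exp j + (m - var_exp j) = m"
      by (intro exps_eqI) (auto simp: lookup_add lookup_minus lookup_single when_def)
    with * show "a + b = m \<and> a = var_exp j" by simp
  qed
  have "mfps_nth (mfps_var j * f) m = (\<Sum>p\<in>{(a, b). a + b = m}. if fst p = var_exp j then mfps_nth f (snd p) else 0)"
    unfolding mfps_nth_mult by (rule sum.cong) (auto simp: mfps_nth_var)
  also have "\<dots> = (\<Sum>p\<in>{p \<in> {(a, b). a + b = m}. fst p = var_exp j}. mfps_nth f (snd p))"
    by (rule sum.inter_filter[symmetric]) (rule finite_exp_splits)
  also have "{p \<in> {(a, b). a + b = m}. fst p = var_exp j} = (if lookup m j > 0 then {(var_exp j, m - var_exp j)} else {})"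
    using eq by (auto simp del: One_nat_def)
  finally show ?thesis by (simp del: One_nat_def)
qed

lemma mfps_const_mult: "mfps_nth (mfps_const c * f) m = c * mfps_nth (f :: 'a::comm_ring_1 mfps) m"
proof -
  have "mfps_nth (mfps_const c * f) m = (\<Sum>p\<in>{(a, b). a + b = m}. if p = (0, m) then c * mfps_nth f m else 0)"
    unfolding mfps_nth_mult by (rule sum.cong) (auto simp: mfps_const_def split: if_splits)
  also have "\<dots> = c * mfps_nth f m"
    using finite_exp_splits[of m] by (simp add: sum.delta)
  finally show ?thesis .
qed

lemma mfps_of_int: "of_int z = (mfps_const (of_int z) :: 'a::comm_ring_1 mfps)"
proof -
  have n: "of_nat k = (mfps_const (of_nat k) :: 'a mfps)" for k
    by (induction k) (auto intro!: mfps_eqI simp: mfps_const_def)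
  show ?thesis by (cases z rule: int_cases2) (auto simp: n intro!: mfps_eqI simp: mfps_const_def)
qed

lemma mfps_nth_of_int_mult: "mfps_nth (of_int z * f) m = of_int z * mfps_nth (f :: 'a::comm_ring_1 mfps) m"
  by (simp add: mfps_of_int mfps_const_mult)

lemma series_closed:
  "f \<in> series n \<Longrightarrow> g \<in> series n \<Longrightarrow> f + g \<in> (series n :: 'a::comm_ring_1 mfps set)"
  "f \<in> series n \<Longrightarrow> g \<in> series n \<Longrightarrow> f - g \<in> (series n :: 'a::comm_ring_1 mfps set)"
  "f \<in> series n \<Longrightarrow> g \<in> series n \<Longrightarrow> f * g \<in> (series n :: 'a::comm_ring_1 mfps set)"
  "0 \<in> (series n :: 'a::comm_ring_1 mfps set)" "1 \<in> (series n :: 'a::comm_ring_1 mfps set)"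
  "j < n \<Longrightarrow> mfps_var j \<in> (series n :: 'a::comm_ring_1 mfps set)"
  "mfps_const c \<in> (series n :: 'a::comm_ring_1 mfps set)"
proof -
  assume fg: "f \<in> series n" "g \<in> series n"
  have nz: "mfps_nth f m \<noteq> 0 \<or> mfps_nth g m \<noteq> 0" if "mfps_nth (f + g) m \<noteq> 0 \<or> mfps_nth (f - g) m \<noteq> 0" for m
    using that by auto
  show "f + g \<in> series n" using fg nz unfolding series_def by blast
  show "f - g \<in> series n" using fg nz unfolding series_def by blast
  show "f * g \<in> series n" unfolding series_def
  proof (rule CollectI, intro allI impI)
    fix m assume "mfps_nth (f * g) m \<noteq> 0"
    then obtain p where "p \<in> {(a, b). a + b = m}" "mfps_nth f (fst p) * mfps_nth g (snd p) \<noteq> 0"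
      unfolding mfps_nth_mult case_prod_beta by (metis (mono_tags, lifting) sum.not_neutral_contains_not_neutral)
    then have "mfps_nth f (fst p) \<noteq> 0" "mfps_nth g (snd p) \<noteq> 0" "m = fst p + snd p"
      by (auto simp: case_prod_beta)
    then have "fst p \<in> exps_of n" "snd p \<in> exps_of n" "m = fst p + snd p" using fg by (auto simp: series_def)
    then show "m \<in> exps_of n" by auto
  qed
qed (auto simp: series_def mfps_nth_var mfps_const_def split: if_splits simp del: One_nat_def)

lemma series_of_int: "of_int z \<in> (series n :: 'a::comm_ring_1 mfps set)"
  by (simp add: mfps_of_int series_closed)

lemma series_sum: "(\<And>x. x \<in> A \<Longrightarrow> f x \<in> series n) \<Longrightarrow> sum f A \<in> (series n :: 'a::comm_ring_1 mfps set)"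
  by (induction A rule: infinite_finite_induct) (auto intro: series_closed)

lemma series_t_prod: "J \<subseteq> {..<n} \<Longrightarrow> t_prod J \<in> series n"
  unfolding t_prod_def by (induction J rule: infinite_finite_induct) (auto intro: series_closed)

lemma is_left_ideal_series: "is_left_ideal (*) (series n) (ideal_gen (series n) (S :: 'a::comm_ring_1 mfps set))"
  by (rule is_left_ideal_gen) (auto simp: algebra_simps intro: series_closed)

lemma ideal_incl_series: "s \<in> S \<Longrightarrow> s \<in> ideal_gen (series n) (S :: 'a::comm_ring_1 mfps set)"
  using left_ideal_gen_incl[where mul = "(*)" and a = 1 and R = "series n" and s = s and S = S] series_closed(5)
  by fastforce

lemma ideal_gen_series_closed: "S \<subseteq> series n \<Longrightarrow> ideal_gen (series n) (S :: 'a::comm_ring_1 mfps set) \<subseteq> series n"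
  by (rule left_ideal_gen_subset) (auto simp: is_left_ideal_def intro: series_closed)

lemma ideal_gen_eqI:
  assumes "S \<subseteq> ideal_gen (series n) T" "T \<subseteq> ideal_gen (series n) (S :: 'a::comm_ring_1 mfps set)"
  shows "ideal_gen (series n) S = ideal_gen (series n) T"
  using left_ideal_gen_subset[OF is_left_ideal_series assms(1)] left_ideal_gen_subset[OF is_left_ideal_series assms(2)] by blast

lemma ideal_closed:
  assumes "is_left_ideal (*) (series n) (I :: 'a::comm_ring_1 mfps set)"
  shows "f \<in> I \<Longrightarrow> g \<in> I \<Longrightarrow> f + g \<in> I" "a \<in> series n \<Longrightarrow> f \<in> I \<Longrightarrow> a * f \<in> I"
    "f \<in> I \<Longrightarrow> g \<in> I \<Longrightarrow> f - g \<in> I" "0 \<in> I"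
proof -
  show m: "a \<in> series n \<Longrightarrow> f \<in> I \<Longrightarrow> a * f \<in> I" for a f using assms by (simp add: is_left_ideal_def)
  show a: "f \<in> I \<Longrightarrow> g \<in> I \<Longrightarrow> f + g \<in> I" for f g using assms by (simp add: is_left_ideal_def)
  show "0 \<in> I" using assms by (simp add: is_left_ideal_def)
  assume "f \<in> I" "g \<in> I"
  have "0 - 1 \<in> (series n :: 'a mfps set)" by (intro series_closed)
  from a[OF \<open>f \<in> I\<close> m[OF this \<open>g \<in> I\<close>]] show "f - g \<in> I" by simp
qed

text \<open>
  Each monomial other than \<open>1\<close> is assigned to its first variable.
\<close>

lemma series_split:
  assumes f: "f \<in> series n" and f0: "mfps_nth f 0 = 0"
  obtains g where "\<And>j. j < n \<Longrightarrow> g j \<in> (series n :: 'a::comm_ring_1 mfps set)" "f = (\<Sum>j<n. mfps_var j * g j)"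
proof -
  \<comment> \<open>The first variable that divides \<open>m\<close>.\<close>
  define lst where "lst m = (LEAST j. lookup m j > 0)" for m :: exps
  define g where "g j = Abs_mfps (\<lambda>m. if lst (m + var_exp j) = j then mfps_nth f (m + var_exp j) else 0)" for j
  have gs: "g j \<in> series n" if "j < n" for j
    using f unfolding series_def g_def
    by (auto simp: exps_of_lookup lookup_add split: if_splits simp del: One_nat_def)
  have "f = (\<Sum>j<n. mfps_var j * g j)"
  proof (rule mfps_eqI)
    fix m
    have "mfps_nth (\<Sum>j<n. mfps_var j * g j) m = (\<Sum>j<n. if lookup m j > 0 \<and> lst m = j then mfps_nth f m else 0)"
      unfolding mfps_nth_sum
    proof (rule sum.cong[OF refl])
      fix j
      have "m - var_exp j + var_exp j = m" if "lookup m j > 0"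
        using that by (intro exps_eqI) (auto simp: lookup_add lookup_minus lookup_single when_def)
      then show "mfps_nth (mfps_var j * g j) m = (if lookup m j > 0 \<and> lst m = j then mfps_nth f m else 0)"
        by (simp add: mfps_nth_var_mult g_def del: One_nat_def)
    qed
    also have "\<dots> = mfps_nth f m"
    proof (cases "mfps_nth f m = 0")
      case False
      then have "m \<noteq> 0" "m \<in> exps_of n" using f0 f by (auto simp: series_def)
      then obtain i where "lookup m i > 0" by (metis gr0I lookup_zero poly_mapping_eqI)
      then have "lookup m (lst m) > 0" unfolding lst_def by (rule LeastI)
      moreover have "lst m < n" using \<open>m \<in> exps_of n\<close> calculation by (metis exps_of_lookup not_le neq0_conv)
      ultimately show ?thesis by (subst sum.cong[OF refl, of _ _ "\<lambda>j. if j = lst m then mfps_nth f m else 0"]) auto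
    qed simp
    finally show "mfps_nth f m = mfps_nth (\<Sum>j<n. mfps_var j * g j) m" by simp
  qed
  with gs that show thesis by blast
qed

section \<open>Substituting the Gale forms\<close>

lemma mfps_nth_gale_mult:
  "mfps_nth (gale_form r B j * f) k = (\<Sum>i<r. if lookup k i > 0 then of_int (B j i) * mfps_nth f (k - var_exp i) else 0)"
proof -
  have "mfps_nth (gale_form r B j * f) k = (\<Sum>i<r. mfps_nth (of_int (B j i) * (mfps_var i * f)) k)"
    by (simp add: gale_form_def sum_distrib_right mfps_nth_sum mult.assoc)
  also have "\<dots> = (\<Sum>i<r. if lookup k i > 0 then of_int (B j i) * mfps_nth f (k - var_exp i) else 0)"
    by (rule sum.cong) (auto simp: mfps_nth_of_int_mult mfps_nth_var_mult simp del: One_nat_def)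
  finally show ?thesis .
qed

lemma finite_exps_degree: "finite {m \<in> exps_of n. exp_degree m = d}"
proof -
  have "inj_on (\<lambda>m. (m, 0::exps, 0::nat)) {m \<in> exps_of n. exp_degree m = d}" by (auto simp: inj_on_def)
  moreover have "(\<lambda>m. (m, 0, 0)) ` {m \<in> exps_of n. exp_degree m = d} \<subseteq> {\<mu> \<in> hkeys n. hdeg \<mu> \<le> d}"
    by (auto simp: hkeys_def hdeg_def)
  ultimately show ?thesis using finite_hkeys_hdeg[of n d] by (meson finite_imageD finite_subset)
qed

lemma Phi_nth: "mfps_nth (Phi n r B f) k = (\<Sum>m \<in> {m \<in> exps_of n. exp_degree m = exp_degree k}.
       mfps_nth f m * mfps_nth (\<Prod>j<n. gale_form r B j ^ lookup m j) k)"
  by (simp add: Phi_def)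

lemma Phi_add: "Phi n r B (f + g) = Phi n r B f + Phi n r B g"
  by (rule mfps_eqI) (simp add: Phi_nth distrib_right sum.distrib)

lemma Phi_zero [simp]: "Phi n r B 0 = 0"
  by (rule mfps_eqI) (simp add: Phi_nth)

lemma Phi_sum: "Phi n r B (sum f A) = (\<Sum>x\<in>A. Phi n r B (f x))"
  by (induction A rule: infinite_finite_induct) (auto simp: Phi_add)

lemma Phi_of_int: "Phi n r B (of_int z * f) = of_int z * Phi n r B f"
  by (rule mfps_eqI) (simp add: Phi_nth mfps_nth_of_int_mult sum_distrib_left mult.assoc)

lemma exp_degree_minus_var: "lookup m j > 0 \<Longrightarrow> exp_degree m = Suc (exp_degree (m - var_exp j))"
proof -
  assume "lookup m j > 0"
  then have "m = (m - var_exp j) + var_exp j"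
    by (intro exps_eqI) (auto simp: lookup_add lookup_minus lookup_single when_def)
  then have "exp_degree m = exp_degree (m - var_exp j) + exp_degree (var_exp j)" by (metis exp_degree_add)
  then show ?thesis by (simp del: One_nat_def)
qed

text \<open>
  This, additivity and the value at \<open>1\<close> are all that is used of the substitution.  It suffices since every
  product below has a variable or a linear form as one factor.
\<close>

lemma Phi_var_mult:
  assumes j: "j < n" shows "Phi n r B (mfps_var j * f) = gale_form r B j * Phi n r B f"
proof (rule mfps_eqI)
  fix k
  let ?G = "\<lambda>m. \<Prod>j<n. gale_form r B j ^ lookup m j"
  let ?E = "\<lambda>d. {m \<in> exps_of n. exp_degree m = d}"
  have G: "?G (m + var_exp j) = gale_form r B j * ?G m" for m
  proof -
    have "?G (m + var_exp j) = (\<Prod>i<n. gale_form r B i ^ lookup m i * (if i = j then gale_form r B j else 1))"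
      by (rule prod.cong) (auto simp: lookup_add lookup_single when_def)
    then show ?thesis using j by (simp add: prod.distrib prod.delta mult.commute)
  qed
  have "mfps_nth (Phi n r B (mfps_var j * f)) k
      = (\<Sum>m\<in>?E (exp_degree k). if lookup m j > 0 then mfps_nth f (m - var_exp j) * mfps_nth (?G m) k else 0)"
    unfolding Phi_nth by (rule sum.cong) (auto simp: mfps_nth_var_mult simp del: One_nat_def)
  also have "\<dots> = (\<Sum>m\<in>{m \<in> ?E (exp_degree k). lookup m j > 0}. mfps_nth f (m - var_exp j) * mfps_nth (?G m) k)"
    by (rule sum.inter_filter[symmetric]) (rule finite_exps_degree)
  also have "\<dots> = (\<Sum>m\<in>{m \<in> exps_of n. Suc (exp_degree m) = exp_degree k}. mfps_nth f m * mfps_nth (gale_form r B j * ?G m) k)"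
  proof (rule sum.reindex_bij_witness[where i = "\<lambda>m. m + var_exp j" and j = "\<lambda>m. m - var_exp j"])
    fix m assume m: "m \<in> {m \<in> ?E (exp_degree k). lookup m j > 0}"
    then show eq: "m - var_exp j + var_exp j = m"
      by (intro exps_eqI) (auto simp: lookup_add lookup_minus lookup_single when_def)
    show "m - var_exp j \<in> {m \<in> exps_of n. Suc (exp_degree m) = exp_degree k}"
      using m exp_degree_minus_var[of m j] by (auto intro: exps_of_minus)
    show "mfps_nth f (m - var_exp j) * mfps_nth (gale_form r B j * ?G (m - var_exp j)) k = mfps_nth f (m - var_exp j) * mfps_nth (?G m) k"
      unfolding G[symmetric] eq ..
  next
    fix m assume m: "m \<in> {m \<in> exps_of n. Suc (exp_degree m) = exp_degree k}"
    show "m + var_exp j - var_exp j = m" by simp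
    show "m + var_exp j \<in> {m \<in> ?E (exp_degree k). lookup m j > 0}"
      using m j by (auto simp: exp_degree_add lookup_add simp del: One_nat_def)
  qed
  also have "\<dots> = (\<Sum>m\<in>{m \<in> exps_of n. Suc (exp_degree m) = exp_degree k}. \<Sum>i<r.
      if lookup k i > 0 then of_int (B j i) * (mfps_nth f m * mfps_nth (?G m) (k - var_exp i)) else 0)"
    unfolding mfps_nth_gale_mult sum_distrib_left
    by (intro sum.cong refl) (auto simp: mult.left_commute)
  also have "\<dots> = (\<Sum>i<r. \<Sum>m\<in>{m \<in> exps_of n. Suc (exp_degree m) = exp_degree k}.
      if lookup k i > 0 then of_int (B j i) * (mfps_nth f m * mfps_nth (?G m) (k - var_exp i)) else 0)"
    by (rule sum.swap)
  also have "\<dots> = (\<Sum>i<r. if lookup k i > 0 then of_int (B j i) * mfps_nth (Phi n r B f) (k - var_exp i) else 0)"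
  proof (rule sum.cong[OF refl])
    fix i
    show "(\<Sum>m\<in>{m \<in> exps_of n. Suc (exp_degree m) = exp_degree k}.
      if lookup k i > 0 then of_int (B j i) * (mfps_nth f m * mfps_nth (?G m) (k - var_exp i)) else 0)
      = (if lookup k i > 0 then of_int (B j i) * mfps_nth (Phi n r B f) (k - var_exp i) else 0)"
      by (simp add: Phi_nth sum_distrib_left exp_degree_minus_var del: One_nat_def)
  qed
  also have "\<dots> = mfps_nth (gale_form r B j * Phi n r B f) k"
    by (rule mfps_nth_gale_mult[symmetric])
  finally show "mfps_nth (Phi n r B (mfps_var j * f)) k = mfps_nth (gale_form r B j * Phi n r B f) k" .
qed

lemma Phi_const_coeff: "mfps_nth (Phi n r B f) 0 = mfps_nth f 0"
proof -
  have "{m \<in> exps_of n. exp_degree m = exp_degree 0} = {0}"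
    by (auto simp: exp_degree_def in_keys_iff intro!: poly_mapping_eqI)
  then show ?thesis by (simp add: Phi_nth)
qed

lemma Phi_one: "Phi n r B 1 = 1"
proof (rule mfps_eqI)
  fix k
  show "mfps_nth (Phi n r B 1) k = mfps_nth 1 k"
  proof (cases "k = 0")
    case False
    have "exp_degree k \<noteq> 0"
    proof
      assume "exp_degree k = 0"
      then have "k = 0" by (auto simp: exp_degree_def in_keys_iff intro!: poly_mapping_eqI)
      with False show False by simp
    qed
    then show ?thesis using False by (auto simp: Phi_nth intro!: sum.neutral)
  qed (simp add: Phi_const_coeff)
qed

lemma Phi_var: "j < n \<Longrightarrow> Phi n r B (mfps_var j) = gale_form r B j"
  using Phi_var_mult[of j n r B 1] by (simp add: Phi_one)

lemma series_gale_form: "gale_form r B j \<in> series r"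
  unfolding gale_form_def by (intro series_sum series_closed series_of_int) auto

lemma Phi_closed: "Phi n r B f \<in> series r"
  unfolding series_def
proof (rule CollectI, intro allI impI)
  fix k assume "mfps_nth (Phi n r B f) k \<noteq> 0"
  then obtain m where "mfps_nth f m * mfps_nth (\<Prod>j<n. gale_form r B j ^ lookup m j) k \<noteq> 0"
    unfolding Phi_nth by (metis (mono_tags, lifting) sum.not_neutral_contains_not_neutral)
  moreover have "gale_form r B j ^ e \<in> series r" for j e
    by (induction e) (auto intro: series_closed series_gale_form)
  then have "(\<Prod>j<n. gale_form r B j ^ lookup m j) \<in> series r"
    by (induction n) (auto intro: series_closed)
  ultimately show "k \<in> exps_of r" unfolding series_def by auto
qed

section \<open>Obstruction module and strict inclusion\<close>

abbreviation t :: "nat \<Rightarrow> complex mfps" where "t \<equiv> mfps_var"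
abbreviation R5 :: "complex mfps set" where "R5 \<equiv> series 5"

lemma t_R5: "t 0 \<in> R5" "t 1 \<in> R5" "t 2 \<in> R5" "t 3 \<in> R5" "t 4 \<in> R5"
  by (simp_all add: series_closed)

lemma t_prod_split: "finite I \<Longrightarrow> K \<subseteq> I \<Longrightarrow> t_prod I = t_prod (I - K) * t_prod K"
  unfolding t_prod_def by (rule prod.subset_diff) auto

lemma t_prod_in_ideal:
  assumes "I \<subseteq> {..<5}" "K \<subseteq> I" "t_prod K \<in> S"
  shows "t_prod I \<in> ideal_gen R5 S"
proof -
  have "finite I" using assms(1) finite_subset by blast
  then have "t_prod I = t_prod (I - K) * t_prod K" using t_prod_split assms(2) by blast
  moreover have "t_prod (I - K) \<in> R5" using assms(1) by (intro series_t_prod) auto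
  ultimately show ?thesis using left_ideal_gen_incl[where mul = "(*)", OF _ assms(3)] by metis
qed

lemma t_prod_small: "t_prod {3} = t 3" "t_prod {4} = t 4" "t_prod {0, 4} = t 0 * t 4" "t_prod {2, 3} = t 2 * t 3"
  by (simp_all add: t_prod_def)

lemma supp_subset: "supp a b \<subseteq> {..<5}" by (auto simp: supp_def)

lemma family_subset: "I \<in> full_family \<Longrightarrow> I \<subseteq> {..<5}" "I \<in> scroll_family \<Longrightarrow> I \<in> full_family"
  by (auto simp: full_family_def scroll_family_def)

definition M5 :: "complex mfps set" where "M5 = ideal_gen R5 {t 3, t 4}"
definition P5 :: "complex mfps set" where "P5 = ideal_gen R5 {t 0 * t 4, t 2 * t 3}"

lemma e_monomial_families:
  "e_monomial 5 scroll_exponent scroll_family = t 4" "e_monomial 5 scroll_exponent full_family = t 4"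
  by (simp_all add: e_monomial_def nsupp_scroll_exponent Inter_families t_prod_small)

text \<open>
  The two families give the same ideal since the additional support \<open>{1, 2, 3}\<close> contains \<open>{3}\<close>.
\<close>

lemma M_ideal_families:
  assumes "\<N> = scroll_family \<or> \<N> = full_family" shows "M_ideal 5 \<N> = M5"
proof -
  have I0: "\<Inter>\<N> = {}" using assms Inter_families by auto
  have sub: "\<N> \<subseteq> full_family" "scroll_family \<subseteq> \<N>" using assms by (auto simp: full_family_def)
  show ?thesis unfolding M_ideal_def M5_def I0 Diff_empty
  proof (rule ideal_gen_eqI)
    show "t_prod ` \<N> \<subseteq> ideal_gen R5 {t 3, t 4}"
    proof (rule image_subsetI)
      fix I assume I: "I \<in> \<N>"
      then have "{3} \<subseteq> I \<or> {4} \<subseteq> I" using sub(1) by (auto simp: full_family_def scroll_family_def)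
      moreover have "I \<subseteq> {..<5}" using family_subset(1) I sub(1) by blast
      ultimately show "t_prod I \<in> ideal_gen R5 {t 3, t 4}"
        using t_prod_in_ideal[of I "{3}" "{t 3, t 4}"] t_prod_in_ideal[of I "{4}" "{t 3, t 4}"] unfolding t_prod_small by blast
    qed
    have "t_prod {3} \<in> t_prod ` \<N>" "t_prod {4} \<in> t_prod ` \<N>" using sub(2) by (auto simp: scroll_family_def)
    then show "{t 3, t 4} \<subseteq> ideal_gen R5 (t_prod ` \<N>)" by (auto simp: t_prod_small intro: ideal_incl_series)
  qed
qed

text \<open>
  Supports outside the family contain \<open>{0, 4}\<close> or \<open>{2, 3}\<close>, and these two are attained; adding
  \<open>{1, 2, 3}\<close> to the family removes no minimal generator.
\<close>

lemma P_ideal_families: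
  assumes "\<N> = scroll_family \<or> \<N> = full_family" shows "P_ideal 3 5 scroll_matrix scroll_exponent \<N> = P5"
proof -
  have I0: "\<Inter>\<N> = {}" using assms Inter_families by auto
  have sub: "\<N> \<subseteq> full_family" "scroll_family \<subseteq> \<N>" using assms by (auto simp: full_family_def)
  let ?S = "{t_prod (I \<union> J - \<Inter>\<N>) |I J. I \<in> \<N> \<and> J \<in> nsupps 3 5 scroll_matrix scroll_exponent - \<N>}"
  show ?thesis unfolding P_ideal_def P5_def
  proof (rule ideal_gen_eqI)
    show "?S \<subseteq> ideal_gen R5 {t 0 * t 4, t 2 * t 3}"
    proof
      fix f assume "f \<in> ?S"
      then obtain I J where IJ: "f = t_prod (I \<union> J)" "I \<in> \<N>" "J \<in> nsupps 3 5 scroll_matrix scroll_exponent - \<N>"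
        unfolding I0 by auto
      have "J \<subseteq> {..<5}" using IJ(3) supp_subset unfolding nsupps_scroll by blast
      then have IJ5: "I \<union> J \<subseteq> {..<5}" using family_subset(1) IJ(2) sub(1) by blast
      have "{0, 4} \<subseteq> J \<or> {2, 3} \<subseteq> J" using outside_family_contains IJ(3) sub(2) by blast
      then show "f \<in> ideal_gen R5 {t 0 * t 4, t 2 * t 3}"
      proof
        assume "{0, 4} \<subseteq> J"
        then show ?thesis unfolding IJ(1) by (intro t_prod_in_ideal[OF IJ5, of "{0, 4}"]) (auto simp: t_prod_small)
      next
        assume "{2, 3} \<subseteq> J"
        then show ?thesis unfolding IJ(1) by (intro t_prod_in_ideal[OF IJ5, of "{2, 3}"]) (auto simp: t_prod_small)
      qed
    qed
    have "{4} \<in> \<N>" "{3} \<in> \<N>" using sub(2) by (auto simp: scroll_family_def)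
    then have "t_prod ({4} \<union> {0, 4} - \<Inter>\<N>) \<in> ?S" "t_prod ({3} \<union> {2, 3} - \<Inter>\<N>) \<in> ?S"
      using outside_family_examples sub(1) by blast+
    moreover have "{4} \<union> {0, 4} - \<Inter>\<N> = {0, 4}" "{3} \<union> {2, 3} - \<Inter>\<N> = {2, 3}" by (auto simp: I0)
    ultimately show "{t 0 * t 4, t 2 * t 3} \<subseteq> ideal_gen R5 ?S"
      by (auto simp: t_prod_small intro: ideal_incl_series)
  qed
qed

definition row_form :: "nat \<Rightarrow> complex mfps" where "row_form i = (\<Sum>j<5. of_int (scroll_matrix i j) * t j)"

lemma row_form_simps: "row_form 0 = t 0 + t 1 + t 2 + t 3 + t 4" "row_form 1 = t 1 + 2 * t 2 + t 4" "row_form 2 = t 3 + t 4"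
  by (simp_all add: row_form_def sum_less5)

definition U5 :: "complex mfps set" where "U5 = ideal_gen R5 (row_form ` {..<3})"

lemma U_ideal_scroll: "U_ideal 3 5 scroll_matrix = U5"
  by (simp add: U_ideal_def U5_def row_form_def)

definition Q5 :: "complex mfps set" where "Q5 = ideal_sum (ideal_mult R5 U5 M5) P5"

lemma Q_ideal_families:
  assumes "\<N> = scroll_family \<or> \<N> = full_family" shows "Q_ideal 3 5 scroll_matrix scroll_exponent \<N> = Q5"
  by (simp add: Q_ideal_def Q5_def U_ideal_scroll M_ideal_families[OF assms] P_ideal_families[OF assms])

lemma is_left_ideal_sum:
  assumes "is_left_ideal (*) (series n) I" "is_left_ideal (*) (series n) (J :: 'a::comm_ring_1 mfps set)"
  shows "is_left_ideal (*) (series n) (ideal_sum I J)"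
  unfolding is_left_ideal_def
proof (intro conjI ballI)
  show "0 \<in> ideal_sum I J" unfolding ideal_sum_def using ideal_closed(4)[OF assms(1)] ideal_closed(4)[OF assms(2)] by force
  fix f assume "f \<in> ideal_sum I J"
  then obtain f1 f2 where f: "f = f1 + f2" "f1 \<in> I" "f2 \<in> J" by (auto simp: ideal_sum_def)
  { fix g assume "g \<in> ideal_sum I J"
    then obtain g1 g2 where g: "g = g1 + g2" "g1 \<in> I" "g2 \<in> J" by (auto simp: ideal_sum_def)
    have "f + g = (f1 + g1) + (f2 + g2)" by (simp add: f g)
    then show "f + g \<in> ideal_sum I J" unfolding ideal_sum_def
      using ideal_closed(1)[OF assms(1) f(2) g(2)] ideal_closed(1)[OF assms(2) f(3) g(3)] by blast }
  { fix a assume a: "a \<in> (series n :: 'a mfps set)"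
    have "a * f = a * f1 + a * f2" by (simp add: f distrib_left)
    then show "a * f \<in> ideal_sum I J" unfolding ideal_sum_def
      using ideal_closed(2)[OF assms(1) a f(2)] ideal_closed(2)[OF assms(2) a f(3)] by blast }
qed

lemma ideals5: "is_left_ideal (*) R5 U5" "is_left_ideal (*) R5 M5" "is_left_ideal (*) R5 P5" "is_left_ideal (*) R5 Q5"
  "is_left_ideal (*) R5 (ideal_sum U5 P5)"
  unfolding U5_def M5_def P5_def Q5_def ideal_mult_def
  by (intro is_left_ideal_sum is_left_ideal_series)+

lemma ideal_sum_left: "is_left_ideal (*) (series n) J \<Longrightarrow> f \<in> I \<Longrightarrow> f \<in> ideal_sum I (J :: 'a::comm_ring_1 mfps set)"
  and ideal_sum_right: "is_left_ideal (*) (series n) I \<Longrightarrow> g \<in> J \<Longrightarrow> g \<in> ideal_sum I (J :: 'a::comm_ring_1 mfps set)"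
  unfolding ideal_sum_def by (metis (mono_tags, lifting) add.right_neutral add.left_neutral ideal_closed(4) mem_Collect_eq)+

lemma Q5_gens:
  "i < 3 \<Longrightarrow> row_form i * t 3 \<in> Q5" "i < 3 \<Longrightarrow> row_form i * t 4 \<in> Q5" "t 0 * t 4 \<in> Q5" "t 2 * t 3 \<in> Q5"
proof -
  have P: "is_left_ideal (*) R5 P5" and UM: "is_left_ideal (*) R5 (ideal_mult R5 U5 M5)"
    unfolding P5_def ideal_mult_def by (rule is_left_ideal_series)+
  { assume i: "i < 3"
    have r: "row_form i \<in> U5" unfolding U5_def by (rule ideal_incl_series) (use i in auto)
    have m: "t 3 \<in> M5" "t 4 \<in> M5" unfolding M5_def by (auto intro: ideal_incl_series)
    have "row_form i * t 3 \<in> ideal_mult R5 U5 M5" "row_form i * t 4 \<in> ideal_mult R5 U5 M5"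
      unfolding ideal_mult_def using r m by (auto intro!: ideal_incl_series)
    then show "row_form i * t 3 \<in> Q5" "row_form i * t 4 \<in> Q5" unfolding Q5_def using ideal_sum_left[OF P] by blast+ }
  have "t 0 * t 4 \<in> P5" "t 2 * t 3 \<in> P5" unfolding P5_def by (auto intro: ideal_incl_series)
  then show "t 0 * t 4 \<in> Q5" "t 2 * t 3 \<in> Q5" unfolding Q5_def using ideal_sum_right[OF UM] by blast+
qed

lemma Q5_closed: "f \<in> Q5 \<Longrightarrow> g \<in> Q5 \<Longrightarrow> f + g \<in> Q5" "a \<in> R5 \<Longrightarrow> f \<in> Q5 \<Longrightarrow> a * f \<in> Q5"
    "f \<in> Q5 \<Longrightarrow> g \<in> Q5 \<Longrightarrow> f - g \<in> Q5" "0 \<in> Q5"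
  by (rule ideal_closed[OF ideals5(4)]; assumption)+

text \<open>
  The linear part of a series, paired with the vector \<open>rel_vec 0 1\<close> of relations.  It vanishes on the
  rows of the matrix and is the single condition that distinguishes the two colon ideals.
\<close>

definition dual4 :: "complex mfps \<Rightarrow> complex" where
  "dual4 f = mfps_nth f (var_exp 2) + mfps_nth f (var_exp 3) - mfps_nth f (var_exp 1) - mfps_nth f (var_exp 4)"

text \<open>
  The same with \<open>rel_vec 1 0\<close>; it is the companion of the other functional for multiples of \<open>t\<^sub>3\<close>.
\<close>

definition dual3 :: "complex mfps \<Rightarrow> complex" where
  "dual3 f = mfps_nth f (var_exp 0) + mfps_nth f (var_exp 4) - mfps_nth f (var_exp 1) - mfps_nth f (var_exp 3)"

text \<open>
  Modulo \<open>U M + P\<close>, the products of \<open>t\<^sub>4\<close> with variables are multiples of the one class \<open>t\<^sub>2 t\<^sub>4\<close>, with the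
  entries of \<open>rel_vec 0 1\<close> as factors: \<open>P\<close> removes \<open>t\<^sub>0 t\<^sub>4\<close>, and each row of the matrix times \<open>t\<^sub>4\<close> gives a
  linear equation.
\<close>

lemma t4_mult_mod_Q:
  "t 0 * t 4 \<in> Q5" "t 1 * t 4 + t 2 * t 4 \<in> Q5" "t 3 * t 4 - t 2 * t 4 \<in> Q5" "t 4 * t 4 + t 2 * t 4 \<in> Q5"
proof -
  note r = Q5_gens(2)[of 0, unfolded row_form_simps] Q5_gens(2)[of 1, unfolded row_form_simps] Q5_gens(2)[of 2, unfolded row_form_simps]
  show q0: "t 0 * t 4 \<in> Q5" by (rule Q5_gens)
  have "t 1 * t 4 + t 2 * t 4 = (t 0 + t 1 + t 2 + t 3 + t 4) * t 4 - (t 3 + t 4) * t 4 - t 0 * t 4"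
    by (simp add: algebra_simps)
  then show q1: "t 1 * t 4 + t 2 * t 4 \<in> Q5" using Q5_closed(3)[OF Q5_closed(3)[OF r(1) r(3)] q0] by (simp only:)
  have "t 4 * t 4 + t 2 * t 4 = (t 1 + 2 * t 2 + t 4) * t 4 - (t 1 * t 4 + t 2 * t 4)"
    by (simp add: algebra_simps)
  then show q4: "t 4 * t 4 + t 2 * t 4 \<in> Q5" using Q5_closed(3)[OF r(2) q1] by (simp only:)
  have "t 3 * t 4 - t 2 * t 4 = (t 3 + t 4) * t 4 - (t 4 * t 4 + t 2 * t 4)"
    by (simp add: algebra_simps)
  then show "t 3 * t 4 - t 2 * t 4 \<in> Q5" using Q5_closed(3)[OF r(3) q4] by (simp only:)
qed

text \<open>
  The class of \<open>t\<^sub>2 t\<^sub>4\<close> is also that of \<open>t\<^sub>0 t\<^sub>3\<close>, and \<open>t\<^sub>2 t\<^sub>3\<close> lies in \<open>P\<close>; hence \<open>t\<^sub>2\<close> annihilates it, and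
  the previous relations transfer this to every variable.
\<close>

lemma t2t4_mult_mod_Q: "j < 5 \<Longrightarrow> t j * (t 2 * t 4) \<in> Q5"
proof -
  note r = Q5_gens(1)[of 0, unfolded row_form_simps] Q5_gens(1)[of 1, unfolded row_form_simps] Q5_gens(1)[of 2, unfolded row_form_simps]
  note q = t4_mult_mod_Q
  have a: "t 2 * t 3 \<in> Q5" by (rule Q5_gens)
  \<comment> \<open>Rows \<open>1\<close> and \<open>2\<close> minus row \<open>0\<close>, times \<open>t\<^sub>3\<close>.\<close>
  have "t 3 * t 4 - t 0 * t 3 = (t 1 + 2 * t 2 + t 4) * t 3 + (t 3 + t 4) * t 3 - (t 0 + t 1 + t 2 + t 3 + t 4) * t 3 - t 2 * t 3"
    by (simp add: algebra_simps)
  then have b: "t 3 * t 4 - t 0 * t 3 \<in> Q5"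
    using Q5_closed(3)[OF Q5_closed(3)[OF Q5_closed(1)[OF r(2) r(3)] r(1)] a] by (simp only:)
  have "t 2 * t 4 - t 0 * t 3 = (t 3 * t 4 - t 0 * t 3) - (t 3 * t 4 - t 2 * t 4)" by simp
  then have c: "t 2 * t 4 - t 0 * t 3 \<in> Q5" using Q5_closed(3)[OF b q(3)] by (simp only:)
  have "t 2 * (t 2 * t 4) = t 2 * (t 2 * t 4 - t 0 * t 3) + t 0 * (t 2 * t 3)" by (simp add: algebra_simps)
  then have d: "t 2 * (t 2 * t 4) \<in> Q5"
    using Q5_closed(1)[OF Q5_closed(2)[OF t_R5(3) c] Q5_closed(2)[OF t_R5(1) a]] by (simp only:)
  have e0: "t 0 * (t 2 * t 4) \<in> Q5" using Q5_closed(2)[OF t_R5(3) q(1)] by (simp add: mult.left_commute)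
  have e3: "t 3 * (t 2 * t 4) \<in> Q5" using Q5_closed(2)[OF t_R5(5) a] by (simp add: ac_simps)
  have "t 1 * (t 2 * t 4) = t 2 * (t 1 * t 4 + t 2 * t 4) - t 2 * (t 2 * t 4)" by (simp add: algebra_simps)
  then have e1: "t 1 * (t 2 * t 4) \<in> Q5" using Q5_closed(3)[OF Q5_closed(2)[OF t_R5(3) q(2)] d] by (simp only:)
  have "t 4 * (t 2 * t 4) = t 2 * (t 4 * t 4 + t 2 * t 4) - t 2 * (t 2 * t 4)" by (simp add: algebra_simps)
  then have e4: "t 4 * (t 2 * t 4) \<in> Q5" using Q5_closed(3)[OF Q5_closed(2)[OF t_R5(3) q(4)] d] by (simp only:)
  show "j < 5 \<Longrightarrow> ?thesis" using less5_cases[of j] d e0 e1 e3 e4 by auto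
qed

lemma order_two_times_t2t4:
  assumes "G \<in> R5" "mfps_nth G 0 = 0" shows "G * (t 2 * t 4) \<in> Q5"
proof -
  obtain g where g: "\<And>j. j < 5 \<Longrightarrow> g j \<in> R5" "G = (\<Sum>j<5. t j * g j)" using series_split[OF assms] by blast
  have "G * (t 2 * t 4) = (\<Sum>j<5. g j * (t j * (t 2 * t 4)))"
    unfolding g(2) sum_distrib_right by (intro sum.cong refl) (simp add: ac_simps)
  moreover have "\<dots> \<in> Q5"
    by (rule sum_in_left_ideal[OF ideals5(4)]) (use g(1) t2t4_mult_mod_Q in \<open>auto intro: Q5_closed(2)\<close>)
  ultimately show ?thesis by simp
qed

lemma times_t4_mod_Q:
  assumes g: "\<And>j. j < 5 \<Longrightarrow> g j \<in> R5"
  shows "(\<Sum>j<5. t j * g j) * t 4 - (g 2 + g 3 - g 1 - g 4) * (t 2 * t 4) \<in> Q5"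
proof -
  have g': "g 0 \<in> R5" "g 1 \<in> R5" "g 3 \<in> R5" "g 4 \<in> R5" by (simp_all add: g)
  have "(\<Sum>j<5. t j * g j) * t 4 - (g 2 + g 3 - g 1 - g 4) * (t 2 * t 4)
     = g 0 * (t 0 * t 4) + g 1 * (t 1 * t 4 + t 2 * t 4) + g 3 * (t 3 * t 4 - t 2 * t 4) + g 4 * (t 4 * t 4 + t 2 * t 4)"
    unfolding sum_less5 by (simp add: algebra_simps)
  moreover have "\<dots> \<in> Q5"
    by (intro Q5_closed(1) Q5_closed(2)[OF g'(1)] Q5_closed(2)[OF g'(2)] Q5_closed(2)[OF g'(3)] Q5_closed(2)[OF g'(4)] t4_mult_mod_Q)
  ultimately show ?thesis by simp
qed

lemma dual4_split:
  assumes "\<And>j. j < 5 \<Longrightarrow> g j \<in> R5" shows "dual4 (\<Sum>j<5. t j * g j) = mfps_nth (g 2 + g 3 - g 1 - g 4) 0"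
proof -
  have *: "mfps_nth (\<Sum>j<5. t j * g j) (var_exp i) = mfps_nth (g i) 0" if "i < 5" for i
  proof -
    have "mfps_nth (\<Sum>j<5. t j * g j) (var_exp i) = (\<Sum>j<5. if j = i then mfps_nth (g i) 0 else 0)"
      unfolding mfps_nth_sum by (rule sum.cong) (auto simp: mfps_nth_var_mult lookup_single when_def)
    then show ?thesis using that by simp
  qed
  show ?thesis unfolding dual4_def by (simp add: * del: One_nat_def)
qed

lemma dual_add: "dual4 (f + g) = dual4 f + dual4 g" "dual3 (f + g) = dual3 f + dual3 g" "dual4 0 = 0" "dual3 0 = 0"
  by (simp_all add: dual4_def dual3_def)

text \<open>
  The linear part of an element of \<open>U\<close> is a combination of the rows of the matrix, and relations are
  orthogonal to rows.
\<close>

lemma dual_U5: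
  assumes "f \<in> U5" shows "mfps_nth f 0 = 0 \<and> dual4 f = 0 \<and> dual3 f = 0"
  using assms unfolding U5_def
proof (induction rule: left_ideal_gen_induct)
  case (mult b s)
  then obtain i where i: "i < 3" "s = row_form i" by auto
  have "b * s = (\<Sum>j<5. of_int (scroll_matrix i j) * (t j * b))"
    by (simp add: i row_form_def sum_distrib_left ac_simps)
  then have n: "mfps_nth (b * s) m = (\<Sum>j<5. of_int (scroll_matrix i j) * mfps_nth (t j * b) m)" for m
    by (simp add: mfps_nth_sum mfps_nth_of_int_mult)
  have e: "mfps_nth (b * s) (var_exp k) = of_int (scroll_matrix i k) * mfps_nth b 0" if "k < 5" for k
  proof -
    have "mfps_nth (b * s) (var_exp k) = (\<Sum>j<5. if j = k then of_int (scroll_matrix i k) * mfps_nth b 0 else 0)"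
      unfolding n by (rule sum.cong) (auto simp: mfps_nth_var_mult lookup_single when_def)
    then show ?thesis using that by simp
  qed
  have "mfps_nth (b * s) 0 = 0" unfolding n by (simp add: mfps_nth_var_mult)
  moreover have "dual4 (b * s) = 0 \<and> dual3 (b * s) = 0"
    unfolding dual4_def dual3_def using less3_cases[OF i(1)] by (elim disjE) (simp_all add: e del: One_nat_def)
  ultimately show ?case by simp
qed (auto simp: dual_add)

text \<open>
  A functional on quadratic forms that vanishes on \<open>U M + P\<close> although it takes the value \<open>1\<close> at \<open>t\<^sub>2 t\<^sub>4\<close>.
  On \<open>t\<^sub>4 f\<close> and on \<open>t\<^sub>3 f\<close> it pairs the linear part of \<open>f\<close> with \<open>rel_vec 0 1\<close> and \<open>rel_vec 1 0\<close>.  Both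
  prescriptions have to agree at \<open>t\<^sub>3 t\<^sub>4\<close>, where both vectors contribute \<open>1\<close>.
\<close>

definition Qdual :: "complex mfps \<Rightarrow> complex" where
  "Qdual x = mfps_nth x (var_exp 3 + var_exp 0) - mfps_nth x (var_exp 3 + var_exp 1) - mfps_nth x (var_exp 3 + var_exp 3)
     + mfps_nth x (var_exp 3 + var_exp 4) - mfps_nth x (var_exp 4 + var_exp 1) + mfps_nth x (var_exp 4 + var_exp 2)
     - mfps_nth x (var_exp 4 + var_exp 4)"

lemma Qdual_t: "Qdual (t 4 * f) = dual4 f" "Qdual (t 3 * f) = dual3 f"
  unfolding Qdual_def dual4_def dual3_def
  by (simp_all add: mfps_nth_var_mult lookup_add lookup_single when_def)

lemma Qdual_add: "Qdual (f + g) = Qdual f + Qdual g" "Qdual 0 = 0"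
  by (simp_all add: Qdual_def)

lemma dual_t0_t2: "dual4 (t 0 * b) = 0" "dual3 (t 2 * b) = 0"
  by (simp_all add: dual4_def dual3_def mfps_nth_var_mult lookup_single when_def)

text \<open>
  For \<open>U M\<close> the pairing is one of relations with rows; the generators \<open>t\<^sub>0 t\<^sub>4\<close> and \<open>t\<^sub>2 t\<^sub>3\<close> of \<open>P\<close> meet the
  zero entries of the two vectors.
\<close>

lemma Q5_dual:
  assumes "x \<in> Q5" shows "mfps_nth x (var_exp 4) = 0 \<and> Qdual x = 0"
proof -
  obtain y p where x: "x = y + p" "y \<in> ideal_mult R5 U5 M5" "p \<in> P5" using assms by (auto simp: Q5_def ideal_sum_def)
  have UM: "mfps_nth (f * g) (var_exp 4) = 0 \<and> Qdual (f * g) = 0" if "f \<in> U5" "g \<in> M5" for f g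
    using that(2) unfolding M5_def
  proof (induction rule: left_ideal_gen_induct)
    case (mult a s)
    have "f * a \<in> U5" using ideal_closed(2)[OF ideals5(1) mult(1) that(1)] by (simp add: mult.commute)
    note l = dual_U5[OF this]
    have "f * (a * s) = s * (f * a)" by (simp add: ac_simps)
    moreover have "mfps_nth (s * (f * a)) (var_exp 4) = 0 \<and> Qdual (s * (f * a)) = 0"
      using mult(2) l by (auto simp: Qdual_t mfps_nth_var_mult lookup_single when_def)
    ultimately show ?case by (simp only:)
  qed (auto simp: distrib_left Qdual_add)
  have "mfps_nth y (var_exp 4) = 0 \<and> Qdual y = 0"
    using x(2) unfolding ideal_mult_def
  proof (induction rule: left_ideal_gen_induct)
    case (mult a s)
    then obtain f g where fg: "s = f * g" "f \<in> U5" "g \<in> M5" by auto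
    have "a * s = (a * f) * g" by (simp add: fg ac_simps)
    then show ?case using UM[OF ideal_closed(2)[OF ideals5(1) mult(1) fg(2)] fg(3)] by simp
  qed (auto simp: Qdual_add)
  moreover have "mfps_nth p (var_exp 4) = 0 \<and> Qdual p = 0"
    using x(3) unfolding P5_def
  proof (induction rule: left_ideal_gen_induct)
    case (mult a s)
    have "a * (t 0 * t 4) = t 4 * (t 0 * a)" "a * (t 2 * t 3) = t 3 * (t 2 * a)" by (simp_all add: ac_simps)
    moreover have "mfps_nth (t 4 * (t 0 * a)) (var_exp 4) = 0 \<and> Qdual (t 4 * (t 0 * a)) = 0"
      "mfps_nth (t 3 * (t 2 * a)) (var_exp 4) = 0 \<and> Qdual (t 3 * (t 2 * a)) = 0"
      by (auto simp: Qdual_t dual_t0_t2 mfps_nth_var_mult lookup_single when_def)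
    ultimately show ?case using mult(2) by (metis insertE singletonD)
  qed (auto simp: Qdual_add)
  ultimately show ?thesis by (simp add: x Qdual_add)
qed

text \<open>
  Multiplication of \<open>t\<^sub>4\<close> by a series without constant term gives a multiple of \<open>t\<^sub>2 t\<^sub>4\<close> modulo the ideal, and
  only its constant factor counts, which is \<open>dual4\<close>.  The functional \<open>Qdual\<close> shows that \<open>t\<^sub>2 t\<^sub>4\<close> itself is
  not in the ideal.
\<close>

lemma den_scroll: "colon R5 Q5 (t 4) = {g \<in> R5. mfps_nth g 0 = 0 \<and> dual4 g = 0}"
proof (rule Set.set_eqI, rule iffI)
  fix g assume "g \<in> colon R5 Q5 (t 4)"
  then have g: "g \<in> R5" "t 4 * g \<in> Q5" by (auto simp: colon_def mult.commute)
  show "g \<in> {g \<in> R5. mfps_nth g 0 = 0 \<and> dual4 g = 0}"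
    using Q5_dual[OF g(2)] g(1) by (simp add: Qdual_t mfps_nth_var_mult)
next
  fix g assume "g \<in> {g \<in> R5. mfps_nth g 0 = 0 \<and> dual4 g = 0}"
  then have g: "g \<in> R5" "mfps_nth g 0 = 0" "dual4 g = 0" by auto
  obtain h where h: "\<And>j. j < 5 \<Longrightarrow> h j \<in> R5" "g = (\<Sum>j<5. t j * h j)" using series_split[OF g(1,2)] by blast
  let ?G = "h 2 + h 3 - h 1 - h 4"
  have "?G \<in> R5" using h(1) by (intro series_closed) auto
  moreover have "mfps_nth ?G 0 = 0" using g(3) dual4_split[of h, OF h(1)] unfolding h(2) by simp
  ultimately have "?G * (t 2 * t 4) \<in> Q5" by (rule order_two_times_t2t4)
  from Q5_closed(1)[OF times_t4_mod_Q[of h, OF h(1)] this] have "g * t 4 \<in> Q5" by (simp add: h(2))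
  then show "g \<in> colon R5 Q5 (t 4)" using g(1) by (simp add: colon_def)
qed

lemma Q5_subset: "Q5 \<subseteq> ideal_sum U5 P5"
proof
  fix x assume "x \<in> Q5"
  then obtain y p where x: "x = y + p" "y \<in> ideal_mult R5 U5 M5" "p \<in> P5" by (auto simp: Q5_def ideal_sum_def)
  have M: "M5 \<subseteq> R5" unfolding M5_def by (rule ideal_gen_series_closed) (use t_R5 in auto)
  have "ideal_mult R5 U5 M5 \<subseteq> U5" unfolding ideal_mult_def
  proof (rule left_ideal_gen_subset[OF ideals5(1)])
    show "{f * g |f g. f \<in> U5 \<and> g \<in> M5} \<subseteq> U5"
      using ideal_closed(2)[OF ideals5(1)] M by (auto simp: mult.commute subset_iff) (metis mult.commute)
  qed
  then show "x \<in> ideal_sum U5 P5" using x by (auto simp: ideal_sum_def)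
qed

text \<open>
  With \<open>U\<close> in place of \<open>U M\<close>, the form \<open>t\<^sub>3 + t\<^sub>4\<close> becomes available, and
  \<open>t\<^sub>2 t\<^sub>4 = t\<^sub>2 (t\<^sub>3 + t\<^sub>4) - t\<^sub>2 t\<^sub>3\<close> lies in the ideal.
\<close>

lemma num_scroll: "colon R5 (ideal_sum U5 P5) (t 4) = {g \<in> R5. mfps_nth g 0 = 0}"
proof (rule Set.set_eqI, rule iffI)
  fix g assume "g \<in> colon R5 (ideal_sum U5 P5) (t 4)"
  then have gR: "g \<in> R5" and "t 4 * g \<in> ideal_sum U5 P5" by (auto simp: colon_def mult.commute)
  then obtain u p where up: "t 4 * g = u + p" "u \<in> U5" "p \<in> P5" by (auto simp: ideal_sum_def)
  have "dual4 p = 0" using up(3) unfolding P5_def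
  proof (induction rule: left_ideal_gen_induct)
    case (mult a s)
    have "a * (t 0 * t 4) = t 4 * (t 0 * a)" "a * (t 2 * t 3) = t 3 * (t 2 * a)" by (simp_all add: ac_simps)
    moreover have "dual4 (t 4 * (t 0 * a)) = 0" "dual4 (t 3 * (t 2 * a)) = 0"
      by (auto simp: dual4_def mfps_nth_var_mult lookup_single when_def)
    ultimately show ?case using mult(2) by (metis insertE singletonD)
  qed (auto simp: dual_add)
  then have "dual4 (t 4 * g) = 0" using dual_U5[OF up(2)] by (simp add: up(1) dual_add)
  then show "g \<in> {g \<in> R5. mfps_nth g 0 = 0}" using gR by (simp add: dual4_def mfps_nth_var_mult lookup_single when_def)
next
  fix g assume "g \<in> {g \<in> R5. mfps_nth g 0 = 0}"
  then have g: "g \<in> R5" "mfps_nth g 0 = 0" by auto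
  obtain h where h: "\<And>j. j < 5 \<Longrightarrow> h j \<in> R5" "g = (\<Sum>j<5. t j * h j)" using series_split[OF g] by blast
  let ?G = "h 2 + h 3 - h 1 - h 4"
  have GR: "?G \<in> R5" using h(1) by (intro series_closed) auto
  have UP: "is_left_ideal (*) R5 (ideal_sum U5 P5)" by (rule ideals5)
  have "t 2 * t 3 \<in> P5" unfolding P5_def by (auto intro: ideal_incl_series)
  then have a: "t 2 * t 3 \<in> ideal_sum U5 P5" by (rule ideal_sum_right[OF ideals5(1)])
  have "row_form 2 \<in> U5" unfolding U5_def by (auto intro: ideal_incl_series)
  then have "t 2 * row_form 2 \<in> U5" by (intro ideal_closed(2)[OF ideals5(1)] t_R5)
  then have b: "t 2 * row_form 2 \<in> ideal_sum U5 P5" by (rule ideal_sum_left[OF ideals5(3)])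
  have "t 2 * t 4 = t 2 * row_form 2 - t 2 * t 3" by (simp add: row_form_simps algebra_simps)
  then have "t 2 * t 4 \<in> ideal_sum U5 P5" using ideal_closed(3)[OF UP b a] by simp
  then have "?G * (t 2 * t 4) \<in> ideal_sum U5 P5" by (rule ideal_closed(2)[OF UP GR])
  from ideal_closed(1)[OF UP subsetD[OF Q5_subset times_t4_mod_Q[of h, OF h(1)]] this]
  have "g * t 4 \<in> ideal_sum U5 P5" by (simp add: h(2))
  then show "g \<in> colon R5 (ideal_sum U5 P5) (t 4)" using g(1) by (simp add: colon_def)
qed

lemma obstruction_dim:
  "quotient_has_dim {g \<in> R5. mfps_nth g 0 = 0} {g \<in> R5. mfps_nth g 0 = 0 \<and> dual4 g = 0} 1"
  unfolding quotient_has_dim_def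
proof (intro conjI exI[of _ "\<lambda>_. t 2"] ballI allI impI)
  show "{g \<in> R5. mfps_nth g 0 = 0 \<and> dual4 g = 0} \<subseteq> {g \<in> R5. mfps_nth g 0 = 0}" by auto
  have t2: "mfps_nth (t 2) 0 = 0" "dual4 (t 2) = 1"
    by (simp_all add: mfps_nth_var dual4_def var_exp_eq)
  show "t 2 \<in> {g \<in> R5. mfps_nth g 0 = 0}" using t_R5 t2 by simp
  fix f assume f: "f \<in> {g \<in> R5. mfps_nth g 0 = 0}"
  have iff: "f - (\<Sum>i<1. mfps_const (c i) * t 2) \<in> {g \<in> R5. mfps_nth g 0 = 0 \<and> dual4 g = 0} \<longleftrightarrow> c 0 = dual4 f" for c :: "nat \<Rightarrow> complex"
  proof -
    have "f - mfps_const (c 0) * t 2 \<in> R5" using f t_R5 by (auto intro: series_closed)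
    moreover have "mfps_nth (f - mfps_const (c 0) * t 2) 0 = 0" using f t2 by (simp add: mfps_const_mult)
    moreover have "dual4 (f - mfps_const (c 0) * t 2) = dual4 f - c 0 * dual4 (t 2)"
      unfolding dual4_def by (simp add: mfps_const_mult algebra_simps)
    ultimately show ?thesis using t2 by auto
  qed
  show "\<exists>!c. c \<in> vectors 1 \<and> f - (\<Sum>i<1. mfps_const (c i) * t 2) \<in> {g \<in> R5. mfps_nth g 0 = 0 \<and> dual4 g = 0}"
    unfolding iff
  proof (rule ex1I[of _ "\<lambda>i. if i = 0 then dual4 f else 0"])
    fix c :: "nat \<Rightarrow> complex" assume "c \<in> vectors 1 \<and> c 0 = dual4 f"
    then show "c = (\<lambda>i. if i = 0 then dual4 f else 0)" by (auto simp: vectors_def fun_eq_iff)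
  qed (simp add: vectors_def)
qed

lemma Phi_U5: "f \<in> U5 \<Longrightarrow> Phi 5 2 scroll_gale f = 0"
  unfolding U5_def
proof (induction rule: left_ideal_gen_induct)
  case (mult b s)
  then obtain i where i: "i < 3" "s = row_form i" by auto
  have "b * s = (\<Sum>j<5. of_int (scroll_matrix i j) * (t j * b))"
    by (simp add: i row_form_def sum_distrib_left ac_simps)
  then have "Phi 5 2 scroll_gale (b * s) = (\<Sum>j<5. of_int (scroll_matrix i j) * (gale_form 2 scroll_gale j * Phi 5 2 scroll_gale b))"
    by (simp add: Phi_sum Phi_of_int Phi_var_mult)
  also have "\<dots> = (\<Sum>j<5. of_int (scroll_matrix i j) * gale_form 2 scroll_gale j) * Phi 5 2 scroll_gale b"
    by (simp add: sum_distrib_right mult.assoc)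
  also have "(\<Sum>j<5. of_int (scroll_matrix i j) * gale_form 2 scroll_gale j) = 0"
    using less3_cases[OF i(1)]
    by (elim disjE) (simp_all add: sum_less5 gale_form_def sum_less2 scroll_gale_def algebra_simps del: One_nat_def)
  finally show ?case by simp
qed (auto simp: Phi_add)

text \<open>
  The substitution kills \<open>U\<close>, so the image of \<open>t\<^sub>2\<close> lies in the larger ideal because \<open>t\<^sub>2 t\<^sub>4\<close> lies in
  \<open>U + P\<close>.  It is not the image of an element of the smaller colon ideal: on series without constant term
  \<open>dual4\<close> depends only on the image, being its coefficient at \<open>s\<^sub>1\<close>.
\<close>

lemma strict_inclusion:
  "Phi 5 2 scroll_gale ` colon R5 Q5 (t 4) \<subset> colon (series 2) (Phi 5 2 scroll_gale ` P5) (Phi 5 2 scroll_gale (t 4))"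
proof
  let ?P = "Phi 5 2 scroll_gale"
  have t4: "?P (t 4 * g) = ?P g * ?P (t 4)" for g by (subst Phi_var_mult, simp, subst Phi_var, simp, rule mult.commute)
  show "?P ` colon R5 Q5 (t 4) \<subseteq> colon (series 2) (?P ` P5) (?P (t 4))"
  proof (rule image_subsetI)
    fix g assume "g \<in> colon R5 Q5 (t 4)"
    then have "t 4 * g \<in> ideal_sum U5 P5" using Q5_subset by (auto simp: colon_def mult.commute)
    then obtain u p where up: "t 4 * g = u + p" "u \<in> U5" "p \<in> P5" by (auto simp: ideal_sum_def)
    have "?P g * ?P (t 4) = ?P p" unfolding t4[symmetric] up(1) by (simp add: Phi_add Phi_U5[OF up(2)])
    then show "?P g \<in> colon (series 2) (?P ` P5) (?P (t 4))" using up(3) by (simp add: colon_def Phi_closed)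
  qed
  have "t 2 \<in> colon R5 (ideal_sum U5 P5) (t 4)" unfolding num_scroll using t_R5 by (simp add: mfps_nth_var var_exp_eq)
  then have "t 4 * t 2 \<in> ideal_sum U5 P5" by (simp add: colon_def mult.commute)
  then obtain u p where up: "t 4 * t 2 = u + p" "u \<in> U5" "p \<in> P5" by (auto simp: ideal_sum_def)
  have "?P (t 2) * ?P (t 4) = ?P p" unfolding t4[symmetric] up(1) by (simp add: Phi_add Phi_U5[OF up(2)])
  then have "?P (t 2) \<in> colon (series 2) (?P ` P5) (?P (t 4))" using up(3) by (simp add: colon_def Phi_closed)
  moreover have "?P (t 2) \<notin> ?P ` colon R5 Q5 (t 4)"
  proof
    assume "?P (t 2) \<in> ?P ` colon R5 Q5 (t 4)"
    then obtain g where g: "?P (t 2) = ?P g" "g \<in> R5" "mfps_nth g 0 = 0" "dual4 g = 0" by (auto simp: den_scroll)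
    obtain h where h: "\<And>j. j < 5 \<Longrightarrow> h j \<in> R5" "g = (\<Sum>j<5. t j * h j)" using series_split[OF g(2,3)] by blast
    have c: "mfps_nth (gale_form 2 scroll_gale j * f) (var_exp 1) = of_int (scroll_gale j 1) * mfps_nth f 0" for j f
      by (simp add: mfps_nth_gale_mult sum_less2 lookup_single when_def del: One_nat_def)
    have "?P g = (\<Sum>j<5. gale_form 2 scroll_gale j * ?P (h j))" by (simp add: h(2) Phi_sum Phi_var_mult)
    then have "mfps_nth (?P g) (var_exp 1) = (\<Sum>j<5. of_int (scroll_gale j 1) * mfps_nth (h j) 0)"
      by (simp add: mfps_nth_sum c Phi_const_coeff del: One_nat_def)
    also have "\<dots> = dual4 g"
      using dual4_split[of h, OF h(1)] unfolding h(2)[symmetric] by (simp add: sum_less5 scroll_gale_def del: One_nat_def)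
    finally have "mfps_nth (?P (t 2)) (var_exp 1) = 0" using g(1,4) by simp
    moreover have "mfps_nth (?P (t 2)) (var_exp 1) = 1"
      using c[of 2 1] by (simp add: Phi_var scroll_gale_def del: One_nat_def)
    ultimately show False by simp
  qed
  ultimately show "?P ` colon R5 Q5 (t 4) \<noteq> colon (series 2) (?P ` P5) (?P (t 4))" by blast
qed

section \<open>The Weyl algebra acts on logarithmic series\<close>

lemma mp_const_eq: "mp_const c = Poly_Mapping.single 0 c"
  by (simp add: mp_const_def)

lemma weyl_act_lin: "weyl_act n v P p = (\<lambda>u. lin (\<lambda>k. monomial_act n v k p u) P)"
  by (simp add: weyl_act_def lin_def mp_const_eq)

lemma mp_deriv_lin: "mp_deriv j p = lin (\<lambda>m. Poly_Mapping.single (m - var_exp j) (of_nat (lookup m j))) (p :: complex mpoly)"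
  unfolding mp_deriv_def lin_def by (rule sum.cong) (simp_all add: mult_single mult.commute)

lemma mp_deriv_add: "mp_deriv j (p + q) = mp_deriv j p + mp_deriv j (q :: complex mpoly)"
  by (simp add: mp_deriv_lin lin_add)

lemma mp_deriv_const_mult: "mp_deriv j (mp_const c * p) = mp_const c * mp_deriv j (p :: complex mpoly)"
  by (simp add: mp_deriv_lin lin_scale mp_const_eq)

lemma mp_deriv_zero [simp]: "mp_deriv j (0 :: complex mpoly) = 0"
  by (simp add: mp_deriv_lin)

lemma mp_deriv_commute: "mp_deriv i (mp_deriv j p) = mp_deriv j (mp_deriv i (p :: complex mpoly))"
proof (induction p rule: poly_mapping_additive_induct)
  case (single m c)
  have "m - var_exp j - var_exp i = m - var_exp i - var_exp j"
    by (intro exps_eqI) (simp add: lookup_minus)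
  moreover have "lookup m j * lookup (m - var_exp j) i = lookup m i * lookup (m - var_exp i) j"
    by (cases "i = j") (auto simp: lookup_minus lookup_single when_def)
  then have "(of_nat (lookup m j) * of_nat (lookup (m - var_exp j) i) :: complex)
     = of_nat (lookup m i) * of_nat (lookup (m - var_exp i) j)" by (metis of_nat_mult)
  ultimately show ?case by (simp add: mp_deriv_lin mult_single mult.assoc del: One_nat_def)
qed (simp_all add: mp_deriv_add)

definition linear_operator :: "(log_series \<Rightarrow> log_series) \<Rightarrow> bool" where
  "linear_operator T \<longleftrightarrow> (\<forall>p q. T (\<lambda>u. p u + q u) = (\<lambda>u. T p u + T q u)) \<and>
     (\<forall>c p. T (\<lambda>u. mp_const c * p u) = (\<lambda>u. mp_const c * T p u))"

lemma linear_operator_addD: "linear_operator T \<Longrightarrow> T (\<lambda>u. p u + q u) = (\<lambda>u. T p u + T q u)"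
  by (simp add: linear_operator_def)

lemma linear_operator_scaleD: "linear_operator T \<Longrightarrow> T (\<lambda>u. mp_const c * p u) = (\<lambda>u. mp_const c * T p u)"
  by (simp add: linear_operator_def)

lemma linear_operator_zero: "linear_operator T \<Longrightarrow> T (\<lambda>_. 0) = (\<lambda>_. 0)"
  using linear_operator_scaleD[of T 0 "\<lambda>_. 0"] by (simp add: mp_const_eq)

lemma linear_operator_x_act: "linear_operator (x_act j)"
  by (simp add: linear_operator_def x_act_def)

lemma linear_operator_d_act: "linear_operator (d_act v j)"
  unfolding linear_operator_def d_act_def Let_def
  by (auto simp: mp_deriv_add mp_deriv_const_mult distrib_left ac_simps)

lemma linear_operator_funpow: "linear_operator T \<Longrightarrow> linear_operator (T ^^ k)"
  by (induction k) (simp_all add: linear_operator_def)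

lemma linear_operator_foldr:
  assumes "\<And>j. linear_operator (F j)" shows "linear_operator (foldr (\<lambda>j. F j ^^ m j) xs)"
proof (induction xs)
  case (Cons x xs)
  have "linear_operator (F x ^^ m x)" by (rule linear_operator_funpow) (rule assms)
  with Cons show ?case by (simp add: linear_operator_def)
qed (simp add: linear_operator_def)

text \<open>
  \<open>F\<close> to the multi-index \<open>m\<close>, for commuting operators \<open>F j\<close>.
\<close>

definition op_power :: "nat \<Rightarrow> (nat \<Rightarrow> log_series \<Rightarrow> log_series) \<Rightarrow> exps \<Rightarrow> log_series \<Rightarrow> log_series" where
  "op_power n F m = foldr (\<lambda>j. F j ^^ lookup m j) [0..<n]"

lemma monomial_act_eq: "monomial_act n v (a, b) p = op_power n x_act a (op_power n (d_act v) b p)"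
  by (simp add: monomial_act_def op_power_def)

lemma funpow_commute_op:
  assumes "\<And>p. F (G p) = G (F p)" shows "F ((G ^^ k) p) = (G ^^ k) (F p)"
  by (induction k) (auto simp: assms)

text \<open>
  Commutativity is needed, as the new factor has to reach its place among the others.
\<close>

lemma op_power_add_var:
  assumes comm: "\<And>i j p. F i (F j p) = F j (F i p)" and j: "j < n"
  shows "op_power n F (m + var_exp j) p = F j (op_power n F m p)"
proof -
  have "foldr (\<lambda>i. F i ^^ lookup (m + var_exp j) i) xs p = (if j \<in> set xs then F j (foldr (\<lambda>i. F i ^^ lookup m i) xs p) else foldr (\<lambda>i. F i ^^ lookup m i) xs p)"
    if "distinct xs" for xs using that
  proof (induction xs)
    case (Cons x xs)
    show ?case
    proof (cases "x = j")
      case True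
      then show ?thesis using Cons by (simp add: lookup_add lookup_single)
    next
      case False
      then show ?thesis using Cons by (simp add: lookup_add lookup_single when_def funpow_commute_op[of "F j" "F x", OF comm])
    qed
  qed simp
  from this[of "[0..<n]"] show ?thesis using j by (simp add: op_power_def)
qed

lemma op_power_zero [simp]: "op_power n F 0 p = p"
proof -
  have "foldr (\<lambda>j. F j ^^ lookup (0 :: exps) j) xs p = p" for xs by (induction xs) auto
  then show ?thesis by (simp only: op_power_def)
qed

lemma x_act_commute: "x_act i (x_act j p) = x_act j (x_act i p)"
  by (cases "i = j") (auto simp: x_act_def fun_upd_twist)

lemma d_act_commute: "d_act v i (d_act v j p) = d_act v j (d_act v i p)"
proof (cases "i = j")
  case False
  then show ?thesis
    by (simp add: d_act_def Let_def mp_deriv_add mp_deriv_const_mult fun_upd_twist[of i j] mp_deriv_commute[of i j] algebra_simps)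
qed simp

text \<open>
  The canonical commutation relation \<open>\<partial>\<^sub>j x\<^sub>i = x\<^sub>i \<partial>\<^sub>j + \<delta>\<^sub>i\<^sub>j\<close>.
\<close>

lemma d_x_commute: "d_act v j (x_act i p) = (\<lambda>u. x_act i (d_act v j p) u + (if i = j then p u else 0))"
proof (cases "i = j")
  case True
  then show ?thesis
    by (auto simp: d_act_def x_act_def Let_def mp_const_eq single_add algebra_simps)
next
  case False
  then show ?thesis by (simp add: d_act_def x_act_def Let_def fun_upd_twist[of i j])
qed

lemma linear_operator_op_power_x: "linear_operator (op_power n x_act m)"
  unfolding op_power_def by (rule linear_operator_foldr[OF linear_operator_x_act])

lemma linear_operator_op_power_d: "linear_operator (op_power n (d_act v) m)"
  unfolding op_power_def by (rule linear_operator_foldr[OF linear_operator_d_act])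

lemma linear_operator_monomial_act: "linear_operator (monomial_act n v k)"
proof (cases k)
  case (Pair a b)
  then show ?thesis using linear_operator_op_power_x[of n a] linear_operator_op_power_d[of n v b]
    by (simp add: linear_operator_def monomial_act_eq)
qed

lemma exps_of_add_iff: "a + b \<in> exps_of n \<longleftrightarrow> a \<in> exps_of n \<and> b \<in> exps_of n"
  by (auto simp: exps_of_lookup lookup_add)

lemma var_exp_exps_of_iff: "var_exp j \<in> exps_of n \<longleftrightarrow> j < n"
  by (auto simp: exps_of_def)

lemma op_power_x_add: "a \<in> exps_of n \<Longrightarrow> op_power n x_act (b + a) p = op_power n x_act a (op_power n x_act b p)"
proof (induction a rule: exps_induct)
  case (add a j)
  then have "a \<in> exps_of n" "j < n" by (auto simp: exps_of_add_iff var_exp_exps_of_iff simp del: One_nat_def)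
  then show ?case using add.IH op_power_add_var[of x_act, OF x_act_commute \<open>j < n\<close>]
    by (simp add: add.assoc[symmetric] del: One_nat_def)
qed simp

lemma d_act_op_power_x:
  assumes "a \<in> exps_of n"
  shows "d_act v j (op_power n x_act a p) = (\<lambda>u. op_power n x_act a (d_act v j p) u
       + mp_const (of_nat (lookup a j)) * op_power n x_act (a - var_exp j) p u)"
  using assms
proof (induction a rule: exps_induct)
  case zero
  then show ?case by (simp add: mp_const_eq)
next
  case (add a i)
  then have a: "a \<in> exps_of n" "i < n" by (auto simp: exps_of_add_iff var_exp_exps_of_iff simp del: One_nat_def)
  note st = op_power_add_var[of x_act, OF x_act_commute a(2)]
  have lin: "x_act i (\<lambda>u. f u + mp_const c * g u) = (\<lambda>u. x_act i f u + mp_const c * x_act i g u)" for f g c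
    by (simp add: x_act_def)
  have "d_act v j (op_power n x_act (a + var_exp i) p) = (\<lambda>u. op_power n x_act (a + var_exp i) (d_act v j p) u
      + mp_const (of_nat (lookup a j)) * x_act i (op_power n x_act (a - var_exp j) p) u
      + (if i = j then op_power n x_act a p u else 0))"
    unfolding st d_x_commute add.IH[OF a(1)] lin ..
  also have "\<dots> = (\<lambda>u. op_power n x_act (a + var_exp i) (d_act v j p) u
       + mp_const (of_nat (lookup (a + var_exp i) j)) * op_power n x_act (a + var_exp i - var_exp j) p u)"
  proof
    fix u
    show "op_power n x_act (a + var_exp i) (d_act v j p) u
      + mp_const (of_nat (lookup a j)) * x_act i (op_power n x_act (a - var_exp j) p) u
      + (if i = j then op_power n x_act a p u else 0) = op_power n x_act (a + var_exp i) (d_act v j p) u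
       + mp_const (of_nat (lookup (a + var_exp i) j)) * op_power n x_act (a + var_exp i - var_exp j) p u"
    proof (cases "i = j")
      case True
      have e: "mp_const (of_nat (lookup a j)) * x_act i (op_power n x_act (a - var_exp j) p) u = mp_const (of_nat (lookup a j)) * op_power n x_act a p u"
      proof (cases "lookup a j = 0")
        case False
        then have "a - var_exp j + var_exp j = a"
          by (intro exps_eqI) (auto simp: lookup_add lookup_minus lookup_single when_def)
        then show ?thesis using st[of "a - var_exp j" p] True by (simp del: One_nat_def)
      qed (simp add: mp_const_eq)
      show ?thesis unfolding e using True
        by (simp add: lookup_add lookup_single mp_const_eq single_add distrib_right single_one add.commute)
    next
      case False
      then have "a - var_exp j + var_exp i = a + var_exp i - var_exp j"
        by (intro exps_eqI) (auto simp: lookup_add lookup_minus lookup_single when_def)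
      then show ?thesis using st[of "a - var_exp j" p] False by (simp add: lookup_add lookup_single when_def del: One_nat_def)
    qed
  qed
  finally show ?case .
qed

lemma keys_weyl_basis_mult: 
  assumes "\<kappa> \<in> keys (weyl_basis_mult \<mu> \<nu>)" "\<mu> \<in> exps_of n \<times> exps_of n" "\<nu> \<in> exps_of n \<times> exps_of n"
  shows "\<kappa> \<in> exps_of n \<times> exps_of n"
proof -
  obtain a b where \<mu>: "\<mu> = (a, b)" by (cases \<mu>) auto
  obtain c e where \<nu>: "\<nu> = (c, e)" by (cases \<nu>) auto
  have "\<kappa> \<in> (\<Union>k\<in>contractions b c. keys (Poly_Mapping.single (a + (c - k), (b - k) + e)
     (of_nat (leibniz_coeff b c k) :: complex)))"
    by (rule subsetD[OF keys_sum_subset]) (use assms in \<open>simp add: \<mu> \<nu> weyl_basis_mult_def\<close>)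
  then obtain k where "\<kappa> = (a + (c - k), (b - k) + e)" by (auto split: if_splits)
  then show ?thesis using assms(2,3) by (auto simp: \<mu> \<nu>)
qed

lemma weyl_mult_closed:
  assumes "P \<in> weyl_algebra n" "Q \<in> weyl_algebra n" shows "weyl_mult P Q \<in> weyl_algebra n"
proof -
  have k: "k \<in> exps_of n \<times> exps_of n" if "k \<in> keys P \<or> k \<in> keys Q" for k
    using assms that unfolding weyl_algebra_def by blast
  show ?thesis unfolding weyl_mult_bil bil_def weyl_algebra_def mem_Collect_eq
    by (intro lin_keys_subset subsetI) (erule keys_weyl_basis_mult[OF _ k k], simp_all)
qed

lemma weyl_act_zero: "weyl_act n v 0 p = (\<lambda>_. 0)" by (simp add: weyl_act_lin)
lemma weyl_act_add: "weyl_act n v (P + Q) p = (\<lambda>u. weyl_act n v P p u + weyl_act n v Q p u)"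
  by (simp add: weyl_act_lin lin_add)
lemma weyl_act_scale: "weyl_act n v (Poly_Mapping.single 0 c * P) p = (\<lambda>u. mp_const c * weyl_act n v P p u)"
  by (simp add: weyl_act_lin lin_scale mp_const_eq)
lemma weyl_act_single: "weyl_act n v (Poly_Mapping.single k c) p = (\<lambda>u. mp_const c * monomial_act n v k p u)"
  by (simp add: weyl_act_lin mp_const_eq)

lemma weyl_act_shift:
  assumes "P \<in> weyl_algebra n" "a \<in> exps_of n"
  shows "weyl_act n v (Poly_Mapping.single (a, 0) 1 * P) p = op_power n x_act a (weyl_act n v P p)"
proof -
  have "weyl_act n v (Poly_Mapping.single (a, 0) 1 * Poly_Mapping.single k c) p = op_power n x_act a (weyl_act n v (Poly_Mapping.single k c) p)" for k c
  proof (cases k)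
    case (Pair x y)
    have "op_power n x_act (a + x) q = op_power n x_act a (op_power n x_act x q)" for q
      using op_power_x_add[OF assms(2), of x q] by (simp add: add.commute)
    then show ?thesis using linear_operator_op_power_x[of n a]
      by (simp add: Pair mult_single weyl_act_single monomial_act_eq linear_operator_scaleD)
  qed
  then show ?thesis
    using linear_operator_op_power_x[of n a] linear_operator_zero[OF linear_operator_op_power_x, of n a]
    by (induction P rule: poly_mapping_additive_induct)
       (simp_all add: distrib_left weyl_act_add weyl_act_zero linear_operator_addD)
qed

lemma weyl_act_d:
  assumes "P \<in> weyl_algebra n" "j < n"
  shows "weyl_act n v (weyl_d j P) p = d_act v j (weyl_act n v P p)"
proof (induction P rule: poly_mapping_additive_induct)
  case zero
  then show ?case by (simp add: weyl_act_zero linear_operator_zero[OF linear_operator_d_act])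
next
  case (add P R)
  then show ?case by (simp add: weyl_act_add linear_operator_addD[OF linear_operator_d_act])
next
  case (single k c)
  obtain x y where k: "k = (x, y)" by (cases k) auto
  have x: "x \<in> exps_of n" using single assms(1) k by (auto simp: weyl_algebra_def)
  have "weyl_d j (Poly_Mapping.single k c) = Poly_Mapping.single 0 c * Poly_Mapping.single (x, y + var_exp j) 1
     + Poly_Mapping.single 0 c * Poly_Mapping.single (x - var_exp j, y) (of_nat (lookup x j))"
    by (simp add: weyl_d_def k distrib_left del: One_nat_def)
  then have "weyl_act n v (weyl_d j (Poly_Mapping.single k c)) p = (\<lambda>u. mp_const c * (monomial_act n v (x, y + var_exp j) p u
      + mp_const (of_nat (lookup x j)) * monomial_act n v (x - var_exp j, y) p u))"
    by (simp add: weyl_act_add weyl_act_scale weyl_act_single distrib_left mp_const_eq single_one del: One_nat_def)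
  also have "\<dots> = (\<lambda>u. mp_const c * d_act v j (monomial_act n v k p) u)"
    unfolding k monomial_act_eq d_act_op_power_x[OF x] op_power_add_var[of "d_act v", OF d_act_commute assms(2)] ..
  also have "\<dots> = d_act v j (weyl_act n v (Poly_Mapping.single k c) p)"
    unfolding weyl_act_single by (rule linear_operator_scaleD[OF linear_operator_d_act, symmetric])
  finally show ?case .
qed

lemma weyl_one_mult: "weyl_mult (Poly_Mapping.single (0, 0) 1) Q = Q"
  unfolding weyl_mult_bil
proof (induction Q rule: poly_mapping_additive_induct)
  case (single \<nu> t)
  have "contractions 0 c = {0}" for c
    by (auto simp: contractions_def exp_dvd_def intro: exps_eqI)
  then show ?case by (cases \<nu>) (simp add: bil_single weyl_basis_mult_def mult_single)
qed (auto simp: bil_add_right)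

text \<open>
  The action is a module structure.  The argument is the one for associativity: \<open>x\<^sup>a\<close> acts from the left
  without contractions, and \<open>\<partial>\<^sup>b\<close> is built up one derivation at a time.
\<close>

theorem weyl_act_mult:
  assumes "P \<in> weyl_algebra n" "Q \<in> weyl_algebra n"
  shows "weyl_act n v (weyl_mult P Q) p = weyl_act n v P (weyl_act n v Q p)"
proof (induction P rule: poly_mapping_additive_induct)
  case zero
  then show ?case by (simp add: weyl_mult_bil weyl_act_zero)
next
  case (add P R)
  then show ?case by (simp add: weyl_mult_bil bil_add_left weyl_act_add)
next
  case (single k c)
  obtain x y where k: "k = (x, y)" by (cases k) auto
  have xy: "x \<in> exps_of n" "y \<in> exps_of n" using single assms(1) k by (auto simp: weyl_algebra_def)
  have cl: "Poly_Mapping.single (0, z) 1 \<in> weyl_algebra n" if "z \<in> exps_of n" for z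
    using that by (simp add: weyl_algebra_def)
  have 1: "weyl_act n v (weyl_mult (Poly_Mapping.single (0, y) 1) Q) p = weyl_act n v (Poly_Mapping.single (0, y) 1) (weyl_act n v Q p)"
    using xy(2)
  proof (induction y rule: exps_induct)
    case zero
    show ?case by (simp add: weyl_one_mult weyl_act_single monomial_act_eq mp_const_eq single_one)
  next
    case (add b j)
    then have b: "b \<in> exps_of n" "j < n" by (auto simp: exps_of_add_iff var_exp_exps_of_iff simp del: One_nat_def)
    have e: "Poly_Mapping.single (0, b + var_exp j) 1 = weyl_d j (Poly_Mapping.single (0, b) 1)"
      by (simp add: weyl_d_def single_one zero_prod_def[symmetric] del: One_nat_def)
    have "weyl_mult (Poly_Mapping.single (0, b + var_exp j) 1) Q = weyl_d j (weyl_mult (Poly_Mapping.single (0, b) 1) Q)"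
      unfolding e weyl_mult_bil weyl_d_mult ..
    then show ?case unfolding e
      using weyl_act_d[OF weyl_mult_closed[OF cl[OF b(1)] assms(2)] b(2)] weyl_act_d[OF cl[OF b(1)] b(2)] add.IH[OF b(1)] by simp
  qed
  have e: "Poly_Mapping.single k c = Poly_Mapping.single 0 c * (Poly_Mapping.single (x, 0) 1 * Poly_Mapping.single (0, y) 1)"
    by (simp add: mult_single k)
  have "weyl_mult (Poly_Mapping.single k c) Q = Poly_Mapping.single 0 c * (Poly_Mapping.single (x, 0) 1 * weyl_mult (Poly_Mapping.single (0, y) 1) Q)"
    unfolding e weyl_mult_bil bil_scale_left weyl_shift_mult ..
  then show ?case
    unfolding e by (simp only: weyl_act_scale weyl_act_shift[OF weyl_mult_closed[OF cl[OF xy(2)] assms(2)] xy(1)]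
        weyl_act_shift[OF cl[OF xy(2)] xy(1)] 1)
qed

lemma annihilator_left_ideal:
  "is_left_ideal weyl_mult (weyl_algebra n) {P \<in> weyl_algebra n. weyl_act n v P p = (\<lambda>_. 0)}"
  unfolding is_left_ideal_def
proof (intro conjI ballI)
  show "0 \<in> {P \<in> weyl_algebra n. weyl_act n v P p = (\<lambda>_. 0)}" by (simp add: weyl_algebra_def weyl_act_zero)
  fix f assume f: "f \<in> {P \<in> weyl_algebra n. weyl_act n v P p = (\<lambda>_. 0)}"
  { fix g assume g: "g \<in> {P \<in> weyl_algebra n. weyl_act n v P p = (\<lambda>_. 0)}"
    then show "f + g \<in> {P \<in> weyl_algebra n. weyl_act n v P p = (\<lambda>_. 0)}"
      using f keys_add[of f g] by (auto simp: weyl_algebra_def weyl_act_add) }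
  { fix a assume a: "a \<in> weyl_algebra n"
    have "weyl_act n v a (\<lambda>_. 0) = (\<lambda>_. 0)"
      using linear_operator_zero[OF linear_operator_monomial_act, of n v] by (simp add: weyl_act_lin lin_def)
    then show "weyl_mult a f \<in> {P \<in> weyl_algebra n. weyl_act n v P p = (\<lambda>_. 0)}"
      using f a by (simp add: weyl_mult_closed weyl_act_mult) }
qed

section \<open>Constant coefficient operators\<close>

lemma diff_op_lin: "diff_op f = lin (\<lambda>m. Poly_Mapping.single (0, m) 1) f"
  by (simp add: diff_op_def lin_def mult_single)

lemma diff_op_closed: "f \<in> polys n \<Longrightarrow> diff_op f \<in> weyl_algebra n"
  unfolding diff_op_lin weyl_algebra_def mem_Collect_eq
  by (intro lin_keys_subset) (auto simp: polys_def)

lemma diff_op_add: "diff_op (f + g) = diff_op f + diff_op g" "diff_op 0 = 0"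
  by (simp_all add: diff_op_lin lin_add)

lemma diff_op_mult: "diff_op (f * g) = weyl_mult (diff_op f) (diff_op g)"
  unfolding weyl_mult_bil
proof (induction f rule: poly_mapping_additive_induct)
  case (single k c)
  show ?case
  proof (induction g rule: poly_mapping_additive_induct)
    case (single l d)
    have "contractions k 0 = {0}"
      by (auto simp: contractions_def exp_dvd_def intro: exps_eqI)
    then show ?case
      by (simp add: diff_op_lin mult_single bil_single weyl_basis_mult_def)
  qed (auto simp: distrib_left diff_op_add bil_add_right)
qed (auto simp: distrib_right diff_op_add bil_add_left)

lemma euler_op_closed: "euler_op 5 scroll_matrix \<beta> i \<in> weyl_algebra 5"
proof -
  have "keys (\<Sum>j<5. Poly_Mapping.single (Poly_Mapping.single j (1::nat), Poly_Mapping.single j (1::nat)) (of_int (scroll_matrix i j) :: complex))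
     \<subseteq> exps_of 5 \<times> exps_of 5"
    by (intro order.trans[OF keys_sum_subset] UN_least) (auto simp: var_exp_exps_of_iff)
  moreover have "keys (x - y) \<subseteq> keys x \<union> keys (y :: weyl)" for x y
    by (auto simp: in_keys_iff lookup_minus)
  moreover have "keys (Poly_Mapping.single (0, 0) (\<beta> i) :: weyl) \<subseteq> exps_of 5 \<times> exps_of 5" by auto
  ultimately show ?thesis unfolding euler_op_def weyl_algebra_def mem_Collect_eq by blast
qed

text \<open>
  Since the toric ideal is generated by three binomials, a left ideal contains the hypergeometric ideal as
  soon as it contains three box operators and three Euler operators.
\<close>

lemma hypergeometric_subset:
  assumes "is_left_ideal weyl_mult (weyl_algebra 5) K" "\<And>i. i < 3 \<Longrightarrow> diff_op (scroll_binomial i) \<in> K"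
    "\<And>i. i < 3 \<Longrightarrow> euler_op 5 scroll_matrix \<beta> i \<in> K"
  shows "hypergeometric_ideal 3 5 scroll_matrix \<beta> \<subseteq> K"
  unfolding hypergeometric_ideal_def
proof (rule left_ideal_gen_subset[OF assms(1)])
  have "diff_op f \<in> K" if "f \<in> toric" for f
    using that unfolding toric_eq scroll_ideal_def
  proof (induction rule: left_ideal_gen_induct)
    case (mult a s)
    then show ?case using assms(1,2) diff_op_closed[OF mult(1)] by (auto simp: diff_op_mult is_left_ideal_def)
  qed (use assms(1) in \<open>auto simp: diff_op_add is_left_ideal_def\<close>)
  then show "diff_op ` toric \<union> euler_op 5 scroll_matrix \<beta> ` {..<3} \<subseteq> K" using assms(3) by auto
qed

lemma scroll_binomial_polys: "i < 3 \<Longrightarrow> scroll_binomial i \<in> polys 5"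
  unfolding scroll_binomial_def by (auto intro!: polys_closed lead_trail_exps_of)

lemma hypergeometric_closed: "hypergeometric_ideal 3 5 scroll_matrix \<beta> \<subseteq> weyl_algebra 5"
proof (rule hypergeometric_subset)
  have "P + Q \<in> weyl_algebra 5" if "P \<in> weyl_algebra 5" "Q \<in> weyl_algebra 5" for P Q
    using that keys_add[of P Q] unfolding weyl_algebra_def by blast
  then show "is_left_ideal weyl_mult (weyl_algebra 5) (weyl_algebra 5)"
    by (auto simp: is_left_ideal_def weyl_mult_closed) (simp add: weyl_algebra_def)
qed (auto intro: diff_op_closed scroll_binomial_polys euler_op_closed)

section \<open>The logarithmic solution\<close>

text \<open>
  The coefficients of \<open>a\<close> and \<open>b\<close> are the entries of \<open>rel_vec 1 0\<close> and \<open>rel_vec 0 1\<close>, so that the Euler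
  operators see no contribution from the logarithms.
\<close>

definition log_form :: "complex \<Rightarrow> complex \<Rightarrow> complex \<Rightarrow> complex mpoly" where
  "log_form a b c = mp_const a * (mp_var 0 - mp_var 1 - mp_var 3 + mp_var 4)
     + mp_const b * (mp_var 2 + mp_var 3 - mp_var 1 - mp_var 4) + mp_const c"

lemma log_form_cong: "a = a' \<Longrightarrow> b = b' \<Longrightarrow> c = c' \<Longrightarrow> log_form a b c = log_form a' b' c'"
  by simp

lemma log_form_add: "log_form a b c + log_form a' b' c' = log_form (a + a') (b + b') (c + c')"
  by (simp add: log_form_def mp_const_eq single_add algebra_simps)

lemma log_form_scale: "mp_const s * log_form a b c = log_form (s * a) (s * b) (s * c)"
  by (simp add: log_form_def mp_const_eq distrib_left mult.assoc[symmetric] mult_single)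

lemma log_form_zero: "log_form 0 0 0 = 0"
  by (simp add: log_form_def mp_const_eq)

lemma mp_deriv_var: "mp_deriv j (mp_var i :: complex mpoly) = (if i = j then mp_const 1 else 0)"
  by (simp add: mp_deriv_lin mp_var_def mp_const_eq lookup_single when_def single_one)

lemma mp_deriv_diff: "mp_deriv j (p - q) = mp_deriv j p - mp_deriv j (q :: complex mpoly)"
  using mp_deriv_add[of j "p - q" q] by simp

lemma mp_deriv_const: "mp_deriv j (mp_const c :: complex mpoly) = 0"
  by (simp add: mp_deriv_lin mp_const_eq)

lemma mp_deriv_log_form: "mp_deriv j (log_form a b c) = mp_const (a * of_int (rel_vec 1 0 j) + b * of_int (rel_vec 0 1 j))"
proof (cases "j < 5")
  case True
  from less5_cases[OF this] show ?thesis
    by (elim disjE; simp add: log_form_def mp_deriv_add mp_deriv_diff mp_deriv_const mp_deriv_const_mult mp_deriv_var del: One_nat_def;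
        simp add: mp_const_eq mult_single single_add single_uminus single_diff single_one right_diff_distrib)
next
  case False
  then show ?thesis
    by (simp add: log_form_def mp_deriv_add mp_deriv_diff mp_deriv_const mp_deriv_const_mult mp_deriv_var rel_vec_out)
       (simp add: mp_const_eq)
qed

lemma d_act_log_form:
  "d_act v j (\<lambda>u. log_form (A u) (B u) (C u)) = (\<lambda>u. let u' = u(j := u j + 1); z = v j + of_int (u j + 1) in
     log_form (z * A u') (z * B u') (z * C u' + A u' * of_int (rel_vec 1 0 j) + B u' * of_int (rel_vec 0 1 j)))"
proof -
  have c: "mp_const c = log_form 0 0 c" for c by (simp add: log_form_def mp_const_eq)
  show ?thesis unfolding d_act_def Let_def log_form_scale mp_deriv_log_form
    unfolding c[of "_ * _ + _ * _"] log_form_add by (simp add: add.assoc)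
qed

text \<open>
  The series arises from the perturbation \<open>t\<^sub>4 \<Sum>\<^sub>u [v + t]\<^bsub>u-\<^esub> / [v + t + u]\<^bsub>u+\<^esub> x\<^bsup>v+t+u\<^esup>\<close> over the quadrant
  by applying the functional \<open>Qdual\<close> in \<open>t\<close>, which makes sense since all coefficients lie in the ideal
  \<open>M\<close> generated by \<open>t\<^sub>3\<close> and \<open>t\<^sub>4\<close>.  The result is a solution as \<open>Qdual\<close> vanishes on \<open>U M + P\<close>.  For
  \<open>u = rel_vec a b\<close> the factor is \<open>t\<^sub>3\<close> if \<open>a > b\<close>, and \<open>t\<^sub>4\<close> otherwise, and it is followed by a series in
  \<open>t\<close>; its constant term is the coefficient of the corresponding logarithm (\<open>sol_log0\<close> or \<open>sol_log1\<close>),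
  and its linear part gives the constant \<open>sol_const\<close>.  If \<open>a + b \<ge> 3\<close>, a factor \<open>t\<^sub>1\<close> from
  \<open>[2 + t\<^sub>1]\<^bsub>a+b\<^esub>\<close> removes the logarithm.
\<close>

definition sol_log0 :: "int \<Rightarrow> int \<Rightarrow> complex" where
  "sol_log0 a b = (if a = 1 \<and> b = 0 then 2 else if a = 2 \<and> b = 0 then -1 else 0)"
definition sol_log1 :: "int \<Rightarrow> int \<Rightarrow> complex" where
  "sol_log1 a b = (if a = 0 \<and> b = 0 then 1 else if a = 0 \<and> b = 1 then -2 else if a = 1 \<and> b = 1 then 2
     else if a = 0 \<and> b = 2 then 1 else 0)"
definition sol_const :: "int \<Rightarrow> int \<Rightarrow> complex" where
  "sol_const a b = (if a < 0 \<or> b < 0 \<or> (a = 0 \<and> b = 0) then 0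
     else if a = 1 \<and> b = 0 then -3 else if a = 0 \<and> b = 1 then 3 else if a = 1 \<and> b = 1 then -5
     else if a = 0 \<and> b = 2 then -3 else if a = 2 \<and> b = 0 then 3
     else (if a \<le> b then 1 else -1) * 2 * fact (nat (a + b - 3)) / (fact (nat a) * fact (nat b)))"

lemma tail_zero: "a + b \<ge> 3 \<Longrightarrow> sol_log0 a b = 0" "a + b \<ge> 3 \<Longrightarrow> sol_log1 a b = 0" "a < 0 \<or> b < 0 \<Longrightarrow> sol_log0 a b = 0" "a < 0 \<or> b < 0 \<Longrightarrow> sol_log1 a b = 0"
  "a < 0 \<or> b < 0 \<Longrightarrow> sol_const a b = 0"
  by (auto simp: sol_log0_def sol_log1_def sol_const_def)

lemma sol_const_tail: "i + j = k + 3 \<Longrightarrow> sol_const (int i) (int j) = (if i \<le> j then 1 else -1) * 2 * fact k / (fact i * fact j)"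
proof -
  assume k: "i + j = k + 3"
  then have "nat (int i + int j - 3) = k" by linarith
  moreover have "sol_const (int i) (int j) = (if i \<le> j then 1 else -1) * 2 * fact (nat (int i + int j - 3)) / (fact (nat (int i)) * fact (nat (int j)))"
    using k unfolding sol_const_def by auto
  ultimately show ?thesis by simp
qed

lemma small_nat_cases: "n \<le> 4 \<Longrightarrow> n = 0 \<or> n = 1 \<or> n = 2 \<or> n = 3 \<or> n = (4::nat)" by auto

text \<open>
  These and the next three identities are the three box equations, compared coefficient by coefficient:
  first the coefficients of the logarithms, then the constants.
\<close>

lemma recurrence_log:
  fixes a b :: int
  shows "of_int b * (of_int a * sol_log0 a b) = (3 - of_int (a + b)) * ((4 - of_int (a + b)) * sol_log0 (a - 1) (b - 1))"
    "of_int b * (of_int a * sol_log1 a b) = (3 - of_int (a + b)) * ((4 - of_int (a + b)) * sol_log1 (a - 1) (b - 1))"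
    "(of_int (a - b) - 1) * (of_int a * sol_log0 a b) = (of_int (b - a) + 1) * ((3 - of_int (a + b)) * sol_log0 (a - 1) b)"
    "(of_int (a - b) - 1) * (of_int a * sol_log1 a b) = (of_int (b - a) + 1) * ((3 - of_int (a + b)) * sol_log1 (a - 1) b)"
    "of_int (b - a) * (of_int b * sol_log0 a b) = of_int (a - b) * ((3 - of_int (a + b)) * sol_log0 a (b - 1))"
    "of_int (b - a) * (of_int b * sol_log1 a b) = of_int (a - b) * ((3 - of_int (a + b)) * sol_log1 a (b - 1))"
  by (auto simp: sol_log0_def sol_log1_def)

text \<open>
  For \<open>a + b \<ge> 5\<close> no logarithms are left on either side, and the identity is the quotient of factorials in
  the tail; the finitely many smaller cases are computed.
\<close>

lemma recurrence_const0:
  fixes a b :: int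
  shows "of_int b * (of_int a * sol_const a b + sol_log0 a b) + of_int a * sol_log1 a b
    = (3 - of_int (a + b)) * ((4 - of_int (a + b)) * sol_const (a - 1) (b - 1) - sol_log0 (a - 1) (b - 1) - sol_log1 (a - 1) (b - 1))
      - (4 - of_int (a + b)) * sol_log0 (a - 1) (b - 1) - (4 - of_int (a + b)) * sol_log1 (a - 1) (b - 1)"
proof (cases "a < 0 \<or> b < 0")
  case True
  then have "a - 1 < 0 \<or> b - 1 < 0" by auto
  with True show ?thesis by (simp add: tail_zero)
next
  case False
  then obtain i j where ij: "a = int i" "b = int j" by (metis nonneg_int_cases not_less)
  show ?thesis
  proof (cases "i + j \<le> 4")
    case True
    then have "i \<le> 4" "j \<le> 4" by auto
    from small_nat_cases[OF this(1)] small_nat_cases[OF this(2)] True show ?thesis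
      unfolding ij by (elim disjE) (simp_all add: sol_log0_def sol_log1_def sol_const_def fact_numeral)
  next
    case False
    then obtain k where k: "i + j = k + 5" by (metis add.commute le_Suc_ex not_less_eq_eq eval_nat_numeral(3) numeral_eq_Suc pred_numeral_simps(3) Suc_eq_plus1 semiring_norm(26,27,28))
    then have z: "sol_log0 a b = 0" "sol_log1 a b = 0" "sol_log0 (a - 1) (b - 1) = 0" "sol_log1 (a - 1) (b - 1) = 0" by (auto simp: ij tail_zero)
    show ?thesis
    proof (cases "i = 0 \<or> j = 0")
      case True
      then have c: "sol_const (a - 1) (b - 1) = 0" by (auto simp: ij tail_zero)
      show ?thesis unfolding z c using True by (auto simp: ij)
    next
      case False
      then obtain i' j' where s: "i = Suc i'" "j = Suc j'" by (meson not0_implies_Suc)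
      have k': "i' + j' = k + 3" "Suc i' + Suc j' = (k + 2) + 3" using k s by auto
      have e: "a - 1 = int i'" "b - 1 = int j'" by (auto simp: ij s)
      have ab: "a = int (Suc i')" "b = int (Suc j')" by (auto simp: ij s)
      have sum: "of_int (a + b) = (of_nat k + 5 :: complex)"
      proof -
        have "a + b = int (k + 5)" using k ij by simp
        then show ?thesis by simp
      qed
      have f: "fact i' \<noteq> (0::complex)" "fact j' \<noteq> (0::complex)" "of_nat (Suc i') \<noteq> (0::complex)" "of_nat (Suc j') \<noteq> (0::complex)"
        by (simp_all del: of_nat_Suc)
      have "(of_nat (Suc j') :: complex) * (of_nat (Suc i') * sol_const (int (Suc i')) (int (Suc j'))) = of_nat ((k+2) * (k+1)) * sol_const (int i') (int j')"
        unfolding sol_const_tail[OF k'(1)] sol_const_tail[OF k'(2)] using f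
        by (simp add: field_simps del: of_nat_Suc of_nat_mult) (simp add: algebra_simps)
      then show ?thesis unfolding z unfolding e sum by (simp add: ab algebra_simps)
    qed
  qed
qed

text \<open>
  The sign in the tail changes between \<open>a \<le> b\<close> and \<open>a > b\<close>.  It does so exactly where the factor
  \<open>a - b - 1\<close> vanishes.
\<close>

lemma recurrence_const1:
  fixes a b :: int
  shows "(of_int (a - b) - 1) * (of_int a * sol_const a b + sol_log0 a b) + of_int a * sol_log0 a b - of_int a * sol_log1 a b
    = (of_int (b - a) + 1) * ((3 - of_int (a + b)) * sol_const (a - 1) b - sol_log0 (a - 1) b - sol_log1 (a - 1) b)
      - (3 - of_int (a + b)) * sol_log0 (a - 1) b + (3 - of_int (a + b)) * sol_log1 (a - 1) b"
proof (cases "a < 0 \<or> b < 0")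
  case True
  then have "a - 1 < 0 \<or> b < 0" by auto
  with True show ?thesis by (simp add: tail_zero)
next
  case False
  then obtain i j where ij: "a = int i" "b = int j" by (metis nonneg_int_cases not_less)
  show ?thesis
  proof (cases "i + j \<le> 3")
    case True
    then have "i \<le> 4" "j \<le> 4" by auto
    from small_nat_cases[OF this(1)] small_nat_cases[OF this(2)] True show ?thesis
      unfolding ij by (elim disjE) (simp_all add: sol_log0_def sol_log1_def sol_const_def fact_numeral)
  next
    case False
    then have "\<exists>k. i + j = k + 4" by presburger
    then obtain k where k: "i + j = k + 4" by blast
    then have z: "sol_log0 a b = 0" "sol_log1 a b = 0" "sol_log0 (a - 1) b = 0" "sol_log1 (a - 1) b = 0" by (auto simp: ij tail_zero)
    show ?thesis
    proof (cases "i = 0")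
      case True
      then have c: "sol_const (a - 1) b = 0" by (auto simp: ij tail_zero)
      show ?thesis unfolding z c using True by (auto simp: ij)
    next
      case False
      then obtain i' where s: "i = Suc i'" by (meson not0_implies_Suc)
      have k': "i' + j = k + 3" "Suc i' + j = (k + 1) + 3" using k s by auto
      have e: "a - 1 = int i'" by (auto simp: ij s)
      have ab: "a = int (Suc i')" by (auto simp: ij s)
      have sum: "of_int (a + b) = (of_nat k + 4 :: complex)"
      proof -
        have "a + b = int (k + 4)" using k ij by simp
        then show ?thesis by simp
      qed
      have f: "fact i' \<noteq> (0::complex)" "fact j \<noteq> (0::complex)" "of_nat (Suc i') \<noteq> (0::complex)"
        by (simp_all del: of_nat_Suc)
      have "(of_nat i' - of_nat j :: complex) * (of_nat (Suc i') * sol_const (int (Suc i')) (int j)) = (of_nat i' - of_nat j) * (of_nat (k+1) * sol_const (int i') (int j))"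
      proof (cases "i' = j")
        case False
        then have "Suc i' \<le> j \<longleftrightarrow> i' \<le> j" by auto
        then have "of_nat (Suc i') * sol_const (int (Suc i')) (int j) = of_nat (k+1) * sol_const (int i') (int j)"
          unfolding sol_const_tail[OF k'(1)] sol_const_tail[OF k'(2)] using f
          by (simp add: field_simps del: of_nat_Suc)
        then show ?thesis by (simp only:)
      qed simp
      then show ?thesis unfolding z unfolding e sum by (simp add: ab ij(2) algebra_simps)
    qed
  qed
qed

text \<open>
  Here the change of sign is hidden by the factor \<open>b - a\<close>.
\<close>

lemma recurrence_const2:
  fixes a b :: int
  shows "of_int (b - a) * (of_int b * sol_const a b + sol_log1 a b) - of_int b * sol_log0 a b + of_int b * sol_log1 a b
    = of_int (a - b) * ((3 - of_int (a + b)) * sol_const a (b - 1) - sol_log0 a (b - 1) - sol_log1 a (b - 1))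
      + (3 - of_int (a + b)) * sol_log0 a (b - 1) - (3 - of_int (a + b)) * sol_log1 a (b - 1)"
proof (cases "a < 0 \<or> b < 0")
  case True
  then have "a < 0 \<or> b - 1 < 0" by auto
  with True show ?thesis by (simp add: tail_zero)
next
  case False
  then obtain i j where ij: "a = int i" "b = int j" by (metis nonneg_int_cases not_less)
  show ?thesis
  proof (cases "i + j \<le> 3")
    case True
    then have "i \<le> 4" "j \<le> 4" by auto
    from small_nat_cases[OF this(1)] small_nat_cases[OF this(2)] True show ?thesis
      unfolding ij by (elim disjE) (simp_all add: sol_log0_def sol_log1_def sol_const_def fact_numeral)
  next
    case False
    then have "\<exists>k. i + j = k + 4" by presburger
    then obtain k where k: "i + j = k + 4" by blast
    then have z: "sol_log0 a b = 0" "sol_log1 a b = 0" "sol_log0 a (b - 1) = 0" "sol_log1 a (b - 1) = 0" by (auto simp: ij tail_zero)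
    show ?thesis
    proof (cases "j = 0")
      case True
      then have c: "sol_const a (b - 1) = 0" by (auto simp: ij tail_zero)
      show ?thesis unfolding z c using True by (auto simp: ij)
    next
      case False
      then obtain j' where s: "j = Suc j'" by (meson not0_implies_Suc)
      have k': "i + j' = k + 3" "i + Suc j' = (k + 1) + 3" using k s by auto
      have e: "b - 1 = int j'" by (auto simp: ij s)
      have ab: "b = int (Suc j')" by (auto simp: ij s)
      have sum: "of_int (a + b) = (of_nat k + 4 :: complex)"
      proof -
        have "a + b = int (k + 4)" using k ij by simp
        then show ?thesis by simp
      qed
      have f: "fact i \<noteq> (0::complex)" "fact j' \<noteq> (0::complex)" "of_nat (Suc j') \<noteq> (0::complex)"
        by (simp_all del: of_nat_Suc)
      have "(of_nat (Suc j') - of_nat i :: complex) * (of_nat (Suc j') * sol_const (int i) (int (Suc j'))) = (of_nat (Suc j') - of_nat i) * (of_nat (k+1) * sol_const (int i) (int j'))"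
      proof (cases "i = Suc j'")
        case False
        then have "i \<le> Suc j' \<longleftrightarrow> i \<le> j'" by auto
        then have "of_nat (Suc j') * sol_const (int i) (int (Suc j')) = of_nat (k+1) * sol_const (int i) (int j')"
          unfolding sol_const_tail[OF k'(1)] sol_const_tail[OF k'(2)] using f
          by (simp add: field_simps del: of_nat_Suc)
        then show ?thesis by (simp only:)
      qed simp
      then show ?thesis unfolding z unfolding e sum by (simp add: ab ij(1) algebra_simps)
    qed
  qed
qed

definition log_sol :: log_series where
  "log_sol u = (if u \<in> scroll_lattice then log_form (sol_log0 (u 0) (u 2)) (sol_log1 (u 0) (u 2)) (sol_const (u 0) (u 2)) else 0)"

text \<open>
  Extension by zero, so that shifts by unit vectors, which leave the lattice, can be written uniformly.
\<close>

definition on_lattice :: "(int \<Rightarrow> int \<Rightarrow> complex) \<Rightarrow> (nat \<Rightarrow> int) \<Rightarrow> complex" where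
  "on_lattice T u = (if u \<in> scroll_lattice then T (u 0) (u 2) else 0)"

lemma log_sol_eq: "log_sol = (\<lambda>u. log_form (on_lattice sol_log0 u) (on_lattice sol_log1 u) (on_lattice sol_const u))"
  by (auto simp: log_sol_def on_lattice_def log_form_zero)

lemma on_lattice_rel_vec: "on_lattice T (rel_vec a b) = T a b"
  by (auto simp: on_lattice_def scroll_lattice_iff)

text \<open>
  The position from which \<open>\<partial>\<^sub>j \<partial>\<^sub>i\<close> reads: a derivation lowers the exponent, so the coefficient at \<open>u\<close>
  comes from \<open>u\<close> raised at \<open>i\<close> and \<open>j\<close>.
\<close>

definition up2 :: "nat \<Rightarrow> nat \<Rightarrow> (nat \<Rightarrow> int) \<Rightarrow> nat \<Rightarrow> int" where
  "up2 i j u m = u m + (if m = i then 1 else 0) + (if m = j then 1 else 0)"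

lemma d_act_twice:
  "d_act v j (d_act v i log_sol) u = (let w = up2 i j u; z = v j + of_int (u j + 1); y = v i + of_int (w i) in
     log_form (z * (y * on_lattice sol_log0 w)) (z * (y * on_lattice sol_log1 w))
       (z * (y * on_lattice sol_const w + on_lattice sol_log0 w * of_int (rel_vec 1 0 i) + on_lattice sol_log1 w * of_int (rel_vec 0 1 i))
         + y * on_lattice sol_log0 w * of_int (rel_vec 1 0 j) + y * on_lattice sol_log1 w * of_int (rel_vec 0 1 j)))"
proof -
  have w: "(u(j := u j + 1))(i := (u(j := u j + 1)) i + 1) = up2 i j u"
    by (auto simp: up2_def fun_eq_iff)
  have wi: "(u(j := u j + 1)) i + 1 = up2 i j u i" by (simp add: up2_def)
  show ?thesis unfolding log_sol_eq d_act_log_form Let_def w unfolding wi ..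
qed

text \<open>
  A box equation at \<open>u\<close> compares two lattice points that differ by the vector of the binomial, or
  compares zero with zero.
\<close>

lemma box_relation:
  assumes shift: "\<And>m. up2 i j u m = up2 k l u m + rel_vec p q m"
    and eqs: "\<And>a b. (\<And>m. up2 i j u m = rel_vec a b m) \<Longrightarrow> 
      (v j + of_int (u j + 1)) * ((v i + of_int (up2 i j u i)) * sol_log0 a b) = (v l + of_int (u l + 1)) * ((v k + of_int (up2 k l u k)) * sol_log0 (a - p) (b - q)) \<and>
      (v j + of_int (u j + 1)) * ((v i + of_int (up2 i j u i)) * sol_log1 a b) = (v l + of_int (u l + 1)) * ((v k + of_int (up2 k l u k)) * sol_log1 (a - p) (b - q)) \<and>
      (v j + of_int (u j + 1)) * ((v i + of_int (up2 i j u i)) * sol_const a b + sol_log0 a b * of_int (rel_vec 1 0 i) + sol_log1 a b * of_int (rel_vec 0 1 i))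
         + (v i + of_int (up2 i j u i)) * sol_log0 a b * of_int (rel_vec 1 0 j) + (v i + of_int (up2 i j u i)) * sol_log1 a b * of_int (rel_vec 0 1 j)
      = (v l + of_int (u l + 1)) * ((v k + of_int (up2 k l u k)) * sol_const (a - p) (b - q) + sol_log0 (a - p) (b - q) * of_int (rel_vec 1 0 k) + sol_log1 (a - p) (b - q) * of_int (rel_vec 0 1 k))
         + (v k + of_int (up2 k l u k)) * sol_log0 (a - p) (b - q) * of_int (rel_vec 1 0 l) + (v k + of_int (up2 k l u k)) * sol_log1 (a - p) (b - q) * of_int (rel_vec 0 1 l)"
  shows "d_act v j (d_act v i log_sol) u = d_act v l (d_act v k log_sol) u"
proof (cases "up2 i j u \<in> scroll_lattice")
  case True
  then obtain a b where ab: "up2 i j u = rel_vec a b" by (auto simp: scroll_lattice_iff)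
  have kl: "up2 k l u = rel_vec (a - p) (b - q)"
  proof
    fix m
    have "rel_vec a b m = up2 k l u m + rel_vec p q m" using shift[of m] ab by simp
    moreover have "rel_vec (a - p) (b - q) m + rel_vec p q m = rel_vec a b m"
      using fun_cong[OF rel_vec_arith(1)[of "a - p" "b - q" p q], of m] by simp
    ultimately show "up2 k l u m = rel_vec (a - p) (b - q) m" by simp
  qed
  have e: "\<And>m. up2 i j u m = rel_vec a b m" using ab by simp
  note E = eqs[OF e]
  show ?thesis
    unfolding d_act_twice Let_def
    unfolding arg_cong[OF ab, of "on_lattice _"] arg_cong[OF kl, of "on_lattice _"] on_lattice_rel_vec
    using E by (metis (no_types, lifting))
next
  case False
  have "up2 k l u \<notin> scroll_lattice"
  proof
    assume "up2 k l u \<in> scroll_lattice"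
    then obtain c d where "up2 k l u = rel_vec c d" by (auto simp: scroll_lattice_iff)
    then have "up2 i j u = rel_vec (c + p) (d + q)" unfolding rel_vec_arith(1)[symmetric] using shift by (auto simp: fun_eq_iff)
    then show False using False by (auto simp: scroll_lattice_iff)
  qed
  then have "on_lattice T (up2 i j u) = 0" "on_lattice T (up2 k l u) = 0" for T using False by (simp_all add: on_lattice_def)
  then show ?thesis unfolding d_act_twice Let_def by simp
qed

lemma op_power_two: "i < 5 \<Longrightarrow> j < 5 \<Longrightarrow> op_power 5 (d_act v) (var_exp i + var_exp j) p = d_act v j (d_act v i p)"
  using op_power_add_var[of "d_act v" j 5 "var_exp i" p, OF d_act_commute] op_power_add_var[of "d_act v" i 5 0 p, OF d_act_commute]
  by (simp del: One_nat_def)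

lemma up2_shift:
  assumes "i < 5" "j < 5" "k < 5" "l < 5"
    "\<forall>m<5. (if m = i then 1 else 0) + (if m = j then 1 else 0) = (if m = k then 1 else 0) + (if m = l then 1 else 0) + rel_vec p q m"
  shows "up2 i j u m = up2 k l u m + rel_vec p q m"
proof (cases "m < 5")
  case True
  then show ?thesis using assms(5) by (simp add: up2_def)
next
  case False
  then show ?thesis using assms by (auto simp: up2_def rel_vec_out)
qed

lemma scroll_binomial_annihilates:
  assumes "i < 3"
  shows "weyl_act 5 scroll_exponent (diff_op (scroll_binomial i)) log_sol = (\<lambda>_. 0)"
proof -
  let ?v = scroll_exponent
  have v: "?v m = of_int (scroll_exponent_int m)" for m by (simp add: scroll_exponent_def)
  have 0: "d_act ?v 2 (d_act ?v 0 log_sol) u = d_act ?v 1 (d_act ?v 1 log_sol) u" for u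
  proof (rule box_relation[where p = 1 and q = 1])
    fix a b assume e: "\<And>m. up2 0 2 u m = rel_vec a b m"
    have u: "u 0 = a - 1" "u 2 = b - 1" "u 1 = - a - b" using e[of 0] e[of 2] e[of 1] by (auto simp: up2_def)
    show "(?v 2 + of_int (u 2 + 1)) * ((?v 0 + of_int (up2 0 2 u 0)) * sol_log0 a b) = (?v 1 + of_int (u 1 + 1)) * ((?v 1 + of_int (up2 1 1 u 1)) * sol_log0 (a - 1) (b - 1)) \<and>
      (?v 2 + of_int (u 2 + 1)) * ((?v 0 + of_int (up2 0 2 u 0)) * sol_log1 a b) = (?v 1 + of_int (u 1 + 1)) * ((?v 1 + of_int (up2 1 1 u 1)) * sol_log1 (a - 1) (b - 1)) \<and>
      (?v 2 + of_int (u 2 + 1)) * ((?v 0 + of_int (up2 0 2 u 0)) * sol_const a b + sol_log0 a b * of_int (rel_vec 1 0 0) + sol_log1 a b * of_int (rel_vec 0 1 0))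
         + (?v 0 + of_int (up2 0 2 u 0)) * sol_log0 a b * of_int (rel_vec 1 0 2) + (?v 0 + of_int (up2 0 2 u 0)) * sol_log1 a b * of_int (rel_vec 0 1 2)
      = (?v 1 + of_int (u 1 + 1)) * ((?v 1 + of_int (up2 1 1 u 1)) * sol_const (a - 1) (b - 1) + sol_log0 (a - 1) (b - 1) * of_int (rel_vec 1 0 1) + sol_log1 (a - 1) (b - 1) * of_int (rel_vec 0 1 1))
         + (?v 1 + of_int (up2 1 1 u 1)) * sol_log0 (a - 1) (b - 1) * of_int (rel_vec 1 0 1) + (?v 1 + of_int (up2 1 1 u 1)) * sol_log1 (a - 1) (b - 1) * of_int (rel_vec 0 1 1)"
      using recurrence_log(1)[of b a] recurrence_log(2)[of b a] recurrence_const0[of b a]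
      unfolding up2_def u v by (simp add: u algebra_simps)
  qed (rule up2_shift; simp add: all_less5)
  have 1: "d_act ?v 4 (d_act ?v 0 log_sol) u = d_act ?v 3 (d_act ?v 1 log_sol) u" for u
  proof (rule box_relation[where p = 1 and q = 0])
    fix a b assume e: "\<And>m. up2 0 4 u m = rel_vec a b m"
    have u: "u 0 = a - 1" "u 4 = a - b - 1" "u 1 = - a - b" "u 3 = b - a" using e[of 0] e[of 4] e[of 1] e[of 3] by (auto simp: up2_def)
    show "(?v 4 + of_int (u 4 + 1)) * ((?v 0 + of_int (up2 0 4 u 0)) * sol_log0 a b) = (?v 3 + of_int (u 3 + 1)) * ((?v 1 + of_int (up2 1 3 u 1)) * sol_log0 (a - 1) (b - 0)) \<and>
      (?v 4 + of_int (u 4 + 1)) * ((?v 0 + of_int (up2 0 4 u 0)) * sol_log1 a b) = (?v 3 + of_int (u 3 + 1)) * ((?v 1 + of_int (up2 1 3 u 1)) * sol_log1 (a - 1) (b - 0)) \<and>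
      (?v 4 + of_int (u 4 + 1)) * ((?v 0 + of_int (up2 0 4 u 0)) * sol_const a b + sol_log0 a b * of_int (rel_vec 1 0 0) + sol_log1 a b * of_int (rel_vec 0 1 0))
         + (?v 0 + of_int (up2 0 4 u 0)) * sol_log0 a b * of_int (rel_vec 1 0 4) + (?v 0 + of_int (up2 0 4 u 0)) * sol_log1 a b * of_int (rel_vec 0 1 4)
      = (?v 3 + of_int (u 3 + 1)) * ((?v 1 + of_int (up2 1 3 u 1)) * sol_const (a - 1) (b - 0) + sol_log0 (a - 1) (b - 0) * of_int (rel_vec 1 0 1) + sol_log1 (a - 1) (b - 0) * of_int (rel_vec 0 1 1))
         + (?v 1 + of_int (up2 1 3 u 1)) * sol_log0 (a - 1) (b - 0) * of_int (rel_vec 1 0 3) + (?v 1 + of_int (up2 1 3 u 1)) * sol_log1 (a - 1) (b - 0) * of_int (rel_vec 0 1 3)"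
      using recurrence_log(3)[of a b] recurrence_log(4)[of a b] recurrence_const1[of a b]
      unfolding up2_def u v by (simp add: u algebra_simps)
  qed (rule up2_shift; simp add: all_less5)
  have 2: "d_act ?v 3 (d_act ?v 2 log_sol) u = d_act ?v 4 (d_act ?v 1 log_sol) u" for u
  proof (rule box_relation[where p = 0 and q = 1])
    fix a b assume e: "\<And>m. up2 2 3 u m = rel_vec a b m"
    have u: "u 2 = b - 1" "u 4 = a - b" "u 1 = - a - b" "u 3 = b - a - 1" using e[of 2] e[of 4] e[of 1] e[of 3] by (auto simp: up2_def)
    show "(?v 3 + of_int (u 3 + 1)) * ((?v 2 + of_int (up2 2 3 u 2)) * sol_log0 a b) = (?v 4 + of_int (u 4 + 1)) * ((?v 1 + of_int (up2 1 4 u 1)) * sol_log0 (a - 0) (b - 1)) \<and>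
      (?v 3 + of_int (u 3 + 1)) * ((?v 2 + of_int (up2 2 3 u 2)) * sol_log1 a b) = (?v 4 + of_int (u 4 + 1)) * ((?v 1 + of_int (up2 1 4 u 1)) * sol_log1 (a - 0) (b - 1)) \<and>
      (?v 3 + of_int (u 3 + 1)) * ((?v 2 + of_int (up2 2 3 u 2)) * sol_const a b + sol_log0 a b * of_int (rel_vec 1 0 2) + sol_log1 a b * of_int (rel_vec 0 1 2))
         + (?v 2 + of_int (up2 2 3 u 2)) * sol_log0 a b * of_int (rel_vec 1 0 3) + (?v 2 + of_int (up2 2 3 u 2)) * sol_log1 a b * of_int (rel_vec 0 1 3)
      = (?v 4 + of_int (u 4 + 1)) * ((?v 1 + of_int (up2 1 4 u 1)) * sol_const (a - 0) (b - 1) + sol_log0 (a - 0) (b - 1) * of_int (rel_vec 1 0 1) + sol_log1 (a - 0) (b - 1) * of_int (rel_vec 0 1 1))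
         + (?v 1 + of_int (up2 1 4 u 1)) * sol_log0 (a - 0) (b - 1) * of_int (rel_vec 1 0 4) + (?v 1 + of_int (up2 1 4 u 1)) * sol_log1 (a - 0) (b - 1) * of_int (rel_vec 0 1 4)"
      using recurrence_log(5)[of b a] recurrence_log(6)[of b a] recurrence_const2[of b a]
      unfolding up2_def u v by (simp add: u algebra_simps)
  qed (rule up2_shift; simp add: all_less5)
  have "op_power 5 (d_act ?v) (lead_exp i) log_sol = op_power 5 (d_act ?v) (trail_exp i) log_sol"
    using less3_cases[OF assms] 0 1 2 by (elim disjE) (simp_all add: lead_trail_simps op_power_two fun_eq_iff del: One_nat_def)
  then have ma: "monomial_act 5 ?v (0, lead_exp i) log_sol = monomial_act 5 ?v (0, trail_exp i) log_sol"
    by (simp add: monomial_act_eq)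
  have eq: "diff_op (scroll_binomial i) = Poly_Mapping.single (0, lead_exp i) 1 + Poly_Mapping.single (0, trail_exp i) (-1)"
  proof -
    have "scroll_binomial i = Poly_Mapping.single (lead_exp i) 1 + Poly_Mapping.single (trail_exp i) (-1)"
      by (simp add: scroll_binomial_def single_uminus)
    then show ?thesis by (simp add: diff_op_lin lin_add mult_single)
  qed
  show ?thesis unfolding eq weyl_act_add weyl_act_single ma
    by (simp add: mp_const_eq single_uminus single_one)
qed

text \<open>
  The exponents \<open>v + u\<close> have the same degree \<open>\<beta>\<close> for all relations \<open>u\<close>, and the logarithmic forms are
  orthogonal to the rows.
\<close>

lemma euler_annihilates:
  assumes "i < 3"
  shows "weyl_act 5 scroll_exponent (euler_op 5 scroll_matrix scroll_beta i) log_sol = (\<lambda>_. 0)"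
proof
  fix u
  let ?v = scroll_exponent
  have xd: "monomial_act 5 ?v (var_exp j, var_exp j) log_sol u = log_form ((?v j + of_int (u j)) * on_lattice sol_log0 u) ((?v j + of_int (u j)) * on_lattice sol_log1 u)
      ((?v j + of_int (u j)) * on_lattice sol_const u + on_lattice sol_log0 u * of_int (rel_vec 1 0 j) + on_lattice sol_log1 u * of_int (rel_vec 0 1 j))" if "j < 5" for j
  proof -
    have "monomial_act 5 ?v (0 + var_exp j, 0 + var_exp j) log_sol u = x_act j (d_act ?v j log_sol) u"
      unfolding monomial_act_eq op_power_add_var[of "d_act ?v", OF d_act_commute that] op_power_add_var[of x_act, OF x_act_commute that] by simp
    then show ?thesis unfolding log_sol_eq d_act_log_form by (simp add: x_act_def Let_def)
  qed
  have E: "weyl_act 5 ?v (euler_op 5 scroll_matrix scroll_beta i) log_sol u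
     = (\<Sum>j<5. mp_const (of_int (scroll_matrix i j)) * monomial_act 5 ?v (var_exp j, var_exp j) log_sol u) + mp_const (- scroll_beta i) * log_sol u"
  proof -
    have e: "euler_op 5 scroll_matrix scroll_beta i = (\<Sum>j<5. Poly_Mapping.single (var_exp j, var_exp j) (of_int (scroll_matrix i j))) + Poly_Mapping.single (0, 0) (- scroll_beta i)"
      by (simp add: euler_op_def single_uminus)
    show ?thesis unfolding e weyl_act_lin lin_add lin_sum lin_single mp_const_eq by (simp add: monomial_act_eq)
  qed
  show "weyl_act 5 ?v (euler_op 5 scroll_matrix scroll_beta i) log_sol u = 0"
  proof (cases "u \<in> scroll_lattice")
    case False
    then have "on_lattice T u = 0" for T by (simp add: on_lattice_def)
    moreover have "log_sol u = 0" using False by (simp add: log_sol_def)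
    ultimately show ?thesis unfolding E sum_less5 by (simp add: xd log_form_zero del: One_nat_def)
  next
    case True
    then obtain a b where u: "u = rel_vec a b" by (auto simp: scroll_lattice_iff)
    have ls: "log_sol u = log_form (sol_log0 a b) (sol_log1 a b) (sol_const a b)" by (simp add: log_sol_eq u on_lattice_rel_vec)
    have less5: "0 < (5::nat)" "1 < (5::nat)" "2 < (5::nat)" "3 < (5::nat)" "4 < (5::nat)" by simp_all
    have ol: "on_lattice T u = T a b" for T by (simp add: u on_lattice_rel_vec)
    have ui: "u 0 = a" "u 1 = - a - b" "u 2 = b" "u 3 = b - a" "u 4 = a - b" by (simp_all add: u)
    have "weyl_act 5 ?v (euler_op 5 scroll_matrix scroll_beta i) log_sol u
      = log_form 0 0 0"
      unfolding E sum_less5 xd[of 0, OF less5(1)] xd[of 1, OF less5(2)] xd[of 2, OF less5(3)] xd[of 3, OF less5(4)] xd[of 4, OF less5(5)]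
        ls ol ui log_form_scale log_form_add
      using less3_cases[OF assms]
      by (elim disjE; intro log_form_cong; simp add: scroll_exponent_def scroll_beta_def algebra_simps)
    then show ?thesis by (simp add: log_form_zero)
  qed
qed

lemma log_form_polys: "log_form a b c \<in> polys 5"
  unfolding log_form_def mp_var_def mp_const_eq
  by (intro polys_closed) (simp_all add: var_exp_exps_of_iff del: One_nat_def)

lemma log_sol_support: "log_sol u \<noteq> 0 \<Longrightarrow> u \<in> scroll_lattice \<and> nsupp_at 5 scroll_exponent u \<in> scroll_family"
proof -
  assume nz: "log_sol u \<noteq> 0"
  then have "u \<in> scroll_lattice" unfolding log_sol_def by presburger
  then obtain a b where u: "u = rel_vec a b" by (auto simp: scroll_lattice_iff)
  have "a \<ge> 0 \<and> b \<ge> 0"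
  proof (rule ccontr)
    assume "\<not> ?thesis"
    then have "a < 0 \<or> b < 0" by auto
    then have "log_sol u = 0" by (simp add: u log_sol_eq on_lattice_rel_vec tail_zero log_form_zero)
    with nz show False by simp
  qed
  then show ?thesis using \<open>u \<in> scroll_lattice\<close> by (simp add: u nsupp_at_rel_vec supp_in_family)
qed

theorem ambient_contains_log:
  "log_form 0 1 0 \<in> ambient_coefficient_space 3 5 scroll_matrix scroll_beta scroll_exponent scroll_family"
proof -
  have "hypergeometric_ideal 3 5 scroll_matrix scroll_beta \<subseteq> {P \<in> weyl_algebra 5. weyl_act 5 scroll_exponent P log_sol = (\<lambda>_. 0)}"
    by (rule hypergeometric_subset[OF annihilator_left_ideal])
       (auto simp: scroll_binomial_annihilates euler_annihilates euler_op_closed intro: diff_op_closed scroll_binomial_polys)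
  moreover have "log_sol (\<lambda>_. 0) = log_form 0 1 0"
  proof -
    have "(\<lambda>_. 0) = rel_vec 0 0" by (simp add: fun_eq_iff)
    then have "log_sol (\<lambda>_. 0) = log_sol (rel_vec 0 0)" by simp
    then show ?thesis by (simp add: log_sol_eq on_lattice_rel_vec sol_log0_def sol_log1_def sol_const_def)
  qed
  moreover have "log_sol u \<in> polys 5" for u using log_form_polys by (simp add: log_sol_eq)
  ultimately show ?thesis unfolding ambient_coefficient_space_def
    using log_sol_support by (intro CollectI exI[of _ log_sol]) auto
qed

section \<open>The intrinsic coefficient space\<close>

lemma add_eq_var_exp: "a + b = var_exp j \<longleftrightarrow> (a = var_exp j \<and> b = 0) \<or> (a = 0 \<and> b = var_exp j)"
proof
  assume "a + b = var_exp j"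
  then have l: "lookup a i + lookup b i = (if i = j then 1 else 0)" for i
    by (metis lookup_add lookup_var_exp)
  show "(a = var_exp j \<and> b = 0) \<or> (a = 0 \<and> b = var_exp j)"
  proof (cases "lookup a j = 0")
    case True
    have "lookup a i = 0" for i using l[of i] True by (cases "i = j") auto
    then have "a = 0" by (intro exps_eqI) simp
    moreover have "b = var_exp j" using l \<open>a = 0\<close> by (intro exps_eqI) (simp add: lookup_single when_def)
    ultimately show ?thesis by simp
  next
    case False
    then have "lookup b j = 0" using l[of j] by simp
    then have "lookup b i = 0" for i using l[of i] by (cases "i = j") auto
    then have "b = 0" by (intro exps_eqI) simp
    moreover have "a = var_exp j" using l \<open>b = 0\<close> by (intro exps_eqI) (simp add: lookup_single when_def)
    ultimately show ?thesis by simp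
  qed
qed auto

lemma add_eq_zero_exps: "(a :: exps) + b = 0 \<longleftrightarrow> a = 0 \<and> b = 0"
proof
  assume "a + b = 0"
  then have "lookup a i + lookup b i = 0" for i by (metis lookup_add lookup_zero)
  then show "a = 0 \<and> b = 0" by (auto intro!: exps_eqI)
qed simp

text \<open>
  Terms of degree at most one in a product; only these are needed to read off a coefficient of one
  logarithm.
\<close>

lemma lookup_mult_low:
  fixes p q :: "complex mpoly"
  shows "lookup (p * q) 0 = lookup p 0 * lookup q 0 \<and>
    lookup (p * q) (var_exp j) = lookup p (var_exp j) * lookup q 0 + lookup p 0 * lookup q (var_exp j)"
proof (induction p rule: poly_mapping_additive_induct)
  case (single k c)
  show ?case
  proof (induction q rule: poly_mapping_additive_induct)
    case (single l d)
    have "var_exp j \<noteq> 0" by (metis lookup_single_eq lookup_zero zero_neq_one)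
    then show ?case using add_eq_var_exp[of k l j] add_eq_zero_exps[of k l]
      by (auto simp: mult_single lookup_single when_def simp del: One_nat_def)
  qed (auto simp: distrib_left distrib_right lookup_add algebra_simps)
qed (auto simp: distrib_right lookup_add algebra_simps)

lemma lookup_power_low:
  fixes p :: "complex mpoly"
  assumes "lookup p 0 = 0"
  shows "lookup (p ^ k) 0 = (if k = 0 then 1 else 0) \<and> lookup (p ^ k) (var_exp j) = (if k = 1 then lookup p (var_exp j) else 0)"
proof (induction k)
  case 0
  have "var_exp j \<noteq> 0" by (metis lookup_single_eq lookup_zero zero_neq_one)
  then show ?case by (simp add: lookup_one when_def del: One_nat_def)
next
  case (Suc k)
  then show ?case using lookup_mult_low[of p "p ^ k"] assms by (auto simp del: One_nat_def)
qed

lemma of_int_mpoly: "(of_int z :: complex mpoly) = Poly_Mapping.single 0 (of_int z)"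
  by simp

lemma lookup_of_int_mult: "lookup (of_int z * p) k = of_int z * lookup (p :: complex mpoly) k"
  unfolding of_int_mpoly by (rule lookup_scale)

lemma lookup_gale_log:
  "lookup (\<Sum>j<5. of_int (scroll_gale j i) * mp_var j :: complex mpoly) 0 = 0"
  "lookup (\<Sum>j<5. of_int (scroll_gale j i) * mp_var j :: complex mpoly) (var_exp 2) = of_int (scroll_gale 2 i)"
  by (simp_all add: sum_less5 lookup_add lookup_of_int_mult mp_var_def lookup_single when_def var_exp_eq)

text \<open>
  In \<open>x\<^bsup>Bs\<^esup>\<close> the logarithm \<open>y\<^sub>2\<close> occurs alone only in the linear term, with factor \<open>(Bs)\<^sub>2 = s\<^sub>1\<close>.
\<close>

lemma lookup_x_power:
  "lookup (mfps_nth (x_power_Bs 5 2 scroll_gale) k) (var_exp 2) = (if k = var_exp 1 then 1 else 0)"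
proof (cases "k \<in> exps_of 2")
  case False
  then have "k \<noteq> var_exp 1" by (auto simp: var_exp_exps_of_iff simp del: One_nat_def)
  then show ?thesis using False by (simp add: x_power_Bs_def del: One_nat_def)
next
  case True
  let ?L = "\<lambda>i. \<Sum>j<5. of_int (scroll_gale j i) * mp_var j :: complex mpoly"
  note low = lookup_power_low[OF lookup_gale_log(1)]
  have "lookup (?L 0 ^ lookup k 0 * ?L 1 ^ lookup k 1) (var_exp 2) = (if lookup k 0 = 0 \<and> lookup k 1 = 1 then 1 else 0)"
    unfolding lookup_mult_low[THEN conjunct2] low[THEN conjunct1] low[THEN conjunct2] lookup_gale_log(2)
    by (auto simp: scroll_gale_def)
  moreover have "lookup k 0 = 0 \<and> lookup k 1 = 1 \<longleftrightarrow> k = var_exp 1"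
  proof
    assume *: "lookup k 0 = 0 \<and> lookup k 1 = 1"
    show "k = var_exp 1"
    proof (rule exps_eqI)
      fix j show "lookup k j = lookup (var_exp 1) j"
        using * True by (cases "j < 2") (auto simp: less_2_cases_iff lookup_single when_def exps_of_lookup)
    qed
  qed (simp add: lookup_single)
  moreover have "exp_fact (var_exp 1) = 1" by (simp add: exp_fact_def)
  moreover have "mfps_nth (x_power_Bs 5 2 scroll_gale) k = mp_const (1 / of_nat (exp_fact k)) * (?L 0 ^ lookup k 0 * ?L 1 ^ lookup k 1)"
    using True by (simp add: x_power_Bs_def numeral_2_eq_2)
  ultimately show ?thesis by (simp add: mp_const_eq lookup_scale del: One_nat_def)
qed

text \<open>
  At \<open>u = 0\<close> both products are empty, and \<open>m(s) = (Bs)\<^sub>4 = s\<^sub>0 - s\<^sub>1\<close> remains.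
\<close>

lemma psi_factor_zero: "psi_factor 5 2 scroll_gale scroll_exponent scroll_family (\<lambda>_. 0) = gale_form 2 scroll_gale 4"
proof -
  have z: "pos_part (\<lambda>_. 0) = 0" "neg_part (\<lambda>_. 0) = 0" by (simp_all add: pos_part_def neg_part_def)
  have f: "falling x 0 = 1" for x :: "nat \<Rightarrow> complex mfps" by (simp add: falling_def)
  show ?thesis unfolding psi_factor_def z f e_monomial_families
    by (rule the_equality) (auto simp: Phi_var series_gale_form)
qed

lemma Psi_zero:
  "Psi 3 5 2 scroll_matrix scroll_gale scroll_exponent scroll_family (\<lambda>_. 0) = (mfps_var 0 - mfps_var 1) * x_power_Bs 5 2 scroll_gale"
proof -
  have u: "(\<lambda>_. 0) = rel_vec 0 0" by (simp add: fun_eq_iff)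
  have "rel_vec 0 0 \<in> scroll_lattice" by (auto simp: scroll_lattice_iff)
  moreover have "nsupp_at 5 scroll_exponent (rel_vec 0 0) \<in> scroll_family" by (simp add: nsupp_at_rel_vec supp_in_family)
  moreover have "Abs_mfps (\<lambda>k. mp_const (mfps_nth (gale_form 2 scroll_gale 4) k)) = (mfps_var 0 - mfps_var 1 :: complex mpoly mfps)"
  proof (rule mfps_eqI)
    fix m
    have "mfps_nth (gale_form 2 scroll_gale 4) m = mfps_nth (mfps_var 0) m - mfps_nth (mfps_var 1) m"
      by (simp add: gale_form_def sum_less2 mfps_nth_of_int_mult scroll_gale_def del: One_nat_def)
    then show "mfps_nth (Abs_mfps (\<lambda>k. mp_const (mfps_nth (gale_form 2 scroll_gale 4) k))) m
       = mfps_nth (mfps_var 0 - mfps_var 1 :: complex mpoly mfps) m"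
      by (simp add: mfps_nth_var mp_const_eq single_one single_uminus del: One_nat_def)
  qed
  ultimately show ?thesis unfolding Psi_def psi_factor_zero by (simp add: u[symmetric])
qed

text \<open>
  The coefficient of \<open>x\<^sup>v y\<^sub>2\<close> in \<open>\<Psi>\<close> is \<open>(Bs)\<^sub>4 (Bs)\<^sub>2 = (s\<^sub>0 - s\<^sub>1) s\<^sub>1\<close>.
\<close>

lemma lookup_Psi_zero:
  "lookup (mfps_nth (Psi 3 5 2 scroll_matrix scroll_gale scroll_exponent scroll_family (\<lambda>_. 0)) k) (var_exp 2)
   = lookup (Poly_Mapping.single (var_exp 0 + var_exp 1) 1 - Poly_Mapping.single (var_exp 1 + var_exp 1) 1 :: complex mpoly) k"
proof -
  have e: "lookup k i > 0 \<and> k - var_exp i = var_exp 1 \<longleftrightarrow> var_exp i + var_exp 1 = k" for i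
  proof
    assume *: "lookup k i > 0 \<and> k - var_exp i = var_exp 1"
    have "k = var_exp i + (k - var_exp i)"
      by (intro exps_eqI) (use conjunct1[OF *] in \<open>auto simp: lookup_add lookup_minus lookup_single when_def\<close>)
    then show "var_exp i + var_exp 1 = k" using * by simp
  qed (auto simp: lookup_add lookup_single)
  have v: "lookup (mfps_nth (mfps_var i * x_power_Bs 5 2 scroll_gale) k) (var_exp 2) = lookup (Poly_Mapping.single (var_exp i + var_exp 1) (1::complex)) k" for i
    unfolding mfps_nth_var_mult using e[of i] by (auto simp: lookup_x_power lookup_single when_def simp del: One_nat_def)
  have "mfps_nth (Psi 3 5 2 scroll_matrix scroll_gale scroll_exponent scroll_family (\<lambda>_. 0)) k
     = mfps_nth (mfps_var 0 * x_power_Bs 5 2 scroll_gale) k - mfps_nth (mfps_var 1 * x_power_Bs 5 2 scroll_gale) k"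
    unfolding Psi_zero left_diff_distrib minus_mfps.rep_eq ..
  then show ?thesis unfolding lookup_minus by (simp only: lookup_minus v)
qed

text \<open>
  It is \<open>- (Bs)\<^sub>2 (Bs)\<^sub>3\<close>, the negative of the generator for \<open>I = {3}\<close> and \<open>J = {2, 3}\<close>.
\<close>

lemma P_poly_element:
  "Poly_Mapping.single (var_exp 0 + var_exp 1) 1 - Poly_Mapping.single (var_exp 1 + var_exp 1) 1
    \<in> P_poly_ideal 3 5 2 scroll_matrix scroll_gale scroll_exponent scroll_family"
proof -
  let ?g = "\<Prod>j\<in>{3} \<union> {2, 3} - \<Inter>scroll_family. gale_poly 2 scroll_gale j"
  have S: "{3} \<union> {2, 3} - \<Inter>scroll_family = {2, 3::nat}" by (auto simp: Inter_families)
  have "{3} \<in> scroll_family" by (simp add: scroll_family_def)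
  moreover have "{2, 3} \<in> nsupps 3 5 scroll_matrix scroll_exponent - scroll_family"
    using outside_family_examples(2) family_subset(2) by blast
  ultimately have g: "?g \<in> {\<Prod>j\<in>(I \<union> J) - \<Inter>scroll_family. gale_poly 2 scroll_gale j | I J. I \<in> scroll_family \<and> J \<in> nsupps 3 5 scroll_matrix scroll_exponent - scroll_family}"
    by blast
  have "Poly_Mapping.single 0 (-1) * ?g \<in> P_poly_ideal 3 5 2 scroll_matrix scroll_gale scroll_exponent scroll_family"
    unfolding P_poly_ideal_def by (rule left_ideal_gen_incl[OF _ g]) (simp add: polys_closed)
  moreover have "Poly_Mapping.single 0 (-1) * ?g = Poly_Mapping.single (var_exp 0 + var_exp 1) 1 - Poly_Mapping.single (var_exp 1 + var_exp 1) (1::complex)"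
    unfolding S by (simp add: gale_poly_def sum_less2 scroll_gale_def mp_var_def mult_single algebra_simps single_uminus del: One_nat_def)
  ultimately show ?thesis by simp
qed

text \<open>
  The coefficient of \<open>y\<^sub>2\<close> is the pairing of \<open>q\<close> with \<open>(Bs)\<^sub>4 (Bs)\<^sub>2\<close>.  As \<open>(Bs)\<^sub>4 = - (Bs)\<^sub>3\<close>, this form
  belongs to the ideal that \<open>q\<close> is orthogonal to.
\<close>

lemma intrinsic_no_log:
  assumes "p \<in> intrinsic_coefficient_space 3 5 2 scroll_matrix scroll_gale scroll_exponent scroll_family"
  shows "lookup p (var_exp 2) = 0"
proof -
  let ?P = "Psi 3 5 2 scroll_matrix scroll_gale scroll_exponent scroll_family (\<lambda>_. 0)"
  obtain q where q: "q \<in> orth_complement 2 (P_poly_ideal 3 5 2 scroll_matrix scroll_gale scroll_exponent scroll_family)"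
    "p = intrinsic_series 3 5 2 scroll_matrix scroll_gale scroll_exponent scroll_family q (\<lambda>_. 0)"
    using assms by (auto simp: intrinsic_coefficient_space_def)
  have "lookup p (var_exp 2) = (\<Sum>k\<in>keys q. lookup q k * of_nat (exp_fact k) * lookup (mfps_nth ?P k) (var_exp 2))"
    unfolding q(2) intrinsic_series_def lookup_sum mp_const_eq lookup_scale ..
  also have "\<dots> = 0"
    unfolding lookup_Psi_zero using q(1) P_poly_element unfolding orth_complement_def by blast
  finally show ?thesis .
qed

section \<open>The example\<close>

lemma lookup_log_form: "lookup (log_form 0 1 0) (var_exp 2) = 1"
  by (simp add: log_form_def mp_const_eq single_one mp_var_def lookup_add lookup_minus lookup_single when_def var_exp_eq)

lemma generic_direction_scroll:
  assumes "w \<in> topspace (Euclidean_space 5)" "leading_weight w"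
    "\<And>m :: nat \<Rightarrow> int. (\<Sum>j<5. w j * of_int (m j)) = 0 \<Longrightarrow> \<forall>j<5. m j = 0"
  shows "generic_direction 3 5 scroll_matrix \<beta> w"
  unfolding generic_direction_def
proof (intro conjI assms(1) independent_weight_in_interior[OF hypergeometric_closed assms(1,3)])
  show "monomial_ideal 5 (initial_ideal 5 w toric)"
    unfolding monomial_ideal_def initial_ideal_scroll[OF assms(2)]
    by (rule exI[of _ "lead_exp ` {..<3}"]) (auto simp: lead_ideal_def lead_trail_exps_of)
qed

lemma scroll_example:
  assumes w: "w \<in> topspace (Euclidean_space 5)" "scroll_weight w"
    "\<And>m :: nat \<Rightarrow> int. (\<Sum>j<5. w j * of_int (m j)) = 0 \<Longrightarrow> \<forall>j<5. m j = 0"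
  shows "homogeneous_matrix 3 5 scroll_matrix \<and> scroll_beta \<in> vectors 3 \<and>
     generic_direction 3 5 scroll_matrix scroll_beta w \<and>
     fake_exponent 3 5 scroll_matrix scroll_beta w scroll_exponent \<and>
     negative_support_family 3 5 scroll_matrix w scroll_exponent scroll_family \<and>
     ordered_family 3 5 scroll_matrix scroll_exponent scroll_family \<and>
     gale_dual 3 5 (5 - 3) scroll_matrix scroll_gale \<and>
     groebner_vectors 3 5 scroll_matrix w scroll_vecs \<and>
     Phi 5 (5 - 3) scroll_gale ` colon (series 5) (Q_ideal 3 5 scroll_matrix scroll_exponent scroll_family) (e_monomial 5 scroll_exponent scroll_family)
       \<subset> colon (series (5 - 3)) (Phi 5 (5 - 3) scroll_gale ` P_ideal 3 5 scroll_matrix scroll_exponent scroll_family)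
            (Phi 5 (5 - 3) scroll_gale (e_monomial 5 scroll_exponent scroll_family)) \<and>
     normal_semigroup scroll_vecs \<and>
     quotient_has_dim (obstruction_num 3 5 scroll_matrix scroll_exponent scroll_family) (obstruction_den 3 5 scroll_matrix scroll_exponent scroll_family) 1 \<and>
     (let \<N>v = distinguished_collection 3 5 scroll_matrix w scroll_exponent in
        \<not> ordered_family 3 5 scroll_matrix scroll_exponent \<N>v \<and>
        M_ideal 5 \<N>v = M_ideal 5 scroll_family \<and>
        P_ideal 3 5 scroll_matrix scroll_exponent \<N>v = P_ideal 3 5 scroll_matrix scroll_exponent scroll_family \<and>
        e_monomial 5 scroll_exponent \<N>v = e_monomial 5 scroll_exponent scroll_family \<and>
        obstruction_module 3 5 scroll_matrix scroll_exponent \<N>v = obstruction_module 3 5 scroll_matrix scroll_exponent scroll_family) \<and>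
     (\<exists>p \<in> ambient_coefficient_space 3 5 scroll_matrix scroll_beta scroll_exponent scroll_family.
        involves_logs p \<and> p \<notin> intrinsic_coefficient_space 3 5 (5 - 3) scroll_matrix scroll_gale scroll_exponent scroll_family)"
proof -
  have good: "leading_weight w" using w(2) by (simp add: scroll_weight_def)
  have two: "5 - 3 = (2::nat)" by simp
  note N = M_ideal_families P_ideal_families Q_ideal_families
  have num: "obstruction_num 3 5 scroll_matrix scroll_exponent \<N> = {g \<in> R5. mfps_nth g 0 = 0}"
    and den: "obstruction_den 3 5 scroll_matrix scroll_exponent \<N> = {g \<in> R5. mfps_nth g 0 = 0 \<and> dual4 g = 0}"
    and e: "e_monomial 5 scroll_exponent \<N> = t 4"
    if "\<N> = scroll_family \<or> \<N> = full_family" for \<N>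
  proof -
    show e: "e_monomial 5 scroll_exponent \<N> = t 4" using that e_monomial_families by blast
    show "obstruction_num 3 5 scroll_matrix scroll_exponent \<N> = {g \<in> R5. mfps_nth g 0 = 0}"
      unfolding obstruction_num_def U_ideal_scroll P_ideal_families[OF that] e by (rule num_scroll)
    show "obstruction_den 3 5 scroll_matrix scroll_exponent \<N> = {g \<in> R5. mfps_nth g 0 = 0 \<and> dual4 g = 0}"
      unfolding obstruction_den_def Q_ideal_families[OF that] e by (rule den_scroll)
  qed
  have "negative_support_family 3 5 scroll_matrix w scroll_exponent scroll_family"
    unfolding negative_support_family_def distinguished_scroll[OF w(2)] nsupp_scroll_exponent
    by (auto simp: full_family_def scroll_family_def)
  moreover have "Phi 5 2 scroll_gale ` colon R5 (Q_ideal 3 5 scroll_matrix scroll_exponent scroll_family) (e_monomial 5 scroll_exponent scroll_family)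
       \<subset> colon (series 2) (Phi 5 2 scroll_gale ` P_ideal 3 5 scroll_matrix scroll_exponent scroll_family)
            (Phi 5 2 scroll_gale (e_monomial 5 scroll_exponent scroll_family))"
    using strict_inclusion by (simp add: Q_ideal_families P_ideal_families e_monomial_families)
  moreover have "quotient_has_dim (obstruction_num 3 5 scroll_matrix scroll_exponent scroll_family) (obstruction_den 3 5 scroll_matrix scroll_exponent scroll_family) 1"
    using obstruction_dim by (simp add: num den)
  moreover have "let \<N>v = distinguished_collection 3 5 scroll_matrix w scroll_exponent in
        \<not> ordered_family 3 5 scroll_matrix scroll_exponent \<N>v \<and>
        M_ideal 5 \<N>v = M_ideal 5 scroll_family \<and>
        P_ideal 3 5 scroll_matrix scroll_exponent \<N>v = P_ideal 3 5 scroll_matrix scroll_exponent scroll_family \<and>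
        e_monomial 5 scroll_exponent \<N>v = e_monomial 5 scroll_exponent scroll_family \<and>
        obstruction_module 3 5 scroll_matrix scroll_exponent \<N>v = obstruction_module 3 5 scroll_matrix scroll_exponent scroll_family"
    unfolding distinguished_scroll[OF w(2)] Let_def obstruction_module_def
    using not_ordered_full by (simp add: num den e N)
  moreover have "involves_logs (log_form 0 1 0)"
    unfolding involves_logs_def
    by (rule bexI[of _ "var_exp 2"]) (use lookup_log_form in \<open>simp_all add: in_keys_iff var_exp_eq\<close>)
  moreover have "log_form 0 1 0 \<notin> intrinsic_coefficient_space 3 5 2 scroll_matrix scroll_gale scroll_exponent scroll_family"
    using intrinsic_no_log[of "log_form 0 1 0"] lookup_log_form by auto
  ultimately show ?thesis
    unfolding two
    using homogeneous_scroll scroll_beta_vectors generic_direction_scroll[OF w(1) good w(3)] fake_exponent_scroll[OF good]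
      ordered_scroll gale_dual_scroll groebner_vectors_scroll[OF good] normal_scroll ambient_contains_log
    by blast
qed

theorem theorem5p1:
  shows "\<exists>(d::nat) (n::nat) (A :: nat \<Rightarrow> nat \<Rightarrow> int) (\<beta> :: nat \<Rightarrow> complex) (w :: nat \<Rightarrow> real)
           (v :: nat \<Rightarrow> complex) (B :: nat \<Rightarrow> nat \<Rightarrow> int) (G :: (nat \<Rightarrow> int) set) (\<N> :: nat set set).
     homogeneous_matrix d n A \<and> \<beta> \<in> vectors d \<and>
     generic_direction d n A \<beta> w \<and>
     fake_exponent d n A \<beta> w v \<and>
     negative_support_family d n A w v \<N> \<and>
     ordered_family d n A v \<N> \<and>
     gale_dual d n (n - d) A B \<and>
     groebner_vectors d n A w G \<and>
     Phi n (n - d) B ` colon (series n) (Q_ideal d n A v \<N>) (e_monomial n v \<N>)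
       \<subset> colon (series (n - d)) (Phi n (n - d) B ` P_ideal d n A v \<N>)
            (Phi n (n - d) B (e_monomial n v \<N>)) \<and>
     normal_semigroup G \<and>
     quotient_has_dim (obstruction_num d n A v \<N>) (obstruction_den d n A v \<N>) 1 \<and>
     (let \<N>v = distinguished_collection d n A w v in
        \<not> ordered_family d n A v \<N>v \<and>
        M_ideal n \<N>v = M_ideal n \<N> \<and>
        P_ideal d n A v \<N>v = P_ideal d n A v \<N> \<and>
        e_monomial n v \<N>v = e_monomial n v \<N> \<and>
        obstruction_module d n A v \<N>v = obstruction_module d n A v \<N>) \<and>
     (\<exists>p \<in> ambient_coefficient_space d n A \<beta> v \<N>.
        involves_logs p \<and> p \<notin> intrinsic_coefficient_space d n (n - d) A B v \<N>)"
proof -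
  obtain w where w: "w \<in> topspace (Euclidean_space 5)" "scroll_weight w"
    "\<forall>m :: nat \<Rightarrow> int. (\<Sum>j<5. w j * of_int (m j)) = 0 \<longrightarrow> (\<forall>j<5. m j = 0)"
    using ex_scroll_weight by blast
  show ?thesis
    by (rule exI[of _ 3], rule exI[of _ 5], rule exI[of _ scroll_matrix], rule exI[of _ scroll_beta], rule exI[of _ w],
        rule exI[of _ scroll_exponent], rule exI[of _ scroll_gale], rule exI[of _ scroll_vecs], rule exI[of _ scroll_family],
        rule scroll_example[OF w(1,2) w(3)[THEN spec, THEN mp]])
qed

end
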